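(* For $1\le p\le\infty$ let $p'$ denote the conjugate exponent of $p$ ($1/p+1/p'=1$). (i) Let $1\le p\le 2$ and $s>0$. Then $B^{p,q}_s(\mathbb{R}^d)\hookrightarrow\mathcal{M}^{p,p'}(\mathbb{R}^d)$ for all $1\le q\le\infty$. (ii) If $2\le p\le\infty$ and $s>d(1/p'-1/p)$, then $B^{p,q}_s(\mathbb{R}^d)\hookrightarrow\mathcal{M}^{p,p'}(\mathbb{R}^d)$ for all $1\le q\le\infty$.
   Context: $B^{p,q}_s(\mathbb{R}^d)$ is the usual inhomogeneous Besov space with integrability exponent $p$, summability exponent $q$ and smoothness $s\in\mathbb{R}$. $\mathcal{M}^{p,q}(\mathbb{R}^d)$ is the unweighted modulation space of all $f\in\mathcal{S}'(\mathbb{R}^d)$ with $\|f\|_{\mathcal{M}^{p,q}}=\big(\int_{\mathbb{R}^d}(\int_{\mathbb{R}^d}|V_gf(x,\omega)|^p\,dx)^{q/p}\,d\omega\big)^{1/q}<\infty$ (usual modifications for infinite exponents), with $V_gf(x,\omega)=\int_{\mathbb{R}^d}f(y)\overline{g(y-x)}e^{-2\pi i y\cdot\omega}\,dy$ for a fixed nonzero window $g\in\mathcal{S}(\mathbb{R}^d)$; different windows give equivalent norms. $\hookrightarrow$ denotes continuous embedding. *)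

theory Defs
  imports "HOL-Analysis.Analysis" "HOL-Probability.Essential_Supremum"
begin

section \<open>Schwartz functions\<close>

text \<open>
  Partial derivatives are indexed by lists of basis vectors rather than by multi-indices: the list
  \<open>[b\<^sub>1, \<dots>, b\<^sub>m]\<close> stands for the derivative
  \<open>\<partial>\<^bsub>b\<^sub>1\<^esub> \<dots> \<partial>\<^bsub>b\<^sub>m\<^esub> f\<close>. The definition is meaningful only where the derivatives exist.
\<close>

primrec partial_derivs ::
  "'a::euclidean_space list \<Rightarrow> ('a \<Rightarrow> complex) \<Rightarrow> 'a \<Rightarrow> complex" where
  "partial_derivs [] f = f"
| "partial_derivs (b # bs) f = (\<lambda>x. frechet_derivative (partial_derivs bs f) (at x) b)"

definition smooth :: "('a::euclidean_space \<Rightarrow> complex) \<Rightarrow> bool" where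
  "smooth f \<longleftrightarrow>
    (\<forall>bs x. set bs \<subseteq> Basis \<longrightarrow> partial_derivs bs f differentiable (at x))"

definition schwartz :: "('a::euclidean_space \<Rightarrow> complex) set" where
  "schwartz = {\<phi>. smooth \<phi> \<and>
    (\<forall>k bs. set bs \<subseteq> Basis \<longrightarrow>
      bdd_above (range (\<lambda>x. norm x ^ k * norm (partial_derivs bs \<phi> x))))}"

definition schwartz_seminorm ::
  "nat \<Rightarrow> 'a::euclidean_space list \<Rightarrow> ('a \<Rightarrow> complex) \<Rightarrow> real" where
  "schwartz_seminorm k bs \<phi> = (SUP x. norm x ^ k * norm (partial_derivs bs \<phi> x))"


section \<open>Tempered distributions\<close>

text \<open>
  A tempered distribution is a continuous linear functional on the Schwartz space. Since HOL
  functions are total, it is extended by 0 to all functions, so that two tempered distributions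
  that agree on the Schwartz space are equal.
\<close>

type_synonym 'a distr = "('a \<Rightarrow> complex) \<Rightarrow> complex"

definition tempered_distributions :: "'a::euclidean_space distr set" where
  "tempered_distributions = {f.
    (\<forall>\<phi>\<in>schwartz. \<forall>\<psi>\<in>schwartz. f (\<lambda>x. \<phi> x + \<psi> x) = f \<phi> + f \<psi>) \<and>
    (\<forall>c. \<forall>\<phi>\<in>schwartz. f (\<lambda>x. c * \<phi> x) = c * f \<phi>) \<and>
    (\<exists>C N. \<forall>\<phi>\<in>schwartz. norm (f \<phi>) \<le>
      C * (\<Sum>k\<le>N. \<Sum>bs | set bs \<subseteq> Basis \<and> length bs \<le> N. schwartz_seminorm k bs \<phi>)) \<and>
    (\<forall>\<phi>. \<phi> \<notin> schwartz \<longrightarrow> f \<phi> = 0)}"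

definition fourier :: "('a::euclidean_space \<Rightarrow> complex) \<Rightarrow> 'a \<Rightarrow> complex" where
  "fourier \<phi> \<xi> = (\<integral>x. \<phi> x * cis (- 2 * pi * (x \<bullet> \<xi>)) \<partial>lborel)"

definition inv_fourier :: "('a::euclidean_space \<Rightarrow> complex) \<Rightarrow> 'a \<Rightarrow> complex" where
  "inv_fourier \<phi> x = (\<integral>\<xi>. \<phi> \<xi> * cis (2 * pi * (x \<bullet> \<xi>)) \<partial>lborel)"

definition distr_fourier :: "'a::euclidean_space distr \<Rightarrow> 'a distr" where
  "distr_fourier f \<phi> = (if \<phi> \<in> schwartz then f (fourier \<phi>) else 0)"

definition distr_inv_fourier :: "'a::euclidean_space distr \<Rightarrow> 'a distr" where
  "distr_inv_fourier f \<phi> = (if \<phi> \<in> schwartz then f (inv_fourier \<phi>) else 0)"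

definition distr_mult :: "('a::euclidean_space \<Rightarrow> complex) \<Rightarrow> 'a distr \<Rightarrow> 'a distr" where
  "distr_mult m f \<phi> = (if \<phi> \<in> schwartz then f (\<lambda>x. m x * \<phi> x) else 0)"

definition represents :: "('a::euclidean_space \<Rightarrow> complex) \<Rightarrow> 'a distr \<Rightarrow> bool" where
  "represents h f \<longleftrightarrow> h \<in> borel_measurable lborel \<and>
    (\<forall>\<phi>\<in>schwartz. integrable lborel (\<lambda>x. h x * \<phi> x) \<and> f \<phi> = (\<integral>x. h x * \<phi> x \<partial>lborel))"


section \<open>Lebesgue norms\<close>

definition ennreal_rpow :: "ennreal \<Rightarrow> real \<Rightarrow> ennreal" where
  "ennreal_rpow x r = (if x = \<infinity> then \<infinity> else ennreal (enn2real x powr r))"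

text \<open>
  The \<open>L\<^sup>p\<close> norm, \<open>1 \<le> p \<le> \<infinity>\<close>, of a nonnegative function; it also yields the norm of
  \<open>\<ell>\<^sup>p\<close> as the special case of the counting measure.
\<close>

definition Lp_norm :: "ennreal \<Rightarrow> 'a measure \<Rightarrow> ('a \<Rightarrow> ennreal) \<Rightarrow> ennreal" where
  "Lp_norm p M F =
    (if p = \<infinity> then esssup M F
     else ennreal_rpow (\<integral>\<^sup>+x. ennreal_rpow (F x) (enn2real p) \<partial>M) (1 / enn2real p))"

text \<open>
  The representing function is unique almost everywhere, so the infimum is over at most one value;
  it is \<open>\<infinity>\<close> if the distribution is not given by a function.
\<close>

definition distr_Lp_norm :: "ennreal \<Rightarrow> 'a::euclidean_space distr \<Rightarrow> ennreal" where
  "distr_Lp_norm p f =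
    (INF h\<in>{h. represents h f}. Lp_norm p lborel (\<lambda>x. ennreal (norm (h x))))"


section \<open>Besov spaces\<close>

definition dyadic_cutoff :: "('a::euclidean_space \<Rightarrow> complex) \<Rightarrow> bool" where
  "dyadic_cutoff \<phi> \<longleftrightarrow> \<phi> \<in> schwartz \<and>
    (\<forall>\<xi>. norm \<xi> \<le> 1 \<longrightarrow> \<phi> \<xi> = 1) \<and> (\<forall>\<xi>. norm \<xi> > 2 \<longrightarrow> \<phi> \<xi> = 0)"

fun dyadic_partition ::
  "('a::euclidean_space \<Rightarrow> complex) \<Rightarrow> nat \<Rightarrow> 'a \<Rightarrow> complex" where
  "dyadic_partition \<phi> 0 \<xi> = \<phi> \<xi>"
| "dyadic_partition \<phi> (Suc j) \<xi> = \<phi> (\<xi> /\<^sub>R 2 ^ Suc j) - \<phi> (\<xi> /\<^sub>R 2 ^ j)"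

definition littlewood_paley ::
  "('a::euclidean_space \<Rightarrow> complex) \<Rightarrow> nat \<Rightarrow> 'a distr \<Rightarrow> 'a distr" where
  "littlewood_paley \<phi> j f =
    distr_inv_fourier (distr_mult (dyadic_partition \<phi> j) (distr_fourier f))"

definition besov_norm ::
  "('a::euclidean_space \<Rightarrow> complex) \<Rightarrow> ennreal \<Rightarrow> ennreal \<Rightarrow> real \<Rightarrow> 'a distr \<Rightarrow> ennreal" where
  "besov_norm \<phi> p q s f = Lp_norm q (count_space UNIV)
    (\<lambda>j. ennreal (2 powr (real j * s)) * distr_Lp_norm p (littlewood_paley \<phi> j f))"

definition besov_space ::
  "('a::euclidean_space \<Rightarrow> complex) \<Rightarrow> ennreal \<Rightarrow> ennreal \<Rightarrow> real \<Rightarrow> 'a distr set" where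
  "besov_space \<phi> p q s = {f \<in> tempered_distributions. besov_norm \<phi> p q s f < \<infinity>}"


section \<open>Modulation spaces\<close>

text \<open>
  For a tempered distribution \<open>f\<close> the integral
  \<open>\<integral> f(y) cnj(g(y - x)) exp(- 2 \<pi> i y\<bullet>\<omega>) dy\<close> is the (bilinear) pairing of \<open>f\<close> with the
  Schwartz function that multiplies \<open>f(y)\<close>.
\<close>

definition stft :: "('a::euclidean_space \<Rightarrow> complex) \<Rightarrow> 'a distr \<Rightarrow> 'a \<Rightarrow> 'a \<Rightarrow> complex" where
  "stft g f x \<omega> = f (\<lambda>y. cnj (g (y - x)) * cis (- 2 * pi * (y \<bullet> \<omega>)))"

definition modulation_norm ::
  "('a::euclidean_space \<Rightarrow> complex) \<Rightarrow> ennreal \<Rightarrow> ennreal \<Rightarrow> 'a distr \<Rightarrow> ennreal" where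
  "modulation_norm g p q f =
    Lp_norm q lborel (\<lambda>\<omega>. Lp_norm p lborel (\<lambda>x. ennreal (norm (stft g f x \<omega>))))"

definition modulation_space ::
  "('a::euclidean_space \<Rightarrow> complex) \<Rightarrow> ennreal \<Rightarrow> ennreal \<Rightarrow> 'a distr set" where
  "modulation_space g p q = {f \<in> tempered_distributions. modulation_norm g p q f < \<infinity>}"


section \<open>Continuous embeddings\<close>

text \<open>The inclusion map is linear, so its continuity is its boundedness.\<close>

definition continuously_embedded ::
  "'a set \<Rightarrow> ('a \<Rightarrow> ennreal) \<Rightarrow> 'a set \<Rightarrow> ('a \<Rightarrow> ennreal) \<Rightarrow> bool" where
  "continuously_embedded X norm\<^sub>X Y norm\<^sub>Y \<longleftrightarrow>
    X \<subseteq> Y \<and> (\<exists>C::real. \<forall>f\<in>X. norm\<^sub>Y f \<le> ennreal C * norm\<^sub>X f)"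

end

theory Submission
  imports Defs "HOL-Probability.Characteristic_Functions" "HOL-Probability.Sinc_Integral"
begin

text \<open>
  As \<open>s\<close> is strictly larger than the critical exponent, it suffices to bound the modulation norm of the
  \<open>j\<close>-th Littlewood--Paley piece by \<open>C 2\<^bsup>js'\<^esup>\<close> times its \<open>L\<^sup>p\<close> norm for some \<open>s' < s\<close>; the pieces are
  then summed as a geometric series, which also makes the exponent \<open>q\<close> irrelevant. For \<open>p \<le> 2\<close> the
  bound, with \<open>s' = 0\<close>, is the Hausdorff--Young inequality in \<open>\<omega>\<close> followed by Minkowski's integral
  inequality. For \<open>p \<ge> 2\<close>, Hausdorff--Young with exponent \<open>p'\<close> and Jensen's inequality bound the
  short-time Fourier transform in \<open>L\<^sup>p(dx d\<omega>)\<close>. On the ball \<open>\<bar>\<omega>\<bar> \<le> R = 2\<^bsup>j(1+\<delta>)\<^esup>\<close>, passing from the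
  \<open>p\<close>-norm to the \<open>p'\<close>-norm in \<open>\<omega>\<close> costs the factor \<open>R\<^bsup>d(1/p' - 1/p)\<^esup>\<close>; outside this ball the transform of
  the piece, which is band-limited to \<open>\<bar>\<xi>\<bar> \<le> 2\<^bsup>j+1\<^esup>\<close>, decays rapidly. Since constants do not matter,
  Hausdorff--Young is proved by real interpolation instead of Riesz--Thorin; Fourier inversion and
  the Plancherel bound come from Gaussian regularisation.
\<close>

section \<open>Jensen's and Minkowski's inequalities for extended nonnegative functions\<close>

text \<open>Why the radius carries a \<delta>: the transform of a band-limited piece h is bounded by
  the convolution of |h| with a kernel of L1 norm at most C (2^j / (1 + |\<omega>|))^N, for every N.
  This gives nothing while |\<omega>| is comparable to 2^j, but beyond 2^(j (1 + \<delta>)) it beats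
  any prescribed power of |\<omega>|. With D = d (1/p' - 1/p) the price is 2^(j \<delta> D), which
  fits into the gap s - D for small \<delta>. \<open>distr_Lp_norm\<close> is an infimum over
  representing functions, so every estimate is proved for an arbitrary representative with one
  constant. The transform of f is the pointwise sum of the transforms of its pieces; this rests on
  the convergence of smooth frequency cutoffs in the Schwartz seminorms. The interpolation constant
  blows up as p tends to 2, so p = 2 comes from the Plancherel bound; the endpoints 1 and
  \<infinity> are treated directly.\<close>

lemma ennreal_rpow_ennreal [simp]: "0 \<le> x \<Longrightarrow> ennreal_rpow (ennreal x) r = ennreal (x powr r)"
  by (simp add: ennreal_rpow_def)

lemma ennreal_rpow_top [simp]: "ennreal_rpow top r = top"
  by (simp add: ennreal_rpow_def)

lemma ennreal_rpow_0 [simp]: "ennreal_rpow 0 r = 0"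
  by (simp add: ennreal_rpow_def)

lemma ennreal_rpow_one [simp]: "ennreal_rpow 1 r = 1"
  by (simp add: ennreal_rpow_def)

lemma ennreal_rpow_mono: "0 \<le> r \<Longrightarrow> x \<le> y \<Longrightarrow> ennreal_rpow x r \<le> ennreal_rpow y r"
  by (cases x; cases y) (auto simp: ennreal_rpow_def top_unique powr_mono2 intro!: ennreal_leI)

lemma ennreal_rpow_rpow: "ennreal_rpow (ennreal_rpow x a) b = ennreal_rpow x (a * b)"
  by (cases x) (auto simp: powr_powr)

lemma ennreal_rpow_1 [simp]: "ennreal_rpow x 1 = x"
  by (cases x) auto

lemma ennreal_rpow_eq_0_iff [simp]: "ennreal_rpow x r = 0 \<longleftrightarrow> x = 0"
  by (cases x) auto

lemma ennreal_rpow_eq_top_iff [simp]: "ennreal_rpow x r = top \<longleftrightarrow> x = top"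
  by (cases x) auto

lemma ennreal_rpow_mult: "ennreal_rpow (x * y) r = ennreal_rpow x r * ennreal_rpow y r"
proof (cases x)
  case xr: (real a)
  show ?thesis
  proof (cases y)
    case (real b)
    with xr show ?thesis by (simp add: powr_mult flip: ennreal_mult)
  next
    case top
    with xr show ?thesis
      by (cases "a = 0") (auto simp: ennreal_mult_top)
  qed
next
  case top
  then show ?thesis
    by (cases "y = 0") (auto simp: ennreal_top_mult)
qed

lemma borel_measurable_ennreal_rpow [measurable]:
  "(\<lambda>x. ennreal_rpow x r) \<in> borel_measurable borel"
  unfolding ennreal_rpow_def by measurable

text \<open>Not an equality: at 0 and at \<open>top\<close> the product is 0.\<close>

lemma ennreal_mult_inverse_le_1: "x * inverse x \<le> (1::ennreal)"
  by (cases x) (auto simp: inverse_ennreal ennreal_mult[symmetric] field_simps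
      intro: order.trans[OF _ order_refl] dest: le_neq_trans)

text \<open>Concavity of the power 1 / r, used through one tangent: t \<le> k1 t^r + k2, with the
  point of contact chosen once the integral I is known. A tangent can be integrated against a weight
  of any mass up to c without normalising it. This one inequality later serves as Hoelder's
  inequality on balls, Young's inequality for convolutions, and the core of Minkowski's
  inequality.\<close>

lemma nn_integral_rpow_jensen:
  assumes r: "1 \<le> r" and [measurable]: "A \<in> borel_measurable M" "F \<in> borel_measurable M"
    and c: "(\<integral>\<^sup>+x. A x \<partial>M) \<le> ennreal c" "0 \<le> c"
  shows "ennreal_rpow (\<integral>\<^sup>+x. A x * F x \<partial>M) r
    \<le> ennreal (c powr (r - 1)) * (\<integral>\<^sup>+x. A x * ennreal_rpow (F x) r \<partial>M)"
proof -
  define I where "I = (\<integral>\<^sup>+x. A x * ennreal_rpow (F x) r \<partial>M)"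
  have zero: ?thesis if "AE x in M. A x * F x = 0"
  proof -
    have "(\<integral>\<^sup>+x. A x * F x \<partial>M) = 0"
      using that by (simp add: nn_integral_0_iff_AE)
    then show ?thesis by simp
  qed
  consider "c = 0" | "c > 0" "I = top" | "I = 0" | "c > 0" "I \<noteq> top" "I \<noteq> 0"
    using c by fastforce
  then show ?thesis
  proof cases
    case 1
    then have "AE x in M. A x = 0"
      using c by (simp add: nn_integral_0_iff_AE)
    then show ?thesis by (intro zero) auto
  next
    case 2
    then show ?thesis by (simp add: I_def[symmetric] ennreal_mult_top)
  next
    case 3
    then have "AE x in M. A x * ennreal_rpow (F x) r = 0"
      unfolding I_def by (simp add: nn_integral_0_iff_AE)
    then show ?thesis by (intro zero) auto
  next
    case 4
    then obtain i where i: "I = ennreal i" "i > 0"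
      by (cases I) (auto simp: less_le)
    \<comment> \<open>The point of contact: the weighted r-mean of \<open>F\<close> for a weight of
      mass c. The constants \<open>k1\<close> and \<open>k2\<close> below are the slope in t^r and
      the intercept of the tangent at t = l.\<close>
    define l where "l = (i / c) powr (1 / r)"
    have l: "l > 0" using 4 i by (simp add: l_def)
    have lr: "l powr r = i / c" using r 4 i by (simp add: l_def powr_powr)
    define k1 where "k1 = l powr (1 - r) / r"
    define k2 where "k2 = (1 - 1 / r) * l"
    have k: "k1 \<ge> 0" "k2 \<ge> 0" using r l by (auto simp: k1_def k2_def)
    have pw: "t \<le> k1 * t powr r + k2" if "t \<ge> 0" for t
    proof (cases "t = 0")
      case False
      then have t: "t > 0" using that by simp
      have "(l powr (1 - r) * t powr r) powr (1 / r) * l powr (1 - 1 / r)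
          \<le> (1 / r) * (l powr (1 - r) * t powr r) + (1 - 1 / r) * l"
        using r l t by (intro Youngs_inequality_0) auto
      moreover have "(l powr (1 - r) * t powr r) powr (1 / r) * l powr (1 - 1 / r)
          = l powr ((1 - r) / r + (1 - 1 / r)) * t"
        using r l t by (simp add: powr_mult powr_powr powr_add)
      moreover have "(1 - r) / r + (1 - 1 / r) = 0" using r by (simp add: field_simps)
      ultimately show ?thesis using l by (simp add: k1_def k2_def)
    qed (use k in simp)
    have pe: "F x \<le> ennreal k1 * ennreal_rpow (F x) r + ennreal k2" for x
    proof (cases "F x")
      case (real t)
      then show ?thesis using pw[of t] k by (simp flip: ennreal_mult ennreal_plus)
    next
      case top
      then show ?thesis using l r by (simp add: k1_def ennreal_mult_top)
    qed
    have "(\<integral>\<^sup>+x. A x * F x \<partial>M) \<le> (\<integral>\<^sup>+x. ennreal k1 * (A x * ennreal_rpow (F x) r) + ennreal k2 * A x \<partial>M)"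
      using mult_left_mono[OF pe] by (intro nn_integral_mono) (auto simp: algebra_simps)
    also have "\<dots> = ennreal k1 * I + ennreal k2 * (\<integral>\<^sup>+x. A x \<partial>M)"
      by (simp add: nn_integral_add nn_integral_cmult I_def)
    also have "\<dots> \<le> ennreal k1 * ennreal i + ennreal k2 * ennreal c"
      using c i by (intro add_mono mult_left_mono) auto
    also have "\<dots> = ennreal (k1 * i + k2 * c)"
      using k i c by (simp add: ennreal_mult)
    \<comment> \<open>Since l^r = i / c, the two summands are c l / r and (1 - 1 / r) c l.\<close>
    also have "k1 * i + k2 * c = c * l"
    proof -
      have "k1 * i = c / r * (l powr (1 - r) * l powr r)"
        using lr 4 by (simp add: k1_def)
      also have "l powr (1 - r) * l powr r = l" using l by (simp flip: powr_add)
      finally show ?thesis using r by (simp add: k2_def field_simps)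
    qed
    finally have "ennreal_rpow (\<integral>\<^sup>+x. A x * F x \<partial>M) r \<le> ennreal_rpow (ennreal (c * l)) r"
      using r by (intro ennreal_rpow_mono) auto
    also have "\<dots> = ennreal (c powr r * (i / c))"
      using l c by (simp add: powr_mult lr)
    also have "c powr r * (i / c) = c powr (r - 1) * i"
      using 4 by (simp add: powr_diff)
    also have "ennreal (c powr (r - 1) * i) = ennreal (c powr (r - 1)) * I"
      using i by (simp add: ennreal_mult)
    finally show ?thesis by (simp add: I_def)
  qed
qed

text \<open>No duality is involved. With \<open>A x\<close> the norm of the slice
  \<open>G x\<close>, write G = A (G / A) and apply Jensen in x with weight A, whose mass c is the
  right-hand side. After the integrals are exchanged, every normalised slice has r-th power integral
  at most 1, which leaves c^(r - 1) c = c^r.\<close>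

lemma nn_integral_minkowski:
  assumes "pair_sigma_finite M1 M2" and r: "1 \<le> r"
    and G[measurable]: "case_prod G \<in> borel_measurable (M1 \<Otimes>\<^sub>M M2)"
  shows "ennreal_rpow (\<integral>\<^sup>+y. ennreal_rpow (\<integral>\<^sup>+x. G x y \<partial>M1) r \<partial>M2) (1 / r)
    \<le> (\<integral>\<^sup>+x. ennreal_rpow (\<integral>\<^sup>+y. ennreal_rpow (G x y) r \<partial>M2) (1 / r) \<partial>M1)"
proof -
  interpret pair_sigma_finite M1 M2 by fact
  define A where "A x = ennreal_rpow (\<integral>\<^sup>+y. ennreal_rpow (G x y) r \<partial>M2) (1 / r)" for x
  have A[measurable]: "A \<in> borel_measurable M1"
    unfolding A_def by measurable
  have Ar: "ennreal_rpow (A x) r = (\<integral>\<^sup>+y. ennreal_rpow (G x y) r \<partial>M2)" for x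
    using r by (simp add: A_def ennreal_rpow_rpow)
  show ?thesis
  proof (cases "(\<integral>\<^sup>+x. A x \<partial>M1)")
    case top
    then show ?thesis by (simp add: A_def)
  next
    case (real c)
    then have "AE x in M1. A x \<noteq> top"
      using nn_integral_PInf_AE[OF A] by simp
    \<comment> \<open>The factorisation can fail only where A is 0 or \<open>top\<close>: in the
      first case the slice vanishes almost everywhere, and the second is a null set because A has
      finite integral. The exceptional y depend on x, hence the exchange of quantifiers by
      \<open>AE_commute\<close> afterwards.\<close>
    then have "AE x in M1. AE y in M2. G x y = A x * (G x y * inverse (A x))"
      using AE_space
    proof (eventually_elim, goal_cases)
      case (1 x)
      show ?case
      proof (cases "A x = 0")
        case True
        then have "(\<integral>\<^sup>+y. ennreal_rpow (G x y) r \<partial>M2) = 0" using Ar[of x] by simp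
        moreover have [measurable]: "x \<in> space M1" using 1 by simp
        have "(\<lambda>y. ennreal_rpow (G x y) r) \<in> borel_measurable M2"
          by measurable
        ultimately have "AE y in M2. G x y = 0"
          by (simp add: nn_integral_0_iff_AE)
        then show ?thesis by eventually_elim (simp add: True)
      next
        case False
        then have "A x * inverse (A x) = 1"
          using 1 by (cases "A x") (auto simp: inverse_ennreal ennreal_mult[symmetric])
        then have "A x * (G x y * inverse (A x)) = G x y" for y
          by (metis mult.commute mult.left_commute mult_1)
        then show ?thesis by simp
      qed
    qed
    then have "AE y in M2. AE x in M1. G x y = A x * (G x y * inverse (A x))"
      by (subst (asm) AE_commute) (auto simp: split_beta')
    then have ineq: "AE y in M2. ennreal_rpow (\<integral>\<^sup>+x. G x y \<partial>M1) r
       \<le> ennreal (c powr (r - 1)) * (\<integral>\<^sup>+x. A x * ennreal_rpow (G x y * inverse (A x)) r \<partial>M1)"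
      using AE_space
    proof (eventually_elim, goal_cases)
      case (1 y)
      then have "(\<integral>\<^sup>+x. G x y \<partial>M1) = (\<integral>\<^sup>+x. A x * (G x y * inverse (A x)) \<partial>M1)"
        by (intro nn_integral_cong_AE)
      moreover have "ennreal_rpow \<dots> r
         \<le> ennreal (c powr (r - 1)) * (\<integral>\<^sup>+x. A x * ennreal_rpow (G x y * inverse (A x)) r \<partial>M1)"
        using real r 1 by (intro nn_integral_rpow_jensen) auto
      ultimately show ?case by simp
    qed
    have "(\<integral>\<^sup>+y. ennreal_rpow (\<integral>\<^sup>+x. G x y \<partial>M1) r \<partial>M2) \<le>
       (\<integral>\<^sup>+y. ennreal (c powr (r - 1)) * (\<integral>\<^sup>+x. A x * ennreal_rpow (G x y * inverse (A x)) r \<partial>M1) \<partial>M2)"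
      using ineq by (rule nn_integral_mono_AE)
    also have "\<dots> = ennreal (c powr (r - 1)) *
        (\<integral>\<^sup>+y. (\<integral>\<^sup>+x. A x * ennreal_rpow (G x y * inverse (A x)) r \<partial>M1) \<partial>M2)"
      by (rule nn_integral_cmult) measurable
    also have "(\<integral>\<^sup>+y. (\<integral>\<^sup>+x. A x * ennreal_rpow (G x y * inverse (A x)) r \<partial>M1) \<partial>M2)
       = (\<integral>\<^sup>+x. (\<integral>\<^sup>+y. A x * ennreal_rpow (G x y * inverse (A x)) r \<partial>M2) \<partial>M1)"
      by (rule Fubini') measurable
    also have "\<dots> \<le> (\<integral>\<^sup>+x. A x \<partial>M1)"
    proof (rule nn_integral_mono)
      fix x assume "x \<in> space M1"
      then have "(\<integral>\<^sup>+y. A x * ennreal_rpow (G x y * inverse (A x)) r \<partial>M2)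
         = A x * ((\<integral>\<^sup>+y. ennreal_rpow (G x y) r \<partial>M2) * ennreal_rpow (inverse (A x)) r)"
        by (simp add: nn_integral_cmult nn_integral_multc ennreal_rpow_mult)
      also have "\<dots> = A x * ennreal_rpow (A x * inverse (A x)) r"
        by (simp add: ennreal_rpow_mult Ar)
      also have "\<dots> \<le> A x * ennreal_rpow 1 r"
        using r by (intro mult_left_mono ennreal_rpow_mono ennreal_mult_inverse_le_1) auto
      finally show "(\<integral>\<^sup>+y. A x * ennreal_rpow (G x y * inverse (A x)) r \<partial>M2) \<le> A x" by simp
    qed
    finally have "(\<integral>\<^sup>+y. ennreal_rpow (\<integral>\<^sup>+x. G x y \<partial>M1) r \<partial>M2) \<le> ennreal (c powr (r - 1)) * ennreal c"
      using real by (simp add: mult_left_mono)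
    also have "\<dots> = ennreal (c powr r)"
      using real r by (cases "c = 0") (auto simp: powr_diff ennreal_mult[symmetric])
    finally have "ennreal_rpow (\<integral>\<^sup>+y. ennreal_rpow (\<integral>\<^sup>+x. G x y \<partial>M1) r \<partial>M2) (1 / r)
      \<le> ennreal_rpow (ennreal (c powr r)) (1 / r)"
      using r by (intro ennreal_rpow_mono) auto
    then show ?thesis using real r by (simp add: powr_powr A_def)
  qed
qed


section \<open>Lebesgue norms and their countable triangle inequality\<close>

lemma Lp_norm_real:
  "1 \<le> r \<Longrightarrow> Lp_norm (ennreal r) M F = ennreal_rpow (\<integral>\<^sup>+x. ennreal_rpow (F x) r \<partial>M) (1 / r)"
  by (simp add: Lp_norm_def)

lemma Lp_norm_top: "Lp_norm top M F = esssup M F"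
  by (simp add: Lp_norm_def)

lemma exponent_cases:
  fixes p :: ennreal
  assumes "1 \<le> p"
  obtains (top) "p = top" | (real) r where "p = ennreal r" "1 \<le> r"
  using assms by (cases p) auto

lemma Lp_norm_mono:
  assumes "1 \<le> p" "F \<in> borel_measurable M" "\<And>x. F x \<le> G x"
  shows "Lp_norm p M F \<le> Lp_norm p M G"
  using \<open>1 \<le> p\<close>
proof (cases rule: exponent_cases)
  case top
  then show ?thesis using assms by (simp add: Lp_norm_top esssup_mono)
next
  case (real r)
  then show ?thesis
    using assms by (auto simp: Lp_norm_real intro!: ennreal_rpow_mono nn_integral_mono)
qed

text \<open>For finite p the norm is a power of a parameter integral, measurable by Tonelli's
  theorem. This argument does not reach the essential supremum, whence
  \<open>p \<noteq> top\<close>.\<close>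

lemma borel_measurable_Lp_norm:
  assumes "sigma_finite_measure M" "1 \<le> p" "p \<noteq> top"
    and [measurable]: "case_prod F \<in> borel_measurable (N \<Otimes>\<^sub>M M)"
  shows "(\<lambda>y. Lp_norm p M (F y)) \<in> borel_measurable N"
proof -
  interpret sigma_finite_measure M by fact
  show ?thesis
    using \<open>1 \<le> p\<close>
  proof (cases rule: exponent_cases)
    case (real r)
    then show ?thesis by (simp add: Lp_norm_real)
  qed (use assms in simp)
qed

text \<open>Minkowski's inequality with counting measure on the indices j as one of the two
  measures. For p = \<infinity>, countably many null sets are united.\<close>

lemma Lp_norm_suminf_le:
  fixes F :: "nat \<Rightarrow> 'a \<Rightarrow> ennreal"
  assumes "sigma_finite_measure M" "1 \<le> p"
    and [measurable]: "\<And>j. F j \<in> borel_measurable M"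
  shows "Lp_norm p M (\<lambda>x. \<Sum>j. F j x) \<le> (\<Sum>j. Lp_norm p M (F j))"
  using \<open>1 \<le> p\<close>
proof (cases rule: exponent_cases)
  case top
  have "AE x in M. F j x \<le> esssup M (F j)" for j
    by (rule esssup_AE)
  then have "AE x in M. \<forall>j. F j x \<le> esssup M (F j)"
    by (simp add: AE_all_countable)
  then have "AE x in M. (\<Sum>j. F j x) \<le> (\<Sum>j. esssup M (F j))"
    by eventually_elim (auto intro: suminf_le)
  then show ?thesis by (simp add: top Lp_norm_top esssup_I)
next
  case (real r)
  interpret M: sigma_finite_measure M by fact
  interpret C: sigma_finite_measure "count_space (UNIV :: nat set)"
    by (rule sigma_finite_measure_count_space)
  interpret pair_sigma_finite "count_space (UNIV :: nat set)" M ..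
  have "case_prod F \<in> borel_measurable (count_space UNIV \<Otimes>\<^sub>M M)"
    by (intro measurable_pair_measure_countable1) auto
  from nn_integral_minkowski[OF pair_sigma_finite_axioms \<open>1 \<le> r\<close> this]
  show ?thesis
    using real by (simp add: Lp_norm_real nn_integral_count_space_nat)
qed

text \<open>Majorants \<open>b j\<close> stand in for the inner norms, so that measurability in the
  outer variable is asked of the majorants. The nonnegative integral is monotone for arbitrary
  functions; the essential supremum needs a measurable left-hand side, which is what
  \<open>V_top\<close> provides.\<close>

lemma mixed_Lp_norm_suminf_le:
  fixes F :: "nat \<Rightarrow> 'b \<Rightarrow> 'a \<Rightarrow> ennreal"
  assumes M: "sigma_finite_measure M" and N: "sigma_finite_measure N" and p: "1 \<le> p" and q: "1 \<le> q"
    and F: "\<And>j y. F j y \<in> borel_measurable M" and V: "\<And>y. V y \<in> borel_measurable M"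
    and le: "\<And>y x. V y x \<le> (\<Sum>j. F j y x)"
    and b: "\<And>j. b j \<in> borel_measurable N" "\<And>j y. Lp_norm p M (F j y) \<le> b j y"
    and V_top: "q = top \<Longrightarrow> (\<lambda>y. Lp_norm p M (V y)) \<in> borel_measurable N"
  shows "Lp_norm q N (\<lambda>y. Lp_norm p M (V y)) \<le> (\<Sum>j. Lp_norm q N (b j))"
proof -
  have le_b: "Lp_norm p M (V y) \<le> (\<Sum>j. b j y)" for y
  proof -
    have "Lp_norm p M (V y) \<le> Lp_norm p M (\<lambda>x. \<Sum>j. F j y x)"
      using p V le by (rule Lp_norm_mono)
    also have "\<dots> \<le> (\<Sum>j. Lp_norm p M (F j y))"
      using M p F by (rule Lp_norm_suminf_le)
    also have "\<dots> \<le> (\<Sum>j. b j y)"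
      by (intro suminf_le b) auto
    finally show ?thesis .
  qed
  have "Lp_norm q N (\<lambda>y. Lp_norm p M (V y)) \<le> Lp_norm q N (\<lambda>y. \<Sum>j. b j y)"
    using q
  proof (cases rule: exponent_cases)
    case top
    then show ?thesis using V_top le_b by (simp add: Lp_norm_top esssup_mono)
  next
    case (real r)
    then show ?thesis
      using le_b by (auto simp: Lp_norm_real intro!: ennreal_rpow_mono nn_integral_mono)
  qed
  also have "\<dots> \<le> (\<Sum>j. Lp_norm q N (b j))"
    using N q b(1) by (rule Lp_norm_suminf_le)
  finally show ?thesis .
qed

section \<open>The Fourier transform of integrable functions\<close>

lemma nn_integral_lborel_affine:
  fixes f :: "'a::euclidean_space \<Rightarrow> ennreal"
  assumes [measurable]: "f \<in> borel_measurable borel" and c: "c \<noteq> 0"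
  shows "(\<integral>\<^sup>+x. f x \<partial>lborel) = ennreal (\<bar>c\<bar> ^ DIM('a)) * (\<integral>\<^sup>+x. f (t + c *\<^sub>R x) \<partial>lborel)"
  by (subst lborel_affine[OF c, of t])
    (simp add: nn_integral_density nn_integral_distr nn_integral_cmult ennreal_power)

lemma lborel_integral_affine:
  fixes f :: "'a::euclidean_space \<Rightarrow> complex"
  assumes [measurable]: "f \<in> borel_measurable borel" and c: "c \<noteq> 0"
  shows "(\<integral>x. f x \<partial>lborel) = (\<bar>c\<bar> ^ DIM('a)) *\<^sub>R (\<integral>x. f (t + c *\<^sub>R x) \<partial>lborel)"
  by (subst lborel_affine[OF c, of t])
    (simp add: integral_density integral_distr)

lemma lborel_integrable_affine_iff:
  fixes f :: "'a::euclidean_space \<Rightarrow> complex"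
  assumes [measurable]: "f \<in> borel_measurable borel" and c: "c \<noteq> 0"
  shows "integrable lborel (\<lambda>x. f (t + c *\<^sub>R x)) \<longleftrightarrow> integrable lborel f"
proof -
  define k :: complex where "k = of_real (\<bar>c\<bar> ^ DIM('a))"
  have k: "k \<noteq> 0" using c by (simp add: k_def)
  have "integrable lborel f \<longleftrightarrow>
      integrable (density (distr lborel borel (\<lambda>x. t + c *\<^sub>R x)) (\<lambda>_. \<bar>c\<bar>^DIM('a))) f"
    by (subst lborel_affine[OF c, of t]) simp
  also have "\<dots> \<longleftrightarrow> integrable lborel (\<lambda>x. k * f (t + c *\<^sub>R x))"
    by (simp add: integrable_density integrable_distr_eq scaleR_conv_of_real k_def)
  also have "\<dots> \<longleftrightarrow> integrable lborel (\<lambda>x. f (t + c *\<^sub>R x))"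
  proof
    assume "integrable lborel (\<lambda>x. k * f (t + c *\<^sub>R x))"
    from integrable_mult_right[OF this, of "inverse k"]
    show "integrable lborel (\<lambda>x. f (t + c *\<^sub>R x))" using k by (simp add: field_simps)
  qed simp
  finally show ?thesis ..
qed

lemma nn_integral_lborel_translate:
  fixes f :: "'a::euclidean_space \<Rightarrow> ennreal"
  assumes "f \<in> borel_measurable borel"
  shows "(\<integral>\<^sup>+x. f (x + a) \<partial>lborel) = (\<integral>\<^sup>+x. f x \<partial>lborel)"
    and "(\<integral>\<^sup>+x. f (x - a) \<partial>lborel) = (\<integral>\<^sup>+x. f x \<partial>lborel)"
    and "(\<integral>\<^sup>+x. f (a - x) \<partial>lborel) = (\<integral>\<^sup>+x. f x \<partial>lborel)"
  using nn_integral_lborel_affine[OF assms, of 1 a] nn_integral_lborel_affine[OF assms, of 1 "- a"]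
    nn_integral_lborel_affine[OF assms, of "-1" a]
  by (simp_all add: add.commute)

text \<open>\<open>lborel\<close> is an image of the product measure over \<open>Basis\<close>. This
  reduces Gaussians and the polynomial weight to one dimension.\<close>

lemma lborel_integral_prod:
  fixes f :: "'a::euclidean_space \<Rightarrow> real \<Rightarrow> complex"
  assumes "\<And>b. b \<in> Basis \<Longrightarrow> integrable lborel (f b)"
  shows "integrable lborel (\<lambda>x::'a. \<Prod>b\<in>Basis. f b (x \<bullet> b))"
    and "(\<integral>x. (\<Prod>b\<in>Basis. f b (x \<bullet> b)) \<partial>lborel) = (\<Prod>b\<in>Basis. \<integral>x. f b x \<partial>lborel)"
proof -
  interpret product_sigma_finite "\<lambda>_::'a. lborel :: real measure" ..
  have [measurable]: "b \<in> Basis \<Longrightarrow> f b \<in> borel_measurable borel" for b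
    using assms[of b] by (simp add: borel_measurable_integrable)
  show "integrable lborel (\<lambda>x::'a. \<Prod>b\<in>Basis. f b (x \<bullet> b))"
    using assms by (subst lborel_eq) (simp add: integrable_distr_eq product_integrable_prod)
  show "(\<integral>x. (\<Prod>b\<in>Basis. f b (x \<bullet> b)) \<partial>lborel) = (\<Prod>b\<in>Basis. \<integral>x. f b x \<partial>lborel)"
    using assms by (subst lborel_eq) (simp add: integral_distr product_integral_prod)
qed

section \<open>Gaussian regularisation: multiplication formula, Plancherel bound, inversion\<close>

text \<open>Normalised for the kernel exp(-2 \<pi> i x \<bullet> \<xi>): its integral is 1 and it is
  its own Fourier transform.\<close>

definition gauss :: "'a::euclidean_space \<Rightarrow> real" where
  "gauss x = exp (- pi * (norm x)\<^sup>2)"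

lemma gauss_pos: "gauss x > 0" and gauss_le_1: "gauss x \<le> 1"
  by (auto simp: gauss_def)

lemma borel_measurable_gauss [measurable]: "gauss \<in> borel_measurable borel"
  unfolding gauss_def by measurable

text \<open>After rescaling, this is the characteristic function of the standard normal
  distribution.\<close>

lemma gauss_1d:
  shows "integrable lborel (\<lambda>x::real. of_real (exp (- pi * x\<^sup>2)) * cis (- 2 * pi * (x * t)) :: complex)"
    and "(\<integral>x. of_real (exp (- pi * x\<^sup>2)) * cis (- 2 * pi * (x * t)) \<partial>lborel) = of_real (exp (- pi * t\<^sup>2))"
proof -
  \<comment> \<open>Chosen so that \<pi> (c x)^2 = x^2 / 2.\<close>
  define c where "c = 1 / sqrt (2 * pi)"
  have c: "c > 0" "c\<^sup>2 = 1 / (2 * pi)" "c \<noteq> 0" by (auto simp: c_def power_divide)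
  define f :: "real \<Rightarrow> complex" where "f x = of_real (exp (- pi * x\<^sup>2)) * cis (- 2 * pi * (x * t))" for x
  have [measurable]: "f \<in> borel_measurable borel"
    unfolding f_def cis_conv_exp by measurable
  define s where "s = - sqrt (2 * pi) * t"
  have sc: "s = - 2 * pi * c * t"
    using real_sqrt_pow2[of "2 * pi"] by (simp add: s_def c_def field_simps power2_eq_square)
  have fc: "f (c * x) = of_real (sqrt (2 * pi) * std_normal_density x) * iexp (s * x)" for x
  proof -
    have "- pi * (c * x)\<^sup>2 = - x\<^sup>2 / 2"
      by (simp add: power_mult_distrib c)
    moreover have "- 2 * pi * (c * x * t) = s * x"
      by (simp add: sc)
    ultimately show ?thesis
      unfolding f_def cis_conv_exp by (simp add: std_normal_density_def)
  qed
  interpret real_distribution std_normal_distribution by (rule real_dist_normal_dist)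
  have int: "integrable std_normal_distribution (\<lambda>x. iexp (s * x))"
    by (rule integrable_iexp) measurable
  then have "integrable lborel (\<lambda>x. std_normal_density x *\<^sub>R iexp (s * x))"
    by (subst (asm) integrable_density) (auto simp: normal_density_nonneg)
  then have i: "integrable lborel (\<lambda>x. of_real (sqrt (2 * pi)) * (std_normal_density x *\<^sub>R iexp (s * x)))"
    by (rule integrable_mult_right)
  have fc': "f (0 + c *\<^sub>R x) = of_real (sqrt (2 * pi)) * (std_normal_density x *\<^sub>R iexp (s * x))" for x
    by (simp add: fc scaleR_conv_of_real)
  show "integrable lborel f"
    using i unfolding fc'[symmetric] by (subst (asm) lborel_integrable_affine_iff[OF _ c(3)]) auto
  have "(\<integral>x. f x \<partial>lborel) = c *\<^sub>R (\<integral>x. of_real (sqrt (2 * pi)) * (std_normal_density x *\<^sub>R iexp (s * x)) \<partial>lborel)"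
    using c by (subst lborel_integral_affine[of _ c 0]) (simp_all only: fc', simp_all)
  also have "\<dots> = (\<integral>x. std_normal_density x *\<^sub>R iexp (s * x) \<partial>lborel)"
    by (simp add: c_def scaleR_conv_of_real)
  also have "\<dots> = char std_normal_distribution s"
    unfolding char_def by (subst integral_density) (auto simp: normal_density_nonneg)
  also have "\<dots> = of_real (exp (- pi * t\<^sup>2))"
    by (simp add: char_std_normal_distribution s_def power_mult_distrib)
  finally show "(\<integral>x. f x \<partial>lborel) = of_real (exp (- pi * t\<^sup>2))" .
qed

lemma cis_sum: "finite A \<Longrightarrow> cis (sum f A) = (\<Prod>a\<in>A. cis (f a))"
  by (induction A rule: finite_induct) (auto simp flip: cis_mult)

lemma gauss_prod_eq:
  "of_real (gauss x) * cis (- 2 * pi * (x \<bullet> y))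
    = (\<Prod>b\<in>Basis. of_real (exp (- pi * (x \<bullet> b)\<^sup>2)) * cis (- 2 * pi * ((x \<bullet> b) * (y \<bullet> b))) :: complex)"
proof -
  have "gauss x = (\<Prod>b\<in>Basis. exp (- pi * (x \<bullet> b)\<^sup>2))"
    unfolding gauss_def power2_norm_eq_inner
    by (subst euclidean_inner) (simp add: sum_distrib_left exp_sum power2_eq_square flip: sum_negf)
  moreover have "cis (- 2 * pi * (x \<bullet> y)) = (\<Prod>b\<in>Basis. cis (- 2 * pi * ((x \<bullet> b) * (y \<bullet> b))))"
    by (subst euclidean_inner) (simp add: sum_distrib_left cis_sum flip: sum_negf)
  ultimately show ?thesis by (simp add: prod.distrib)
qed

lemma integrable_gauss_cis:
  "integrable lborel (\<lambda>x::'a::euclidean_space. of_real (gauss x) * cis (- 2 * pi * (x \<bullet> y)) :: complex)"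
  unfolding gauss_prod_eq by (rule lborel_integral_prod(1)) (rule gauss_1d)

lemma fourier_gauss: "fourier (\<lambda>x. of_real (gauss x)) y = of_real (gauss y)"
proof -
  have "fourier (\<lambda>x. of_real (gauss x)) y = (\<Prod>b\<in>Basis. of_real (exp (- pi * (y \<bullet> b)\<^sup>2)))"
    unfolding fourier_def gauss_prod_eq by (subst lborel_integral_prod(2)) (simp_all only: gauss_1d)
  also have "\<dots> = of_real (gauss y)"
    using gauss_prod_eq[of y 0] by simp
  finally show ?thesis .
qed

lemma integrable_gauss: "integrable lborel (gauss :: 'a::euclidean_space \<Rightarrow> real)"
  using integrable_norm[OF integrable_gauss_cis[of "0::'a"]]
  by (simp add: norm_mult abs_of_pos[OF gauss_pos])

lemma integral_gauss: "(\<integral>x. gauss (x::'a::euclidean_space) \<partial>lborel) = 1"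
proof -
  have "of_real (\<integral>x. gauss (x::'a) \<partial>lborel) = fourier (\<lambda>x::'a. of_real (gauss x)) 0"
    unfolding fourier_def by simp
  also have "\<dots> = 1" by (subst fourier_gauss) (simp add: gauss_def)
  finally show ?thesis using of_real_eq_1_iff by blast
qed

lemma nn_integral_gauss: "(\<integral>\<^sup>+x. ennreal (gauss (x::'a::euclidean_space)) \<partial>lborel) = 1"
  by (subst nn_integral_eq_integral[OF integrable_gauss]) (auto simp: integral_gauss gauss_pos less_imp_le)

lemma integrable_mult_cis [simp]:
  fixes u :: "'a::euclidean_space \<Rightarrow> complex"
  assumes u: "integrable lborel u" and [measurable]: "h \<in> borel_measurable borel"
  shows "integrable lborel (\<lambda>x. u x * cis (h x))"
proof -
  have [measurable]: "u \<in> borel_measurable borel"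
    using u by (simp add: borel_measurable_integrable)
  show ?thesis
    by (rule Bochner_Integration.integrable_bound[OF u]) (auto simp: norm_mult cis_conv_exp)
qed

lemma norm_fourier_le:
  assumes "integrable lborel u"
  shows "norm (fourier u y) \<le> (\<integral>x. norm (u x) \<partial>lborel)"
proof -
  have "norm (fourier u y) \<le> (\<integral>x. norm (u x * cis (- 2 * pi * (x \<bullet> y))) \<partial>lborel)"
    unfolding fourier_def by (rule integral_norm_bound)
  then show ?thesis by (simp add: norm_mult)
qed

lemma borel_measurable_fourier [measurable]:
  assumes [measurable]: "u \<in> borel_measurable borel"
  shows "fourier u \<in> borel_measurable borel"
  unfolding fourier_def cis_conv_exp by measurable

lemma integrable_product_cis:
  fixes u :: "'a::euclidean_space \<Rightarrow> complex" and v :: "'b::euclidean_space \<Rightarrow> complex"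
  assumes u: "integrable lborel u" and v: "integrable lborel v"
    and h[measurable]: "h \<in> borel_measurable (borel \<Otimes>\<^sub>M borel)"
  shows "integrable (lborel \<Otimes>\<^sub>M lborel) (\<lambda>(x, y). u x * v y * cis (h (x, y)))"
proof (rule lborel_pair.Fubini_integrable)
  have [measurable]: "u \<in> borel_measurable borel" "v \<in> borel_measurable borel"
    using u v by (simp_all add: borel_measurable_integrable)
  show "(\<lambda>(x, y). u x * v y * cis (h (x, y))) \<in> borel_measurable (lborel \<Otimes>\<^sub>M lborel)"
    unfolding cis_conv_exp by measurable
  show "integrable lborel (\<lambda>x. \<integral>y. norm (case (x, y) of (x, y) \<Rightarrow> u x * v y * cis (h (x, y))) \<partial>lborel)"
    using u v by (simp add: norm_mult)
  show "AE x in lborel. integrable lborel (\<lambda>y. case (x, y) of (x, y) \<Rightarrow> u x * v y * cis (h (x, y)))"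
    using v by (auto intro!: integrable_mult_cis)
qed

text \<open>Fubini's theorem for a symmetric kernel. Fourier inversion and the Plancherel bound are
  both this identity with a second function that carries a Gaussian factor.\<close>

lemma fourier_mult_formula:
  assumes u: "integrable lborel u" and v: "integrable lborel v"
  shows "(\<integral>x. fourier u x * v x \<partial>lborel) = (\<integral>x. u x * fourier v x \<partial>lborel)"
proof -
  have "(\<integral>y. fourier u y * v y \<partial>lborel) = (\<integral>y. \<integral>x. u x * v y * cis (- 2 * pi * (x \<bullet> y)) \<partial>lborel \<partial>lborel)"
    unfolding fourier_def
    by (subst integral_mult_left_zero[symmetric]) (simp add: mult_ac)
  also have "\<dots> = (\<integral>x. \<integral>y. u x * v y * cis (- 2 * pi * (x \<bullet> y)) \<partial>lborel \<partial>lborel)"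
    using integrable_product_cis[OF u v, of "\<lambda>(x, y). - 2 * pi * (x \<bullet> y)"]
    by (intro lborel_pair.Fubini_integral) simp
  also have "\<dots> = (\<integral>x. u x * fourier v x \<partial>lborel)"
    unfolding fourier_def
    by (subst integral_mult_right_zero[symmetric]) (simp add: mult_ac inner_commute)
  finally show ?thesis .
qed

text \<open>Its Fourier transform is a Gaussian of mass 1 and width r centred at x, so integrating
  \<open>fourier u\<close> against it averages u near x.\<close>

definition gauss_mod :: "real \<Rightarrow> 'a::euclidean_space \<Rightarrow> 'a \<Rightarrow> complex" where
  "gauss_mod r x y = of_real (gauss (r *\<^sub>R y)) * cis (2 * pi * (x \<bullet> y))"

lemma gauss_mod_fourier:
  fixes x y :: "'a::euclidean_space"
  assumes r: "r > 0"
  shows "integrable lborel (gauss_mod r x)"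
    and "fourier (gauss_mod r x) y = of_real (gauss ((y - x) /\<^sub>R r) / r ^ DIM('a))"
proof -
  have [measurable]: "gauss_mod r x \<in> borel_measurable borel"
    unfolding gauss_mod_def cis_conv_exp by measurable
  define h where "h \<xi> = of_real (gauss (r *\<^sub>R \<xi>)) * cis (- 2 * pi * (\<xi> \<bullet> (y - x)))" for \<xi> :: 'a
  have [measurable]: "h \<in> borel_measurable borel"
    unfolding h_def cis_conv_exp by measurable
  have hr: "h (0 + (1/r) *\<^sub>R \<xi>) = of_real (gauss \<xi>) * cis (- 2 * pi * (\<xi> \<bullet> ((y - x) /\<^sub>R r)))" for \<xi>
    using r by (simp add: h_def divide_inverse)
  have r0: "1 / r \<noteq> 0" using r by simp
  have "integrable lborel (\<lambda>\<xi>. h (0 + (1/r) *\<^sub>R \<xi>))"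
    unfolding hr by (rule integrable_gauss_cis)
  then have h: "integrable lborel h"
    by (subst (asm) lborel_integrable_affine_iff[OF _ r0]) auto
  have "gauss_mod r x = (\<lambda>\<xi>. h \<xi> * cis (2 * pi * (\<xi> \<bullet> y)))"
    by (auto simp: gauss_mod_def h_def cis_mult inner_commute algebra_simps fun_eq_iff)
  then show "integrable lborel (gauss_mod r x)"
    using h by simp
  have "fourier (gauss_mod r x) y = (\<integral>\<xi>. h \<xi> \<partial>lborel)"
    unfolding fourier_def gauss_mod_def h_def
    by (intro Bochner_Integration.integral_cong) (auto simp: cis_mult inner_commute algebra_simps)
  also have "\<dots> = (\<bar>1 / r\<bar> ^ DIM('a)) *\<^sub>R fourier (\<lambda>x. of_real (gauss x)) ((y - x) /\<^sub>R r)"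
    unfolding fourier_def by (subst lborel_integral_affine[OF _ r0, of _ 0]) (simp_all only: hr, simp)
  also have "\<dots> = of_real (gauss ((y - x) /\<^sub>R r) / r ^ DIM('a))"
    using r by (simp add: fourier_gauss scaleR_conv_of_real field_simps power_one_over)
  finally show "fourier (gauss_mod r x) y = of_real (gauss ((y - x) /\<^sub>R r) / r ^ DIM('a))" .
qed

lemma nn_integral_gauss_scaled:
  fixes x :: "'a::euclidean_space"
  assumes r: "r > 0"
  shows "(\<integral>\<^sup>+y. ennreal (gauss ((y - x) /\<^sub>R r) / r ^ DIM('a)) \<partial>lborel) = 1"
    and "(\<integral>\<^sup>+y. ennreal (gauss ((x - y) /\<^sub>R r) / r ^ DIM('a)) \<partial>lborel) = 1"
proof -
  have a: "(\<integral>\<^sup>+y. ennreal (gauss ((y::'a) /\<^sub>R r) / r ^ DIM('a)) \<partial>lborel) = 1"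
    using r by (subst nn_integral_lborel_affine[of _ r 0])
      (simp_all add: nn_integral_gauss nn_integral_cmult[symmetric] gauss_pos less_imp_le flip: ennreal_mult)
  show "(\<integral>\<^sup>+y. ennreal (gauss ((y - x) /\<^sub>R r) / r ^ DIM('a)) \<partial>lborel) = 1"
    "(\<integral>\<^sup>+y. ennreal (gauss ((x - y) /\<^sub>R r) / r ^ DIM('a)) \<partial>lborel) = 1"
    using nn_integral_lborel_translate(2,3)[of "\<lambda>y. ennreal (gauss (y /\<^sub>R r) / r ^ DIM('a))" x] a
    by simp_all
qed

lemma gauss_nonneg [simp]: "0 \<le> gauss x"
  by (simp add: gauss_def)

lemma norm_integral_le_nn_integral:
  fixes f :: "_ \<Rightarrow> 'b::{banach, second_countable_topology}"
  shows "ennreal (norm (integral\<^sup>L M f)) \<le> (\<integral>\<^sup>+x. ennreal (norm (f x)) \<partial>M)"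
  by (cases "integrable M f") (auto simp: integral_norm_bound_ennreal not_integrable_integral_eq)

lemma integrable_bounded_mult:
  fixes u v :: "'a \<Rightarrow> complex"
  assumes u: "integrable M u" and [measurable]: "v \<in> borel_measurable M" and K: "\<And>x. norm (v x) \<le> K"
  shows "integrable M (\<lambda>x. v x * u x)"
proof (rule Bochner_Integration.integrable_bound)
  show "integrable M (\<lambda>x. of_real K * u x)" using u by simp
  have "norm (v x) \<le> \<bar>K\<bar>" for x using K[of x] by simp
  then show "AE x in M. norm (v x * u x) \<le> norm (of_real K * u x)"
    by (auto simp: norm_mult intro!: mult_right_mono)
qed (use u in \<open>simp add: borel_measurable_integrable\<close>)

lemma fourier_gauss_integral:
  assumes u: "integrable lborel u" and r: "r > 0"
  shows "(\<integral>\<xi>. fourier u \<xi> * gauss_mod r x \<xi> \<partial>lborel)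
    = (\<integral>y. u y * of_real (gauss ((y - x) /\<^sub>R r) / r ^ DIM('a)) \<partial>(lborel :: 'a::euclidean_space measure))"
  using fourier_mult_formula[OF u gauss_mod_fourier(1)[OF r]] by (simp add: gauss_mod_fourier(2)[OF r])

lemma norm_mult_le_half_squares: "norm (a :: complex) * norm b \<le> (norm a)\<^sup>2 / 2 + (norm b)\<^sup>2 / 2"
  using sum_squares_bound[of "norm a" "norm b"] by simp

text \<open>The multiplication formula with v = cnj (fourier u) times a Gaussian, which makes v
  integrable although u is only in L1. The transform of v is the conjugate of an average of u at
  width r, so the left side is at most the double integral of |u(x)| |u(y)| \<Gamma>(y - x). Then
  2ab \<le> a^2 + b^2, and \<Gamma> has mass 1 in either variable.\<close>

lemma nn_integral_fourier_gauss_le: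
  fixes u :: "'a::euclidean_space \<Rightarrow> complex"
  assumes u: "integrable lborel u" and r: "r > 0"
  shows "(\<integral>\<^sup>+\<xi>. ennreal ((norm (fourier u \<xi>))\<^sup>2 * gauss (r *\<^sub>R \<xi>)) \<partial>lborel)
    \<le> (\<integral>\<^sup>+x. ennreal ((norm (u x))\<^sup>2) \<partial>lborel)"
proof -
  have [measurable]: "u \<in> borel_measurable borel"
    using u by (simp add: borel_measurable_integrable)
  define v where "v \<xi> = cnj (fourier u \<xi>) * gauss_mod r 0 \<xi>" for \<xi>
  define \<Gamma> where "\<Gamma> z = gauss (z /\<^sub>R r) / r ^ DIM('a)" for z :: 'a
  have \<Gamma>: "\<Gamma> z \<ge> 0" for z using r gauss_pos[of "z /\<^sub>R r"] by (simp add: \<Gamma>_def)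
  have [measurable]: "\<Gamma> \<in> borel_measurable borel" unfolding \<Gamma>_def by measurable
  have [measurable]: "cnj \<in> borel_measurable borel"
    by (intro borel_measurable_continuous_onI continuous_intros)
  have v: "integrable lborel v"
    unfolding v_def using norm_fourier_le[OF u]
    by (intro integrable_bounded_mult[where K = "\<integral>x. norm (u x) \<partial>lborel"] gauss_mod_fourier r) auto
  have uv: "fourier u \<xi> * v \<xi> = of_real ((norm (fourier u \<xi>))\<^sup>2 * gauss (r *\<^sub>R \<xi>))" for \<xi>
    unfolding v_def gauss_mod_def using complex_norm_square[of "fourier u \<xi>"] by (simp add: mult_ac)
  have "integrable lborel (\<lambda>\<xi>. fourier u \<xi> * v \<xi>)"
    using norm_fourier_le[OF u] v by (intro integrable_bounded_mult) auto
  then have int: "integrable lborel (\<lambda>\<xi>. (norm (fourier u \<xi>))\<^sup>2 * gauss (r *\<^sub>R \<xi>))"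
    unfolding uv using integrable_norm[of lborel "\<lambda>\<xi>. complex_of_real ((norm (fourier u \<xi>))\<^sup>2 * gauss (r *\<^sub>R \<xi>))"]
    by (simp add: norm_mult norm_power abs_of_pos[OF gauss_pos])
  have v_le: "ennreal (norm (fourier v x)) \<le> (\<integral>\<^sup>+y. ennreal (norm (u y) * \<Gamma> (y - x)) \<partial>lborel)" for x
  proof -
    have "fourier v x = cnj (\<integral>\<xi>. fourier u \<xi> * gauss_mod r x \<xi> \<partial>lborel)"
      unfolding fourier_def[of v] v_def gauss_mod_def
      by (simp add: cis_cnj inner_commute mult_ac flip: Bochner_Integration.integral_cnj)
    also have "\<dots> = cnj (\<integral>y. u y * of_real (\<Gamma> (y - x)) \<partial>lborel)"
      unfolding \<Gamma>_def by (simp add: fourier_gauss_integral[OF u r])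
    finally have "norm (fourier v x) = norm (\<integral>y. u y * of_real (\<Gamma> (y - x)) \<partial>lborel)"
      by simp
    also have "ennreal \<dots> \<le> (\<integral>\<^sup>+y. ennreal (norm (u y * of_real (\<Gamma> (y - x)))) \<partial>lborel)"
      by (rule norm_integral_le_nn_integral)
    finally show ?thesis using \<Gamma> by (simp add: norm_mult)
  qed
  have "(\<integral>\<^sup>+\<xi>. ennreal ((norm (fourier u \<xi>))\<^sup>2 * gauss (r *\<^sub>R \<xi>)) \<partial>lborel)
      = ennreal (\<integral>\<xi>. (norm (fourier u \<xi>))\<^sup>2 * gauss (r *\<^sub>R \<xi>) \<partial>lborel)"
    using int by (intro nn_integral_eq_integral) auto
  also have "\<dots> = ennreal (norm (\<integral>\<xi>. fourier u \<xi> * v \<xi> \<partial>lborel))"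
    unfolding uv by (simp add: abs_of_nonneg integral_nonneg_AE del: of_real_mult of_real_power)
  also have "\<dots> = ennreal (norm (\<integral>x. u x * fourier v x \<partial>lborel))"
    using fourier_mult_formula[OF u v] by simp
  also have "\<dots> \<le> (\<integral>\<^sup>+x. ennreal (norm (u x * fourier v x)) \<partial>lborel)"
    by (rule norm_integral_le_nn_integral)
  also have "\<dots> \<le> (\<integral>\<^sup>+x. (\<integral>\<^sup>+y. ennreal (norm (u x)) * ennreal (norm (u y) * \<Gamma> (y - x)) \<partial>lborel) \<partial>lborel)"
    using v_le by (intro nn_integral_mono) (auto simp: norm_mult ennreal_mult nn_integral_cmult intro!: mult_left_mono)
  also have "\<dots> \<le> (\<integral>\<^sup>+x. (\<integral>\<^sup>+y. ennreal ((norm (u x))\<^sup>2 / 2) * ennreal (\<Gamma> (y - x))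
        + ennreal ((norm (u y))\<^sup>2 / 2) * ennreal (\<Gamma> (y - x)) \<partial>lborel) \<partial>lborel)"
  proof (intro nn_integral_mono)
    fix x y
    have "norm (u x) * norm (u y) * \<Gamma> (y - x) \<le> ((norm (u x))\<^sup>2 / 2 + (norm (u y))\<^sup>2 / 2) * \<Gamma> (y - x)"
      by (intro mult_right_mono norm_mult_le_half_squares \<Gamma>)
    then show "ennreal (norm (u x)) * ennreal (norm (u y) * \<Gamma> (y - x)) \<le>
       ennreal ((norm (u x))\<^sup>2 / 2) * ennreal (\<Gamma> (y - x))
        + ennreal ((norm (u y))\<^sup>2 / 2) * ennreal (\<Gamma> (y - x))"
      using \<Gamma>[of "y - x"] by (simp add: algebra_simps flip: ennreal_mult ennreal_plus)
  qed
  also have "\<dots> = (\<integral>\<^sup>+x. (\<integral>\<^sup>+y. ennreal ((norm (u x))\<^sup>2 / 2) * ennreal (\<Gamma> (y - x)) \<partial>lborel) \<partial>lborel)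
     + (\<integral>\<^sup>+x. (\<integral>\<^sup>+y. ennreal ((norm (u y))\<^sup>2 / 2) * ennreal (\<Gamma> (y - x)) \<partial>lborel) \<partial>lborel)"
    by (simp add: nn_integral_add)
  also have "(\<integral>\<^sup>+x. (\<integral>\<^sup>+y. ennreal ((norm (u x))\<^sup>2 / 2) * ennreal (\<Gamma> (y - x)) \<partial>lborel) \<partial>lborel)
     = (\<integral>\<^sup>+x. ennreal ((norm (u x))\<^sup>2 / 2) \<partial>lborel)"
    by (simp add: nn_integral_cmult \<Gamma>_def nn_integral_gauss_scaled(1)[OF r])
  also have "(\<integral>\<^sup>+x. (\<integral>\<^sup>+y. ennreal ((norm (u y))\<^sup>2 / 2) * ennreal (\<Gamma> (y - x)) \<partial>lborel) \<partial>lborel)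
     = (\<integral>\<^sup>+y. (\<integral>\<^sup>+x. ennreal ((norm (u y))\<^sup>2 / 2) * ennreal (\<Gamma> (y - x)) \<partial>lborel) \<partial>lborel)"
    by (rule lborel_pair.Fubini') measurable
  also have "\<dots> = (\<integral>\<^sup>+x. ennreal ((norm (u x))\<^sup>2 / 2) \<partial>lborel)"
    by (simp add: nn_integral_cmult \<Gamma>_def nn_integral_gauss_scaled(2)[OF r])
  also have "(\<integral>\<^sup>+x. ennreal ((norm (u x))\<^sup>2 / 2) \<partial>lborel) + (\<integral>\<^sup>+x. ennreal ((norm (u x))\<^sup>2 / 2) \<partial>lborel)
     = (\<integral>\<^sup>+x. ennreal ((norm (u x))\<^sup>2) \<partial>lborel)"
    by (subst nn_integral_add[symmetric]) (auto simp flip: ennreal_plus)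
  finally show ?thesis .
qed

lemma gauss_scaled_tendsto: "(\<lambda>n. gauss ((1 / real (Suc n)) *\<^sub>R x)) \<longlonglongrightarrow> 1"
proof -
  have "(\<lambda>n. gauss ((1 / real (Suc n)) *\<^sub>R x)) \<longlonglongrightarrow> gauss (0 *\<^sub>R x)"
    unfolding gauss_def by (intro tendsto_intros LIMSEQ_Suc[OF lim_1_over_n])
  then show ?thesis by (simp add: gauss_def)
qed

text \<open>The regularisation is removed by Fatou's lemma, which keeps an upper bound without a
  dominating function.\<close>

lemma plancherel_le:
  fixes u :: "'a::euclidean_space \<Rightarrow> complex"
  assumes u: "integrable lborel u"
  shows "(\<integral>\<^sup>+\<xi>. ennreal ((norm (fourier u \<xi>))\<^sup>2) \<partial>lborel) \<le> (\<integral>\<^sup>+x. ennreal ((norm (u x))\<^sup>2) \<partial>lborel)"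
proof -
  have [measurable]: "u \<in> borel_measurable borel"
    using u by (simp add: borel_measurable_integrable)
  define F where "F n \<xi> = ennreal ((norm (fourier u \<xi>))\<^sup>2 * gauss ((1 / real (Suc n)) *\<^sub>R \<xi>))" for n \<xi>
  have [measurable]: "F n \<in> borel_measurable borel" for n
    unfolding F_def by measurable
  have lim: "(\<lambda>n. F n \<xi>) \<longlonglongrightarrow> ennreal ((norm (fourier u \<xi>))\<^sup>2)" for \<xi>
    unfolding F_def using tendsto_mult[OF tendsto_const gauss_scaled_tendsto]
    by (intro tendsto_ennrealI) force
  have "(\<integral>\<^sup>+\<xi>. ennreal ((norm (fourier u \<xi>))\<^sup>2) \<partial>lborel) = (\<integral>\<^sup>+\<xi>. liminf (\<lambda>n. F n \<xi>) \<partial>lborel)"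
    using lim by (intro nn_integral_cong lim_imp_Liminf[symmetric]) auto
  also have "\<dots> \<le> liminf (\<lambda>n. \<integral>\<^sup>+\<xi>. F n \<xi> \<partial>lborel)"
    by (rule nn_integral_liminf) measurable
  also have "\<dots> \<le> liminf (\<lambda>n. \<integral>\<^sup>+x. ennreal ((norm (u x))\<^sup>2) \<partial>lborel)"
    unfolding F_def by (intro Liminf_mono always_eventually allI nn_integral_fourier_gauss_le u) simp
  finally show ?thesis by (simp add: Liminf_const)
qed

text \<open>One sequence with two limits. On the frequency side it is dominated by |fourier u|; on
  the other side, after the substitution y = x + r z, it is dominated by K times a Gaussian, and
  continuity of u at x identifies the limit.\<close>

lemma inv_fourier_fourier:
  fixes u :: "'a::euclidean_space \<Rightarrow> complex"
  assumes u: "integrable lborel u" and fu: "integrable lborel (fourier u)"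
    and cont: "continuous_on UNIV u" and K: "\<And>x. norm (u x) \<le> K"
  shows "inv_fourier (fourier u) x = u x"
proof (rule LIMSEQ_unique)
  define r where "r n = 1 / real (Suc n)" for n
  have r: "r n > 0" for n by (simp add: r_def)
  have [measurable]: "u \<in> borel_measurable borel"
    using u by (simp add: borel_measurable_integrable)
  have gm: "(\<lambda>n. gauss_mod (r n) x \<xi>) \<longlonglongrightarrow> cis (2 * pi * (x \<bullet> \<xi>))" for \<xi>
    using tendsto_mult[OF tendsto_of_real[OF gauss_scaled_tendsto] tendsto_const, of \<xi>]
    unfolding gauss_mod_def r_def by force
  show "(\<lambda>n. \<integral>\<xi>. fourier u \<xi> * gauss_mod (r n) x \<xi> \<partial>lborel) \<longlonglongrightarrow> inv_fourier (fourier u) x"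
    unfolding inv_fourier_def
  proof (rule integral_dominated_convergence)
    show "integrable lborel (\<lambda>\<xi>. norm (fourier u \<xi>))" using fu by simp
    show "AE \<xi> in lborel. (\<lambda>n. fourier u \<xi> * gauss_mod (r n) x \<xi>) \<longlonglongrightarrow> fourier u \<xi> * cis (2 * pi * (x \<bullet> \<xi>))"
      using gm by (auto intro!: tendsto_intros)
    show "AE \<xi> in lborel. norm (fourier u \<xi> * gauss_mod (r n) x \<xi>) \<le> norm (fourier u \<xi>)" for n
      by (auto simp: gauss_mod_def norm_mult gauss_le_1 intro!: mult_left_le)
  qed (unfold gauss_mod_def cis_conv_exp, measurable)
  have eq: "(\<integral>\<xi>. fourier u \<xi> * gauss_mod (r n) x \<xi> \<partial>lborel) = (\<integral>z. u (x + r n *\<^sub>R z) * of_real (gauss z) \<partial>lborel)" for n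
  proof -
    have rn: "r n \<noteq> 0" "r n > 0" using r[of n] by auto
    have "(\<integral>\<xi>. fourier u \<xi> * gauss_mod (r n) x \<xi> \<partial>lborel)
        = (\<integral>y. u y * of_real (gauss ((y - x) /\<^sub>R r n) / r n ^ DIM('a)) \<partial>lborel)"
      by (rule fourier_gauss_integral[OF u r])
    also have "\<dots> = (\<bar>r n\<bar> ^ DIM('a)) *\<^sub>R
       (\<integral>z. u (x + r n *\<^sub>R z) * of_real (gauss z) / of_real (r n ^ DIM('a)) \<partial>lborel)"
      using rn by (subst lborel_integral_affine[OF _ rn(1), of _ x]) auto
    also have "\<dots> = (\<integral>z. u (x + r n *\<^sub>R z) * of_real (gauss z) \<partial>lborel)"
      using rn by (simp add: scaleR_conv_of_real)
    finally show ?thesis .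
  qed
  have "(\<lambda>n. \<integral>z. u (x + r n *\<^sub>R z) * of_real (gauss z) \<partial>lborel) \<longlonglongrightarrow> (\<integral>z. u x * of_real (gauss (z::'a)) \<partial>lborel)"
  proof (rule integral_dominated_convergence)
    show "integrable lborel (\<lambda>z::'a. K * gauss z)" by (simp add: integrable_gauss)
    have "(\<lambda>n. u (x + r n *\<^sub>R z)) \<longlonglongrightarrow> u x" for z
    proof (rule isCont_tendsto_compose[where g = u])
      show "isCont u x" using cont by (simp add: continuous_on_eq_continuous_at)
      have "(\<lambda>n. x + r n *\<^sub>R z) \<longlonglongrightarrow> x + 0 *\<^sub>R z"
        unfolding r_def by (intro tendsto_intros LIMSEQ_Suc[OF lim_1_over_n])
      then show "(\<lambda>n. x + r n *\<^sub>R z) \<longlonglongrightarrow> x" by simp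
    qed
    then show "AE z in lborel. (\<lambda>n. u (x + r n *\<^sub>R z) * of_real (gauss z)) \<longlonglongrightarrow> u x * of_real (gauss z)"
      by (auto intro!: tendsto_intros)
    show "AE z in lborel. norm (u (x + r n *\<^sub>R z) * of_real (gauss z)) \<le> K * gauss z" for n
      using K by (auto simp: norm_mult intro!: mult_right_mono)
  qed measurable
  then show "(\<lambda>n. \<integral>\<xi>. fourier u \<xi> * gauss_mod (r n) x \<xi> \<partial>lborel) \<longlonglongrightarrow> u x"
    by (simp add: eq integral_gauss)
qed


section \<open>The Hausdorff--Young inequality by real interpolation\<close>

lemma nn_integral_powr_from_0:
  assumes "a > (-1::real)" "c \<ge> 0"
  shows "(\<integral>\<^sup>+x. ennreal (x powr a) * indicator {0..c} x \<partial>lborel) = ennreal (c powr (a + 1) / (a + 1))"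
proof -
  have "ennreal (x powr a) * indicator {0..c} x = ennreal (indicator {0..c} x * x powr a)" for x
    by (simp add: indicator_def)
  then show ?thesis
    using nn_integral_has_integral_lebesgue[OF _ has_integral_powr_from_0[OF assms]] by simp
qed

text \<open>Real interpolation between \<open>L\<^sup>1 \<rightarrow> L\<^sup>\<infinity>\<close> and \<open>L\<^sup>2 \<rightarrow> L\<^sup>2\<close>: at level \<open>l\<close> the
  function is split at a height chosen such that the Fourier transform of the large part is
  at most \<open>l / 2\<close>.\<close>

lemma fourier_level_set_le:
  fixes u :: "'a::euclidean_space \<Rightarrow> complex"
  assumes p: "1 < p" and u: "integrable lborel u"
    and I: "(\<integral>\<^sup>+x. ennreal (norm (u x) powr p) \<partial>lborel) = ennreal I" "I > 0" and l: "l > 0"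
  shows "emeasure lborel {\<xi>. l \<le> norm (fourier u \<xi>)} \<le>
    ennreal (4 / l\<^sup>2) * (\<integral>\<^sup>+x. ennreal ((norm (u x))\<^sup>2) * indicator {x. l \<le> 2 * I * norm (u x) powr (1 - p)} x \<partial>lborel)"
proof -
  have [measurable]: "u \<in> borel_measurable borel"
    using u by (simp add: borel_measurable_integrable)
  \<comment> \<open>The small values of u: where u x is nonzero, the condition reads |u x|^(p - 1)
    \<le> 2 I / l. Since 0 powr (1 - p) = 0 and l > 0, the zeros of u fall outside \<open>A\<close>,
    where \<open>ub\<close> vanishes at them anyway.\<close>
  define A where "A = {x. l \<le> 2 * I * norm (u x) powr (1 - p)}"
  have A[measurable]: "A \<in> sets borel" unfolding A_def by measurable
  define us where "us x = indicator A x * u x" for x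
  define ub where "ub x = indicator (- A) x * u x" for x
  have us: "integrable lborel us" and ub: "integrable lborel ub"
    unfolding us_def ub_def
    by (intro integrable_bounded_mult[OF u, where K = 1]; simp add: indicator_def)+
  have "us x * c + ub x * c = u x * c" for x c
    by (auto simp: us_def ub_def indicator_def)
  then have sum: "fourier u \<xi> = fourier us \<xi> + fourier ub \<xi>" for \<xi>
    unfolding fourier_def using us ub by (subst Bochner_Integration.integral_add[symmetric]) auto
  \<comment> \<open>Off \<open>A\<close> one has |u| \<le> l / (2 I) |u|^p, and |u|^p has integral
    I: the threshold in \<open>A\<close> is made for this bound.\<close>
  have ub_le: "norm (fourier ub \<xi>) \<le> l / 2" for \<xi>
  proof -
    have "ennreal (norm (fourier ub \<xi>)) \<le> (\<integral>\<^sup>+x. ennreal (norm (ub x * cis (- 2 * pi * (x \<bullet> \<xi>)))) \<partial>lborel)"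
      unfolding fourier_def by (rule norm_integral_le_nn_integral)
    also have "\<dots> = (\<integral>\<^sup>+x. ennreal (norm (ub x)) \<partial>lborel)" by (simp add: norm_mult)
    also have "\<dots> \<le> (\<integral>\<^sup>+x. ennreal (l / (2 * I)) * ennreal (norm (u x) powr p) \<partial>lborel)"
    proof (intro nn_integral_mono)
      fix x
      have "norm (u x) \<le> l / (2 * I) * norm (u x) powr p" if "2 * I * norm (u x) powr (1 - p) < l"
      proof (cases "u x = 0")
        case False
        have "norm (u x) = norm (u x) powr (1 - p) * norm (u x) powr p"
          using False by (simp flip: powr_add)
        also have "\<dots> \<le> l / (2 * I) * norm (u x) powr p"
          using that I by (intro mult_right_mono) (auto simp: field_simps)
        finally show ?thesis .
      qed (use l I in simp)
      then show "ennreal (norm (ub x)) \<le> ennreal (l / (2 * I)) * ennreal (norm (u x) powr p)"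
        using l I by (auto simp: ub_def A_def indicator_def simp flip: ennreal_mult intro!: ennreal_leI)
    qed
    also have "\<dots> = ennreal (l / 2)"
 using l I(2) by (subst nn_integral_cmult) (simp_all add: I(1) flip: ennreal_mult)
    finally show ?thesis using l by simp
  qed
  have "emeasure lborel {\<xi>. l \<le> norm (fourier u \<xi>)} = (\<integral>\<^sup>+\<xi>. indicator {\<xi>. l \<le> norm (fourier u \<xi>)} \<xi> \<partial>lborel)"
    by (subst nn_integral_indicator) auto
  \<comment> \<open>Chebyshev's inequality: the large part contributes at most l / 2, so
    \<open>us\<close> must supply the other half wherever the full transform reaches l.\<close>
  also have "\<dots> \<le> (\<integral>\<^sup>+\<xi>. ennreal (4 / l\<^sup>2) * ennreal ((norm (fourier us \<xi>))\<^sup>2) \<partial>lborel)"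
  proof (intro nn_integral_mono)
    fix \<xi>
    have "1 \<le> 4 / l\<^sup>2 * (norm (fourier us \<xi>))\<^sup>2" if "l \<le> norm (fourier u \<xi>)"
    proof -
      have "l / 2 \<le> norm (fourier us \<xi>)"
        using that ub_le[of \<xi>] norm_triangle_ineq[of "fourier us \<xi>" "fourier ub \<xi>"] sum[of \<xi>] by simp
      then have "(l / 2)\<^sup>2 \<le> (norm (fourier us \<xi>))\<^sup>2"
        using l by (intro power_mono) auto
      then show ?thesis using l by (simp add: field_simps power_divide)
    qed
    then show "indicator {\<xi>. l \<le> norm (fourier u \<xi>)} \<xi> \<le> ennreal (4 / l\<^sup>2) * ennreal ((norm (fourier us \<xi>))\<^sup>2)"
      by (auto simp: indicator_def simp flip: ennreal_mult ennreal_1 intro!: ennreal_leI)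
  qed
  also have "\<dots> = ennreal (4 / l\<^sup>2) * (\<integral>\<^sup>+\<xi>. ennreal ((norm (fourier us \<xi>))\<^sup>2) \<partial>lborel)"
    using us by (intro nn_integral_cmult) (auto simp: borel_measurable_integrable intro!: borel_measurable_fourier)
  also have "\<dots> \<le> ennreal (4 / l\<^sup>2) * (\<integral>\<^sup>+x. ennreal ((norm (us x))\<^sup>2) \<partial>lborel)"
    by (intro mult_left_mono plancherel_le us) simp
  also have "(\<integral>\<^sup>+x. ennreal ((norm (us x))\<^sup>2) \<partial>lborel) = (\<integral>\<^sup>+x. ennreal ((norm (u x))\<^sup>2) * indicator A x \<partial>lborel)"
    by (intro nn_integral_cong) (auto simp: us_def indicator_def)
  finally show ?thesis by (simp add: A_def)
qed

text \<open>Layer-cake formula: integrate q l^(q - 1) times the measure of the level set. After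
  inserting \<open>fourier_level_set_le\<close> and exchanging integrals, each x contributes the
  integral of l^(q - 3) up to 2 I |u x|^(1 - p). It converges at 0 because q > 2; its value carries
  the factor 1 / (q - 2), which is infinite at p = 2.\<close>

lemma hausdorff_young_lt_2:
  fixes u :: "'a::euclidean_space \<Rightarrow> complex"
  assumes p: "1 < p" "p < 2" and q: "q = p / (p - 1)" and u: "integrable lborel u"
    and I: "(\<integral>\<^sup>+x. ennreal (norm (u x) powr p) \<partial>lborel) = ennreal I" "I > 0"
  shows "(\<integral>\<^sup>+\<xi>. ennreal (norm (fourier u \<xi>) powr q) \<partial>lborel)
    \<le> ennreal (4 * q * 2 powr (q - 2) / (q - 2) * I powr (q - 1))"
proof -
  have [measurable]: "u \<in> borel_measurable borel"
    using u by (simp add: borel_measurable_integrable)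
  have q2: "q > 2" using p by (simp add: q field_simps)
  \<comment> \<open>The exponent count that turns |u|^2 times the integral in l back into
    |u|^p.\<close>
  have pq: "2 + (1 - p) * (q - 2) = p" using p by (simp add: q field_simps)
  have "(\<integral>\<^sup>+\<xi>. ennreal (norm (fourier u \<xi>) powr q) \<partial>lborel)
    = (\<integral>\<^sup>+\<xi>. (\<integral>\<^sup>+l. ennreal (q * l powr (q - 1)) * indicator {0..norm (fourier u \<xi>)} l \<partial>lborel) \<partial>lborel)"
  proof (intro nn_integral_cong)
    fix \<xi>
    have "(\<integral>\<^sup>+l. ennreal (q * l powr (q - 1)) * indicator {0..norm (fourier u \<xi>)} l \<partial>lborel)
      = ennreal q * (\<integral>\<^sup>+l. ennreal (l powr (q - 1)) * indicator {0..norm (fourier u \<xi>)} l \<partial>lborel)"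
      using q2 by (subst nn_integral_cmult[symmetric]) (auto simp: ennreal_mult mult_ac)
    then show "ennreal (norm (fourier u \<xi>) powr q)
      = (\<integral>\<^sup>+l. ennreal (q * l powr (q - 1)) * indicator {0..norm (fourier u \<xi>)} l \<partial>lborel)"
      using q2 by (simp add: nn_integral_powr_from_0 flip: ennreal_mult)
  qed
  also have "\<dots> = (\<integral>\<^sup>+\<xi>. (\<integral>\<^sup>+l. ennreal (q * l powr (q - 1)) * indicator {0..} l
      * indicator {\<xi>. l \<le> norm (fourier u \<xi>)} \<xi> \<partial>lborel) \<partial>lborel)"
    by (intro nn_integral_cong) (auto simp: indicator_def)
  also have "\<dots> = (\<integral>\<^sup>+l. (\<integral>\<^sup>+\<xi>. ennreal (q * l powr (q - 1)) * indicator {0..} l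
      * indicator {\<xi>. l \<le> norm (fourier u \<xi>)} \<xi> \<partial>lborel) \<partial>lborel)"
    by (rule lborel_pair.Fubini') measurable
  also have "\<dots> = (\<integral>\<^sup>+l. ennreal (q * l powr (q - 1)) * indicator {0..} l
      * emeasure lborel {\<xi>. l \<le> norm (fourier u \<xi>)} \<partial>lborel)"
    by (intro nn_integral_cong) (simp add: nn_integral_cmult_indicator)
  also have "\<dots> \<le> (\<integral>\<^sup>+l. (\<integral>\<^sup>+x. ennreal (4 * q * (norm (u x))\<^sup>2) *
      (ennreal (l powr (q - 3)) * indicator {0..2 * I * norm (u x) powr (1 - p)} l) \<partial>lborel) \<partial>lborel)"
  proof (intro nn_integral_mono)
    fix l :: real
    show "ennreal (q * l powr (q - 1)) * indicator {0..} l * emeasure lborel {\<xi>. l \<le> norm (fourier u \<xi>)}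
      \<le> (\<integral>\<^sup>+x. ennreal (4 * q * (norm (u x))\<^sup>2) *
      (ennreal (l powr (q - 3)) * indicator {0..2 * I * norm (u x) powr (1 - p)} l) \<partial>lborel)"
    proof (cases "l > 0")
      case True
      have l3: "q * l powr (q - 1) * (4 / l\<^sup>2) = 4 * q * l powr (q - 3)"
      proof -
        have "l powr (q - 1) = l powr (q - 3) * l powr 2"
          by (simp flip: powr_add)
        then show ?thesis using True by simp
      qed
      have e3: "ennreal (q * l powr (q - 1)) * ennreal (4 / l\<^sup>2) = ennreal (4 * q * l powr (q - 3))"
        using q2 by (subst ennreal_mult[symmetric]) (simp_all only: l3, simp_all)
      have "ennreal (q * l powr (q - 1)) * indicator {0..} l * emeasure lborel {\<xi>. l \<le> norm (fourier u \<xi>)}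
        \<le> ennreal (q * l powr (q - 1)) * (ennreal (4 / l\<^sup>2) *
          (\<integral>\<^sup>+x. ennreal ((norm (u x))\<^sup>2) * indicator {x. l \<le> 2 * I * norm (u x) powr (1 - p)} x \<partial>lborel))"
        using fourier_level_set_le[OF p(1) u I True] True by (simp add: mult_left_mono)
      also have "\<dots> = ennreal (4 * q * l powr (q - 3)) *
          (\<integral>\<^sup>+x. ennreal ((norm (u x))\<^sup>2) * indicator {x. l \<le> 2 * I * norm (u x) powr (1 - p)} x \<partial>lborel)"
        using e3 by (simp only: mult.assoc[symmetric])
      also have "\<dots> = (\<integral>\<^sup>+x. ennreal (4 * q * (norm (u x))\<^sup>2) *
          (ennreal (l powr (q - 3)) * indicator {0..2 * I * norm (u x) powr (1 - p)} l) \<partial>lborel)"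
        using q2 True
        by (subst nn_integral_cmult[symmetric])
          (auto intro!: nn_integral_cong simp: indicator_def mult_ac simp flip: ennreal_mult)
      finally show ?thesis .
    next
      case False
      then show ?thesis using q2 by (cases "l = 0") (auto simp: indicator_def)
    qed
  qed
  also have "\<dots> = (\<integral>\<^sup>+x. (\<integral>\<^sup>+l. ennreal (4 * q * (norm (u x))\<^sup>2) *
      (ennreal (l powr (q - 3)) * indicator {0..2 * I * norm (u x) powr (1 - p)} l) \<partial>lborel) \<partial>lborel)"
    unfolding indicator_def atLeastAtMost_iff by (rule lborel_pair.Fubini') measurable
  also have "\<dots> = (\<integral>\<^sup>+x. ennreal (4 * q * 2 powr (q - 2) / (q - 2) * I powr (q - 2)) * ennreal (norm (u x) powr p) \<partial>lborel)"
  proof (intro nn_integral_cong)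
    fix x
    have "(\<integral>\<^sup>+l. ennreal (4 * q * (norm (u x))\<^sup>2) *
      (ennreal (l powr (q - 3)) * indicator {0..2 * I * norm (u x) powr (1 - p)} l) \<partial>lborel)
      = ennreal (4 * q * (norm (u x))\<^sup>2) * ennreal ((2 * I * norm (u x) powr (1 - p)) powr (q - 3 + 1) / (q - 3 + 1))"
      using q2 I by (subst nn_integral_cmult) (simp_all add: nn_integral_powr_from_0)
    also have "\<dots> = ennreal (4 * q * (norm (u x))\<^sup>2 * ((2 * I * norm (u x) powr (1 - p)) powr (q - 2) / (q - 2)))"
      using q2 by (simp flip: ennreal_mult)
    also have "4 * q * (norm (u x))\<^sup>2 * ((2 * I * norm (u x) powr (1 - p)) powr (q - 2) / (q - 2))
      = 4 * q * 2 powr (q - 2) / (q - 2) * I powr (q - 2) * norm (u x) powr p"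
    proof (cases "u x = 0")
      case False
      have "(norm (u x))\<^sup>2 * norm (u x) powr ((1 - p) * (q - 2)) = norm (u x) powr (2 + (1 - p) * (q - 2))"
        using False by (simp add: powr_add)
      then have "(norm (u x))\<^sup>2 * norm (u x) powr ((1 - p) * (q - 2)) = norm (u x) powr p" by (simp only: pq)
      then show ?thesis using I by (simp add: powr_mult powr_powr mult_ac)
    qed simp
    finally show "(\<integral>\<^sup>+l. ennreal (4 * q * (norm (u x))\<^sup>2) *
      (ennreal (l powr (q - 3)) * indicator {0..2 * I * norm (u x) powr (1 - p)} l) \<partial>lborel)
      = ennreal (4 * q * 2 powr (q - 2) / (q - 2) * I powr (q - 2)) * ennreal (norm (u x) powr p)"
      using q2 I by (simp flip: ennreal_mult)
  qed
  also have "\<dots> = ennreal (4 * q * 2 powr (q - 2) / (q - 2) * I powr (q - 2)) * ennreal I"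
    by (subst nn_integral_cmult) (simp_all add: I)
  also have "\<dots> = ennreal (4 * q * 2 powr (q - 2) / (q - 2) * (I powr (q - 2) * I))"
    using q2 I by (simp add: mult_ac flip: ennreal_mult)
  also have "I powr (q - 2) * I = I powr (q - 1)"
    using I powr_add[of I "q - 2" 1] by simp
  finally show ?thesis .
qed

text \<open>The level-set bound divides by I, so u = 0 almost everywhere is a separate case; at p =
  2 the Plancherel bound replaces interpolation.\<close>

lemma hausdorff_young:
  assumes p: "1 < p" "p \<le> 2" and q: "q = p / (p - 1)"
  shows "\<exists>C>0. \<forall>u :: 'a::euclidean_space \<Rightarrow> complex. integrable lborel u \<longrightarrow>
    (\<integral>\<^sup>+\<xi>. ennreal (norm (fourier u \<xi>) powr q) \<partial>lborel)
      \<le> ennreal C * ennreal_rpow (\<integral>\<^sup>+x. ennreal (norm (u x) powr p) \<partial>lborel) (q / p)"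
proof (cases "p = 2")
  case True
  then show ?thesis using plancherel_le by (intro exI[of _ 1]) (auto simp: q)
next
  case False
  then have p2: "p < 2" using p by simp
  then have q2: "q > 2" using p by (simp add: q field_simps)
  have qp: "q / p = q - 1" using p by (simp add: q field_simps)
  define C where "C = 4 * q * 2 powr (q - 2) / (q - 2)"
  have C: "C > 0" using q2 by (simp add: C_def)
  show ?thesis
  proof (intro exI[of _ C] conjI allI impI C)
    fix u :: "'a \<Rightarrow> complex" assume u: "integrable lborel u"
    have [measurable]: "u \<in> borel_measurable borel"
      using u by (simp add: borel_measurable_integrable)
    show "(\<integral>\<^sup>+\<xi>. ennreal (norm (fourier u \<xi>) powr q) \<partial>lborel)
      \<le> ennreal C * ennreal_rpow (\<integral>\<^sup>+x. ennreal (norm (u x) powr p) \<partial>lborel) (q / p)"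
    proof (cases "\<integral>\<^sup>+x. ennreal (norm (u x) powr p) \<partial>lborel")
      case top
      then show ?thesis using C by (simp add: ennreal_mult_top)
    next
      case (real I)
      show ?thesis
      proof (cases "I = 0")
        case True
        then have "AE x in lborel. u x = 0"
          using real by (simp add: nn_integral_0_iff_AE)
        then have "fourier u \<xi> = 0" for \<xi>
          unfolding fourier_def by (intro integral_eq_zero_AE) auto
        then show ?thesis by simp
      next
        case False
        then show ?thesis
          using hausdorff_young_lt_2[OF p(1) p2 q u real(2)] real C
          by (simp only: C_def[symmetric] qp ennreal_rpow_ennreal) (simp add: ennreal_mult)
      qed
    qed
  qed
qed

section \<open>The Schwartz space\<close>

text \<open>One step of \<open>partial_derivs\<close>, as a map on functions that can be iterated by
  \<open>^^\<close>.\<close>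

definition pd :: "'a::euclidean_space \<Rightarrow> ('a \<Rightarrow> complex) \<Rightarrow> 'a \<Rightarrow> complex" where
  "pd b f x = frechet_derivative f (at x) b"

lemma partial_derivs_Cons: "partial_derivs (b # bs) f = pd b (partial_derivs bs f)"
  by (simp add: pd_def fun_eq_iff)

lemma partial_derivs_append: "partial_derivs (bs @ cs) f = partial_derivs bs (partial_derivs cs f)"
  by (induction bs) simp_all

lemma pd_eqI: "(f has_derivative D) (at x) \<Longrightarrow> pd b f x = D b"
  by (simp add: pd_def frechet_derivative_at[symmetric])

lemma schwartz_differentiable: "f \<in> schwartz \<Longrightarrow> f differentiable (at x)"
  unfolding schwartz_def smooth_def by (force dest: spec[of _ "[]"])

lemma schwartz_has_derivative:
  "f \<in> schwartz \<Longrightarrow> (f has_derivative frechet_derivative f (at x)) (at x)"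
  using schwartz_differentiable frechet_derivative_works by blast

lemma schwartz_partial_derivs_bound:
  assumes "f \<in> schwartz" "set bs \<subseteq> Basis"
  obtains C where "\<And>x. norm x ^ k * norm (partial_derivs bs f x) \<le> C"
  using assms unfolding schwartz_def bdd_above_def by blast

text \<open>\<open>partial_derivs bs (pd b f)\<close> belongs to the list \<open>bs @ [b]\<close>,
  so no symmetry of second derivatives enters.\<close>

lemma pd_schwartz:
  assumes "f \<in> schwartz" "b \<in> Basis"
  shows "pd b f \<in> schwartz"
proof -
  have "partial_derivs bs (pd b f) = partial_derivs (bs @ [b]) f" for bs
    by (simp add: partial_derivs_append pd_def[abs_def])
  moreover have "set (bs @ [b]) \<subseteq> Basis" if "set bs \<subseteq> Basis" for bs
    using that assms by simp
  ultimately show ?thesis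
    using assms(1) unfolding schwartz_def smooth_def mem_Collect_eq by presburger
qed

text \<open>Most closure properties of the Schwartz space follow from this principle, since the partial
  derivatives of functions of a given shape are again of that shape.\<close>

lemma schwartz_family:
  fixes T :: "'i \<Rightarrow> 'a::euclidean_space \<Rightarrow> complex"
  assumes i: "i \<in> A"
    and pd: "\<And>i b. i \<in> A \<Longrightarrow> b \<in> Basis \<Longrightarrow> \<exists>j\<in>A. pd b (T i) = T j"
    and diff: "\<And>i x. i \<in> A \<Longrightarrow> T i differentiable (at x)"
    and bound: "\<And>i k. i \<in> A \<Longrightarrow> \<exists>C. \<forall>x. norm x ^ k * norm (T i x) \<le> C"
  shows "T i \<in> schwartz"
proof -
  have "\<exists>j\<in>A. partial_derivs bs (T i) = T j" if "set bs \<subseteq> Basis" for bs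
    using that
  proof (induction bs)
    case (Cons b bs)
    then obtain j where "j \<in> A" "partial_derivs bs (T i) = T j" by auto
    then show ?case using pd[of j b] Cons.prems unfolding partial_derivs_Cons by auto
  qed (use i in auto)
  then show ?thesis
    using diff bound unfolding schwartz_def smooth_def bdd_above_def by fastforce
qed

lemma one_plus_power_le: "0 \<le> t \<Longrightarrow> (1 + t) ^ k \<le> 2 ^ k * (1 + t ^ k)" for t :: real
proof -
  assume t: "0 \<le> t"
  then have "(1 + t) ^ k \<le> (2 * max 1 t) ^ k"
    by (intro power_mono) auto
  also have "\<dots> \<le> 2 ^ k * (1 + t ^ k)"
    using t by (auto simp: power_mult_distrib max_def)
  finally show ?thesis .
qed

text \<open>The weight 1 + |x| never vanishes and is submultiplicative under addition of arguments,
  which makes it easier to shift than the powers of |x| in the definition.\<close>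

lemma schwartz_bound:
  fixes f :: "'a::euclidean_space \<Rightarrow> complex"
  assumes "f \<in> schwartz"
  obtains C where "C > 0" "\<And>x. (1 + norm x) ^ k * norm (f x) \<le> C"
proof -
  obtain C0 where C0: "\<And>x. norm x ^ 0 * norm (f x) \<le> C0"
    using schwartz_partial_derivs_bound[OF assms, of "[]" 0] by auto
  obtain C1 where C1: "\<And>x. norm x ^ k * norm (f x) \<le> C1"
    using schwartz_partial_derivs_bound[OF assms, of "[]" k] by auto
  show thesis
  proof (rule that[of "1 + 2 ^ k * (\<bar>C0\<bar> + \<bar>C1\<bar>)"])
    fix x :: 'a
    have "(1 + norm x) ^ k \<le> 2 ^ k * (1 + norm x ^ k)"
      by (simp add: one_plus_power_le)
    then have "(1 + norm x) ^ k * norm (f x) \<le> 2 ^ k * (1 + norm x ^ k) * norm (f x)"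
      by (rule mult_right_mono) simp
    also have "\<dots> = 2 ^ k * (norm x ^ 0 * norm (f x) + norm x ^ k * norm (f x))"
      by (simp add: algebra_simps)
    also have "\<dots> \<le> 2 ^ k * (\<bar>C0\<bar> + \<bar>C1\<bar>)"
      using C0[of x] C1[of x] by (intro mult_left_mono add_mono) auto
    finally show "(1 + norm x) ^ k * norm (f x) \<le> 1 + 2 ^ k * (\<bar>C0\<bar> + \<bar>C1\<bar>)" by simp
  qed (simp add: add_pos_nonneg)
qed

lemma norm_power_le_weight: "norm x ^ k \<le> (1 + norm x) ^ k"
  by (intro power_mono) auto

lemma schwartz_bounded:
  assumes "f \<in> schwartz"
  obtains C where "C > 0" "\<And>x. norm (f x) \<le> C"
  using schwartz_bound[OF assms, of 0] by auto

lemma schwartz_continuous: "f \<in> schwartz \<Longrightarrow> continuous_on A f"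
  using schwartz_differentiable differentiable_imp_continuous_within
  by (blast intro: continuous_at_imp_continuous_on)

lemma schwartz_measurable: "f \<in> schwartz \<Longrightarrow> f \<in> borel_measurable borel"
  by (intro borel_measurable_continuous_onI schwartz_continuous)

lemma pd_add: "f \<in> schwartz \<Longrightarrow> g \<in> schwartz \<Longrightarrow> pd b (\<lambda>x. f x + g x) = (\<lambda>x. pd b f x + pd b g x)"
  unfolding pd_def[abs_def] fun_eq_iff
  by (intro allI frechet_derivative_at[symmetric, THEN fun_cong])
    (auto intro: has_derivative_add schwartz_has_derivative)

lemma pd_mult:
  assumes "f \<in> schwartz" "g \<in> schwartz"
  shows "pd b (\<lambda>x. f x * g x) = (\<lambda>x. pd b f x * g x + f x * pd b g x)"
proof
  fix x
  show "pd b (\<lambda>x. f x * g x) x = pd b f x * g x + f x * pd b g x"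
    using pd_eqI[where b = b, OF has_derivative_mult[OF assms[THEN schwartz_has_derivative, of x]]]
    by (simp add: pd_def add.commute)
qed

lemma pd_cmult:
  assumes "f \<in> schwartz"
  shows "pd b (\<lambda>x. c * f x) = (\<lambda>x. c * pd b f x)"
proof
  fix x
  show "pd b (\<lambda>x. c * f x) x = c * pd b f x"
    using pd_eqI[where b = b, OF has_derivative_mult_right[OF assms[THEN schwartz_has_derivative, of x]]]
    by (simp add: pd_def)
qed

text \<open>Sums, differences and scalar multiples in one closure property. The family is indexed by
  pairs because a derivative acts on the two functions separately.\<close>

lemma schwartz_lin:
  fixes f g :: "'a::euclidean_space \<Rightarrow> complex"
  assumes "f \<in> schwartz" "g \<in> schwartz"
  shows "(\<lambda>x. c * f x + d * g x) \<in> schwartz"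
proof -
  define T where "T p = (\<lambda>x::'a. c * fst p x + d * snd p x)" for p
  have "T (f, g) \<in> schwartz"
  proof (rule schwartz_family[where T = T and A = "schwartz \<times> schwartz"])
    fix p :: "('a \<Rightarrow> complex) \<times> ('a \<Rightarrow> complex)" and b x :: 'a and k
    assume "p \<in> schwartz \<times> schwartz"
    then obtain f g where p: "p = (f, g)" and fg: "f \<in> schwartz" "g \<in> schwartz" by blast
    have "pd b (T p) = T (pd b f, pd b g)"
      unfolding p T_def pd_def[abs_def] fun_eq_iff fst_conv snd_conv
      by (intro allI frechet_derivative_at[symmetric, THEN fun_cong])
        (auto intro!: has_derivative_add has_derivative_mult_right schwartz_has_derivative fg)
    then show "\<exists>j\<in>schwartz \<times> schwartz. pd b (T p) = T j" if "b \<in> Basis"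
      using that fg by (intro bexI[of _ "(pd b f, pd b g)"]) (auto intro: pd_schwartz)
    show "T p differentiable (at x)"
      unfolding p T_def by (auto intro!: differentiable_add differentiable_mult intro: schwartz_differentiable fg)
    obtain C1 where C1: "\<And>x. (1 + norm x) ^ k * norm (f x) \<le> C1" using schwartz_bound[OF fg(1)] by metis
    obtain C2 where C2: "\<And>x. (1 + norm x) ^ k * norm (g x) \<le> C2" using schwartz_bound[OF fg(2)] by metis
    have "norm x ^ k * norm (T p x) \<le> norm c * C1 + norm d * C2" for x
    proof -
      have "norm x ^ k * norm (T p x) \<le> (1 + norm x) ^ k * (norm c * norm (f x) + norm d * norm (g x))"
        unfolding p T_def using norm_triangle_ineq[of "c * f x" "d * g x"]
        by (intro mult_mono norm_power_le_weight) (auto simp: norm_mult)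
      also have "\<dots> = norm c * ((1 + norm x) ^ k * norm (f x)) + norm d * ((1 + norm x) ^ k * norm (g x))"
        by (simp add: algebra_simps)
      also have "\<dots> \<le> norm c * C1 + norm d * C2"
        using C1 C2 by (intro add_mono mult_left_mono) auto
      finally show ?thesis .
    qed
    then show "\<exists>C. \<forall>x. norm x ^ k * norm (T p x) \<le> C" by blast
  qed (use assms in auto)
  then show ?thesis by (simp add: T_def)
qed

lemma schwartz_add: "f \<in> schwartz \<Longrightarrow> g \<in> schwartz \<Longrightarrow> (\<lambda>x. f x + g x) \<in> schwartz"
  using schwartz_lin[of f g 1 1] by simp

lemma schwartz_diff: "f \<in> schwartz \<Longrightarrow> g \<in> schwartz \<Longrightarrow> (\<lambda>x. f x - g x) \<in> schwartz"
  using schwartz_lin[of f g 1 "-1"] by simp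

lemma schwartz_cmult: "f \<in> schwartz \<Longrightarrow> (\<lambda>x. c * f x) \<in> schwartz"
  using schwartz_lin[of f f c 0] by simp

text \<open>The Leibniz rule leads out of the class of products, so \<open>schwartz_family\<close>
  is applied to finite sums of products instead.\<close>

inductive_set product_span :: "('a::euclidean_space \<Rightarrow> complex) set" where
  prod: "f \<in> schwartz \<Longrightarrow> g \<in> schwartz \<Longrightarrow> (\<lambda>x. f x * g x) \<in> product_span"
| add: "f \<in> product_span \<Longrightarrow> g \<in> product_span \<Longrightarrow> (\<lambda>x. f x + g x) \<in> product_span"

text \<open>The three properties go through one induction: the derivative of a sum splits only once
  both summands are known to be differentiable.\<close>

lemma product_span_props:
  assumes "h \<in> product_span"
  shows "h differentiable (at x) \<and> (b \<in> Basis \<longrightarrow> pd b h \<in> product_span)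
    \<and> (\<exists>C. \<forall>x. norm x ^ k * norm (h x) \<le> C)"
  using assms
proof (induction arbitrary: x)
  case (prod f g)
  obtain C1 where C1: "\<And>x. (1 + norm x) ^ k * norm (f x) \<le> C1" using schwartz_bound[OF prod(1)] by metis
  obtain C2 where C2: "C2 > 0" "\<And>x. norm (g x) \<le> C2" using schwartz_bounded[OF prod(2)] by metis
  have "norm x ^ k * norm (f x * g x) \<le> C1 * C2" for x
  proof -
    have "norm x ^ k * norm (f x * g x) \<le> ((1 + norm x) ^ k * norm (f x)) * norm (g x)"
      by (auto simp: norm_mult mult.assoc intro!: mult_right_mono norm_power_le_weight)
    also have "\<dots> \<le> C1 * C2" using C1[of x] C2 order_trans[OF _ C1[of x], of 0]
      by (intro mult_mono) auto
    finally show ?thesis .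
  qed
  with prod show ?case
    by (auto simp: pd_mult schwartz_differentiable intro!: product_span.intros pd_schwartz)
next
  case (add f g)
  then have d: "f differentiable (at x)" "g differentiable (at x)" for x by auto
  have pd: "pd b (\<lambda>x. f x + g x) = (\<lambda>x. pd b f x + pd b g x)"
    using d unfolding pd_def[abs_def] fun_eq_iff
    by (intro allI frechet_derivative_at[symmetric, THEN fun_cong])
      (auto intro: has_derivative_add simp: frechet_derivative_works)
  obtain C1 C2 where C: "\<And>x. norm x ^ k * norm (f x) \<le> C1" "\<And>x. norm x ^ k * norm (g x) \<le> C2"
    using add.IH by meson
  have "norm x ^ k * norm (f x + g x) \<le> C1 + C2" for x
    using mult_left_mono[OF norm_triangle_ineq[of "f x" "g x"], of "norm x ^ k"] C[of x]
    by (simp add: algebra_simps)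
  then show ?case
    using add d by (auto simp: pd intro: product_span.intros)
qed

lemma schwartz_mult: "f \<in> schwartz \<Longrightarrow> g \<in> schwartz \<Longrightarrow> (\<lambda>x. f x * g x) \<in> schwartz"
  by (rule schwartz_family[where T = "\<lambda>h. h" and A = product_span])
    (auto intro: product_span.prod dest: product_span_props)

lemma pd_affine:
  assumes "f \<in> schwartz"
  shows "pd b (\<lambda>x. f (a + c *\<^sub>R x)) = (\<lambda>x. of_real c * pd b f (a + c *\<^sub>R x))"
proof
  fix x
  interpret bounded_linear "frechet_derivative f (at (a + c *\<^sub>R x))"
    using schwartz_has_derivative[OF assms] by (rule has_derivative_bounded_linear)
  have "((\<lambda>x. f (a + c *\<^sub>R x)) has_derivative (\<lambda>h. frechet_derivative f (at (a + c *\<^sub>R x)) (c *\<^sub>R h))) (at x)"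
    by (rule has_derivative_compose[OF _ schwartz_has_derivative[OF assms]]) (auto intro!: derivative_eq_intros)
  from pd_eqI[OF this] show "pd b (\<lambda>x. f (a + c *\<^sub>R x)) x = of_real c * pd b f (a + c *\<^sub>R x)"
    by (simp add: pd_def scaleR scaleR_conv_of_real)
qed

lemma schwartz_affine:
  fixes f :: "'a::euclidean_space \<Rightarrow> complex"
  assumes f: "f \<in> schwartz" and c: "c \<noteq> 0"
  shows "(\<lambda>x. f (a + c *\<^sub>R x)) \<in> schwartz"
proof (rule schwartz_family[OF f, where T = "\<lambda>f x. f (a + c *\<^sub>R x)"])
  fix f :: "'a \<Rightarrow> complex" and b x :: 'a and k
  assume f: "f \<in> schwartz"
  show "\<exists>h\<in>schwartz. pd b (\<lambda>x. f (a + c *\<^sub>R x)) = (\<lambda>x. h (a + c *\<^sub>R x))" if "b \<in> Basis"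
    unfolding pd_affine[OF f] using schwartz_cmult[OF pd_schwartz[OF f that]] by fastforce
  show "(\<lambda>x. f (a + c *\<^sub>R x)) differentiable (at x)"
    by (rule differentiable_compose[of f]) (auto intro!: schwartz_differentiable f derivative_intros)
  obtain C where C: "\<And>x. (1 + norm x) ^ k * norm (f x) \<le> C" using schwartz_bound[OF f] by metis
  \<comment> \<open>From |c| |x| \<le> |a + c x| + |a|.\<close>
  define K where "K = (1 + norm a) / \<bar>c\<bar>"
  have K: "K \<ge> 0" by (simp add: K_def)
  have "norm x \<le> K * (1 + norm (a + c *\<^sub>R x))" for x
  proof -
    have "\<bar>c\<bar> * norm x = norm ((a + c *\<^sub>R x) - a)" by simp
    also have "\<dots> \<le> norm (a + c *\<^sub>R x) + norm a" by (rule norm_triangle_ineq4)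
    also have "\<dots> \<le> (1 + norm a) * (1 + norm (a + c *\<^sub>R x))" by (simp add: algebra_simps)
    finally show ?thesis using c by (simp add: K_def field_simps)
  qed
  then have "norm x ^ k \<le> K ^ k * (1 + norm (a + c *\<^sub>R x)) ^ k" for x
    by (metis norm_ge_zero power_mono power_mult_distrib)
  then have "norm x ^ k * norm (f (a + c *\<^sub>R x)) \<le> K ^ k * (1 + norm (a + c *\<^sub>R x)) ^ k * norm (f (a + c *\<^sub>R x))" for x
    by (intro mult_right_mono) auto
  also have "K ^ k * (1 + norm (a + c *\<^sub>R x)) ^ k * norm (f (a + c *\<^sub>R x)) \<le> K ^ k * C" for x
    using C[of "a + c *\<^sub>R x"] K by (simp add: mult.assoc mult_left_mono)
  finally show "\<exists>C. \<forall>x. norm x ^ k * norm (f (a + c *\<^sub>R x)) \<le> C" by blast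
qed

lemma schwartz_translate: "f \<in> schwartz \<Longrightarrow> (\<lambda>x. f (x - a)) \<in> schwartz"
  using schwartz_affine[of f 1 "- a"] by simp

lemma pd_translate: "f \<in> schwartz \<Longrightarrow> pd b (\<lambda>x. f (x - a)) = (\<lambda>x. pd b f (x - a))"
  using pd_affine[of f b "- a" 1] by simp

lemma schwartz_dilate: "f \<in> schwartz \<Longrightarrow> c \<noteq> 0 \<Longrightarrow> (\<lambda>x. f (c *\<^sub>R x)) \<in> schwartz"
  using schwartz_affine[of f c 0] by simp

lemma pd_dilate: "f \<in> schwartz \<Longrightarrow> pd b (\<lambda>x. f (c *\<^sub>R x)) = (\<lambda>x. of_real c * pd b f (c *\<^sub>R x))"
  using pd_affine[of f b 0 c] by simp

lemma schwartz_cnj: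
  fixes f :: "'a::euclidean_space \<Rightarrow> complex"
  assumes f: "f \<in> schwartz"
  shows "(\<lambda>x. cnj (f x)) \<in> schwartz"
proof (rule schwartz_family[OF f, where T = "\<lambda>f x. cnj (f x)"])
  fix f :: "'a \<Rightarrow> complex" and b x :: 'a and k
  assume f: "f \<in> schwartz"
  have "pd b (\<lambda>x. cnj (f x)) x = cnj (pd b f x)" for x
    using pd_eqI[OF has_derivative_cnj[OF schwartz_has_derivative[OF f]]] by (simp add: pd_def)
  then show "\<exists>h\<in>schwartz. pd b (\<lambda>x. cnj (f x)) = (\<lambda>x. cnj (h x))" if "b \<in> Basis"
    using pd_schwartz[OF f that] by blast
  show "(\<lambda>x. cnj (f x)) differentiable (at x)"
    using has_derivative_cnj[OF schwartz_has_derivative[OF f]] by (auto simp: differentiable_def)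
  show "\<exists>C. \<forall>x. norm x ^ k * norm (cnj (f x)) \<le> C"
    using schwartz_partial_derivs_bound[OF f, of "[]" k] by auto
qed

lemma has_derivative_cis_inner:
  "((\<lambda>x. cis (x \<bullet> a)) has_derivative (\<lambda>h. \<i> * of_real (h \<bullet> a) * cis (x \<bullet> a))) (at x)"
proof -
  have "((\<lambda>x. \<i> * of_real (x \<bullet> a)) has_derivative (\<lambda>h. \<i> * of_real (h \<bullet> a))) (at x)"
    by (auto intro!: derivative_eq_intros)
  from has_derivative_compose[OF this DERIV_exp[unfolded has_field_derivative_def]]
  show ?thesis by (simp add: cis_conv_exp mult_ac)
qed

lemma
  fixes f :: "'a::euclidean_space \<Rightarrow> complex"
  assumes "f \<in> schwartz"
  shows schwartz_modulation: "(\<lambda>x. f x * cis (x \<bullet> a)) \<in> schwartz" (is ?thesis1)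
    and pd_modulation: "pd b (\<lambda>x. f x * cis (x \<bullet> a)) = (\<lambda>x. (pd b f x + \<i> * of_real (b \<bullet> a) * f x) * cis (x \<bullet> a))" (is ?thesis2)
proof -
  have pd: "pd b (\<lambda>x. f x * cis (x \<bullet> a)) = (\<lambda>x. (1 * pd b f x + \<i> * of_real (b \<bullet> a) * f x) * cis (x \<bullet> a))"
    if "f \<in> schwartz" for f b
    using pd_eqI[where b = b, OF has_derivative_mult[OF schwartz_has_derivative[OF that] has_derivative_cis_inner]]
    by (auto simp: pd_def fun_eq_iff algebra_simps)
  show ?thesis2 using pd[OF assms] by simp
  show ?thesis1
  proof (rule schwartz_family[OF assms, where T = "\<lambda>f x. f x * cis (x \<bullet> a)"])
    fix f :: "'a \<Rightarrow> complex" and b x :: 'a and k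
    assume f: "f \<in> schwartz"
    show "\<exists>h\<in>schwartz. pd b (\<lambda>x. f x * cis (x \<bullet> a)) = (\<lambda>x. h x * cis (x \<bullet> a))" if "b \<in> Basis"
      unfolding pd[OF f] using schwartz_lin[OF pd_schwartz[OF f that] f, of 1 "\<i> * of_real (b \<bullet> a)"]
      by (intro bexI[of _ "\<lambda>x. 1 * pd b f x + \<i> * of_real (b \<bullet> a) * f x"] refl)
    show "(\<lambda>x. f x * cis (x \<bullet> a)) differentiable (at x)"
      using has_derivative_mult[OF schwartz_has_derivative[OF f] has_derivative_cis_inner]
      by (auto simp: differentiable_def)
    show "\<exists>C. \<forall>x. norm x ^ k * norm (f x * cis (x \<bullet> a)) \<le> C"
      using schwartz_partial_derivs_bound[OF f, of "[]" k] by (auto simp: norm_mult)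
  qed
qed

text \<open>Differentiating the coordinate factor leaves a multiple of f alone, so the family
  consists of the functions (x \<bullet> c) f + g with both f and g Schwartz.\<close>

lemma schwartz_coord_mult:
  fixes f :: "'a::euclidean_space \<Rightarrow> complex"
  assumes "f \<in> schwartz"
  shows "(\<lambda>x. of_real (x \<bullet> c) * f x) \<in> schwartz"
proof -
  define T where "T p = (\<lambda>x. of_real (x \<bullet> c) * fst p x + snd p x)" for p :: "('a \<Rightarrow> complex) \<times> ('a \<Rightarrow> complex)"
  have d: "((\<lambda>x. of_real (x \<bullet> c) :: complex) has_derivative (\<lambda>h. of_real (h \<bullet> c))) (at x)" for x
    by (auto intro!: derivative_eq_intros)
  \<comment> \<open>The second component is the zero function, written so that
    \<open>schwartz_cmult\<close> shows it to be Schwartz.\<close>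
  have "T (f, \<lambda>x. 0 * f x) \<in> schwartz"
  proof (rule schwartz_family[where T = T and A = "schwartz \<times> schwartz"])
    show "(f, \<lambda>x. 0 * f x) \<in> schwartz \<times> schwartz"
      using assms schwartz_cmult[OF assms, of 0] by simp
  next
    fix p :: "('a \<Rightarrow> complex) \<times> ('a \<Rightarrow> complex)" and b x :: 'a and k
    assume "p \<in> schwartz \<times> schwartz"
    then obtain f g where p: "p = (f, g)" and fg: "f \<in> schwartz" "g \<in> schwartz" by blast
    have deriv: "(T p has_derivative (\<lambda>h. of_real (x \<bullet> c) * frechet_derivative f (at x) h
        + of_real (h \<bullet> c) * f x + frechet_derivative g (at x) h)) (at x)" for x
      unfolding p T_def fst_conv snd_conv
      by (intro has_derivative_add has_derivative_mult d schwartz_has_derivative fg)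
    have "pd b (T p) = T (pd b f, \<lambda>x. of_real (b \<bullet> c) * f x + 1 * pd b g x)"
      using pd_eqI[OF deriv, where b = b] by (simp add: T_def pd_def fun_eq_iff)
    then show "\<exists>j\<in>schwartz \<times> schwartz. pd b (T p) = T j" if "b \<in> Basis"
      using schwartz_lin[OF fg(1) pd_schwartz[OF fg(2) that], of "of_real (b \<bullet> c)" 1] pd_schwartz[OF fg(1) that]
      by (intro bexI[of _ "(pd b f, \<lambda>x. of_real (b \<bullet> c) * f x + 1 * pd b g x)"]) auto
    show "T p differentiable (at x)"
      using deriv by (auto simp: differentiable_def)
    obtain C1 where C1: "\<And>x. norm x ^ Suc k * norm (f x) \<le> C1"
      using schwartz_partial_derivs_bound[OF fg(1), of "[]" "Suc k"] by auto
    obtain C2 where C2: "\<And>x. norm x ^ k * norm (g x) \<le> C2"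
      using schwartz_partial_derivs_bound[OF fg(2), of "[]" k] by auto
    have "norm x ^ k * norm (T p x) \<le> norm c * C1 + C2" for x
    proof -
      have "norm (T p x) \<le> \<bar>x \<bullet> c\<bar> * norm (f x) + norm (g x)"
        unfolding p T_def by (rule order_trans[OF norm_triangle_ineq]) (simp add: norm_mult)
      also have "\<dots> \<le> norm x * norm c * norm (f x) + norm (g x)"
        by (intro add_mono mult_right_mono Cauchy_Schwarz_ineq2) auto
      finally have "norm x ^ k * norm (T p x) \<le> norm x ^ k * (norm x * norm c * norm (f x) + norm (g x))"
        by (intro mult_left_mono) auto
      also have "\<dots> = norm c * (norm x ^ Suc k * norm (f x)) + norm x ^ k * norm (g x)"
        by (simp add: algebra_simps)
      also have "\<dots> \<le> norm c * C1 + C2"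
        using C1 C2 by (intro add_mono mult_left_mono) auto
      finally show ?thesis .
    qed
    then show "\<exists>C. \<forall>x. norm x ^ k * norm (T p x) \<le> C" by blast
  qed
  then show ?thesis by (simp add: T_def)
qed

section \<open>The Fourier transform on the Schwartz space\<close>

text \<open>As 1 + (x \<bullet> b)^2 \<le> (1 + |x|)^2 for each coordinate, the product of the
  one-dimensional functions 1 / (1 + t^2) is a majorant. This is the origin of the exponent 2 d in
  the later weights and derivative counts.\<close>

lemma integrable_weight:
  "integrable lborel (\<lambda>x::'a::euclidean_space. 1 / (1 + norm x) ^ (2 * DIM('a)))"
proof (rule Bochner_Integration.integrable_bound)
  have "integrable lborel (\<lambda>t::real. complex_of_real (1 / (1 + t\<^sup>2)))"
    using integrable_inverse_1_plus_square
    by (intro integrable_of_real) (simp add: set_integrable_def einterval_eq inverse_eq_divide)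
  then show "integrable lborel (\<lambda>x::'a. \<Prod>b\<in>Basis. complex_of_real (1 / (1 + (x \<bullet> b)\<^sup>2)))"
    by (rule lborel_integral_prod(1))
  have "1 / (1 + norm x) ^ (2 * DIM('a)) \<le> (\<Prod>b\<in>Basis. 1 / (1 + (x \<bullet> b)\<^sup>2))" for x :: 'a
  proof -
    have "(\<Prod>b\<in>Basis. 1 + (x \<bullet> b)\<^sup>2) \<le> (\<Prod>b\<in>(Basis :: 'a set). (1 + norm x)\<^sup>2)"
    proof (intro prod_mono conjI)
      fix b :: 'a assume b: "b \<in> Basis"
      have "(x \<bullet> b)\<^sup>2 \<le> (norm x)\<^sup>2"
        using Basis_le_norm[OF b, of x] by (simp flip: abs_le_square_iff)
      also have "1 + (norm x)\<^sup>2 \<le> (1 + norm x)\<^sup>2"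
        by (simp add: power2_eq_square algebra_simps)
      finally show "1 + (x \<bullet> b)\<^sup>2 \<le> (1 + norm x)\<^sup>2" by simp
    qed (simp add: add_nonneg_nonneg)
    also have "\<dots> = (1 + norm x) ^ (2 * DIM('a))" by (simp add: power_mult)
    finally show ?thesis
      by (auto simp: prod_dividef intro!: divide_left_mono mult_pos_pos prod_pos add_pos_nonneg zero_less_power)
  qed
  moreover have "norm (\<Prod>b\<in>Basis. complex_of_real (1 / (1 + (x \<bullet> b)\<^sup>2))) = (\<Prod>b\<in>Basis. 1 / (1 + (x \<bullet> b)\<^sup>2))" for x :: 'a
    unfolding prod_norm[symmetric] norm_of_real by (intro prod.cong) auto
  ultimately show "AE x in lborel. norm (1 / (1 + norm (x::'a)) ^ (2 * DIM('a))) \<le> norm (\<Prod>b\<in>Basis. complex_of_real (1 / (1 + (x \<bullet> b)\<^sup>2)))"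
    by (intro AE_I2) (simp only: real_norm_def abs_divide power_abs abs_of_nonneg add_nonneg_nonneg norm_ge_zero zero_le_one abs_one)
qed measurable

lemma schwartz_weight_integrable:
  fixes f :: "'a::euclidean_space \<Rightarrow> complex"
  assumes f: "f \<in> schwartz"
  shows "integrable lborel (\<lambda>x. (1 + norm x) ^ k * norm (f x))"
proof -
  have [measurable]: "f \<in> borel_measurable borel" using f by (rule schwartz_measurable)
  obtain C where C: "C > 0" "\<And>x. (1 + norm x) ^ (k + 2 * DIM('a)) * norm (f x) \<le> C"
    using schwartz_bound[OF f] by metis
  have "(1 + norm x) ^ k * norm (f x) \<le> C * (1 / (1 + norm x) ^ (2 * DIM('a)))" for x
  proof -
    have "1 + norm x > 0" by (simp add: add_pos_nonneg)
    then show ?thesis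
      using C(2)[of x] by (simp add: field_simps power_add)
  qed
  then show ?thesis
    using C
    by (intro Bochner_Integration.integrable_bound[OF integrable_mult_right[OF integrable_weight, of C]])
      (auto simp: abs_mult)
qed

lemma schwartz_integrable: "f \<in> schwartz \<Longrightarrow> integrable lborel f"
  using schwartz_weight_integrable[of f 0] schwartz_measurable
  by (subst integrable_norm_iff[symmetric]) auto

lemma integral_translate:
  fixes f :: "'a::euclidean_space \<Rightarrow> complex"
  assumes "f \<in> borel_measurable borel"
  shows "(\<integral>x. f (x + a) \<partial>lborel) = (\<integral>x. f x \<partial>lborel)"
  using lborel_integral_affine[OF assms, of 1 a] by (simp add: add.commute)

lemma integrable_translate:
  fixes f :: "'a::euclidean_space \<Rightarrow> complex"
  assumes "integrable lborel f"
  shows "integrable lborel (\<lambda>x. f (x + a))"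
  using assms lborel_integrable_affine_iff[of f 1 a] by (simp add: add.commute borel_measurable_integrable)

text \<open>Difference quotients have integral 0 by translation invariance, and they converge to the
  derivative under an integrable majorant.\<close>

lemma integral_pd_zero:
  fixes f :: "'a::euclidean_space \<Rightarrow> complex"
  assumes f: "f \<in> schwartz" and b: "b \<in> Basis"
  shows "(\<integral>x. pd b f x \<partial>lborel) = 0"
proof -
  note pf = pd_schwartz[OF f b]
  have [measurable]: "f \<in> borel_measurable borel" "pd b f \<in> borel_measurable borel"
    using f pf by (auto intro: schwartz_measurable)
  define r where "r n = 1 / real (Suc n)" for n
  have r: "r n > 0" "r n \<le> 1" for n by (auto simp: r_def)
  have r0: "r \<longlonglongrightarrow> 0" unfolding r_def by (rule LIMSEQ_Suc[OF lim_1_over_n])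
  define q where "q n x = (f (x + r n *\<^sub>R b) - f x) /\<^sub>R r n" for n x
  obtain C where C: "C > 0" "\<And>x. (1 + norm x) ^ (2 * DIM('a)) * norm (pd b f x) \<le> C"
    using schwartz_bound[OF pf] by metis
  have deriv: "((\<lambda>t. f (x + t *\<^sub>R b)) has_derivative (\<lambda>h. h *\<^sub>R pd b f (x + s *\<^sub>R b))) (at s)" for x s
  proof -
    interpret bounded_linear "frechet_derivative f (at (x + s *\<^sub>R b))"
      using schwartz_has_derivative[OF f] by (rule has_derivative_bounded_linear)
    have "((\<lambda>t. f (x + t *\<^sub>R b)) has_derivative (\<lambda>h. frechet_derivative f (at (x + s *\<^sub>R b)) (h *\<^sub>R b))) (at s)"
      by (rule has_derivative_compose[OF _ schwartz_has_derivative[OF f]]) (auto intro!: derivative_eq_intros)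
    then show ?thesis by (simp add: pd_def scaleR)
  qed
  have "(\<lambda>n. \<integral>x. q n x \<partial>lborel) \<longlonglongrightarrow> (\<integral>x. pd b f x \<partial>lborel)"
  \<comment> \<open>By the mean value theorem a quotient is bounded by the derivative at some x + s
    b with 0 < s < 1, and there 1 + |x| \<le> 2 (1 + |x + s b|): hence the factor 2^(2 d).\<close>
  proof (rule integral_dominated_convergence[where w = "\<lambda>x. 2 ^ (2 * DIM('a)) * C * (1 / (1 + norm x) ^ (2 * DIM('a)))"])
    show "integrable lborel (\<lambda>x::'a. 2 ^ (2 * DIM('a)) * C * (1 / (1 + norm x) ^ (2 * DIM('a))))"
      by (rule integrable_mult_right[OF integrable_weight])
    have "(\<lambda>n. q n x) \<longlonglongrightarrow> pd b f x" for x
    proof -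
      have "((\<lambda>t. norm (f (x + (0 + t) *\<^sub>R b) - f (x + 0 *\<^sub>R b) - t *\<^sub>R pd b f (x + 0 *\<^sub>R b)) / norm t) \<longlongrightarrow> 0) (at 0)"
        using deriv[of x 0] unfolding has_derivative_at by blast
      then have "((\<lambda>t. norm ((f (x + t *\<^sub>R b) - f x) /\<^sub>R t - pd b f x)) \<longlongrightarrow> 0) (at 0)"
      proof (rule Lim_transform_eventually)
        have "norm (f (x + t *\<^sub>R b) - f x - t *\<^sub>R pd b f x) / norm t = norm ((f (x + t *\<^sub>R b) - f x) /\<^sub>R t - pd b f x)"
          if "t \<noteq> 0" for t
        proof -
          have "(f (x + t *\<^sub>R b) - f x) /\<^sub>R t - pd b f x = (f (x + t *\<^sub>R b) - f x - t *\<^sub>R pd b f x) /\<^sub>R t"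
            using that by (simp add: scaleR_diff_right)
          then show ?thesis by (simp only: norm_scaleR divide_inverse abs_inverse real_norm_def mult.commute)
        qed
        then show "\<forall>\<^sub>F t in at 0. norm (f (x + (0 + t) *\<^sub>R b) - f (x + 0 *\<^sub>R b) - t *\<^sub>R pd b f (x + 0 *\<^sub>R b)) / norm t
          = norm ((f (x + t *\<^sub>R b) - f x) /\<^sub>R t - pd b f x)"
          unfolding eventually_at_filter by (intro always_eventually allI impI) simp
      qed
      then have "((\<lambda>t. (f (x + t *\<^sub>R b) - f x) /\<^sub>R t) \<longlongrightarrow> pd b f x) (at 0)"
        by (rule LIM_zero_cancel[OF tendsto_norm_zero_cancel])
      moreover have "filterlim r (at 0) sequentially"
        using r0 r(1) by (simp add: filterlim_at less_imp_neq[THEN not_sym])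
      ultimately show ?thesis
        unfolding q_def
        by (rule filterlim_compose[where f = r and g = "\<lambda>t. (f (x + t *\<^sub>R b) - f x) /\<^sub>R t"])
    qed
    then show "AE x in lborel. (\<lambda>n. q n x) \<longlonglongrightarrow> pd b f x" by simp
    have "norm (q n x) \<le> 2 ^ (2 * DIM('a)) * C * (1 / (1 + norm x) ^ (2 * DIM('a)))" for n x
    proof -
      have "\<exists>s\<in>{0<..<r n}. norm (f (x + r n *\<^sub>R b) - f (x + 0 *\<^sub>R b)) \<le> norm ((r n - 0) *\<^sub>R pd b f (x + s *\<^sub>R b))"
      proof (rule mvt_general[OF r(1)])
        show "continuous_on {0..r n} (\<lambda>t. f (x + t *\<^sub>R b))"
          using has_derivative_continuous[OF deriv] by (intro continuous_at_imp_continuous_on) auto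
        show "((\<lambda>t. f (x + t *\<^sub>R b)) has_derivative (\<lambda>h. h *\<^sub>R pd b f (x + s *\<^sub>R b))) (at s)" for s
          by (rule deriv)
      qed
      then obtain s where s: "0 < s" "s < r n"
        and le: "norm (f (x + r n *\<^sub>R b) - f x) \<le> r n * norm (pd b f (x + s *\<^sub>R b))"
        using r[of n] by auto
      have "norm x \<le> norm (x + s *\<^sub>R b) + norm (s *\<^sub>R b)"
        using norm_triangle_ineq4[of "x + s *\<^sub>R b" "s *\<^sub>R b"] by simp
      moreover have "norm (s *\<^sub>R b) \<le> 1" using s b r(2)[of n] by simp
      ultimately have "1 + norm x \<le> 2 * (1 + norm (x + s *\<^sub>R b))"
        using norm_ge_zero[of "x + s *\<^sub>R b"] unfolding distrib_left by (smt (verit))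
      then have "(1 + norm x) ^ (2 * DIM('a)) \<le> 2 ^ (2 * DIM('a)) * (1 + norm (x + s *\<^sub>R b)) ^ (2 * DIM('a))"
        unfolding power_mult_distrib[symmetric] by (intro power_mono) auto
      then have "(1 + norm x) ^ (2 * DIM('a)) * norm (pd b f (x + s *\<^sub>R b))
          \<le> 2 ^ (2 * DIM('a)) * ((1 + norm (x + s *\<^sub>R b)) ^ (2 * DIM('a)) * norm (pd b f (x + s *\<^sub>R b)))"
        unfolding mult.assoc[symmetric] by (intro mult_right_mono) auto
      also have "\<dots> \<le> 2 ^ (2 * DIM('a)) * C" using C by (intro mult_left_mono) auto
      finally have "norm (pd b f (x + s *\<^sub>R b)) \<le> 2 ^ (2 * DIM('a)) * C / (1 + norm x) ^ (2 * DIM('a))"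
        by (subst pos_le_divide_eq) (auto simp: add_pos_nonneg mult.commute)
      moreover have "norm (q n x) \<le> norm (pd b f (x + s *\<^sub>R b))"
      proof -
        have "norm (q n x) = norm (f (x + r n *\<^sub>R b) - f x) / r n"
          using r(1)[of n] by (simp add: q_def divide_inverse mult.commute)
        then show ?thesis
          using le r(1)[of n] by (simp only: pos_divide_le_eq mult.commute)
      qed
      ultimately show ?thesis by simp
    qed
    then show "AE x in lborel. norm (q n x) \<le> 2 ^ (2 * DIM('a)) * C * (1 / (1 + norm x) ^ (2 * DIM('a)))" for n
      by simp
  qed (unfold q_def, measurable)
  moreover have "(\<integral>x. q n x \<partial>lborel) = 0" for n
    unfolding q_def using schwartz_integrable[OF f] integrable_translate[OF schwartz_integrable[OF f]]
    by (simp add: integral_translate)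
  ultimately show ?thesis by (simp add: LIMSEQ_const_iff)
qed

lemma modulation_eq: "cis (- 2 * pi * (x \<bullet> y)) = cis (x \<bullet> ((- 2 * pi) *\<^sub>R y))"
  by simp

text \<open>Integration by parts: the derivative of f times the character has integral 0.\<close>

lemma fourier_pd:
  assumes f: "f \<in> schwartz" and b: "b \<in> Basis"
  shows "fourier (pd b f) \<xi> = 2 * pi * \<i> * of_real (\<xi> \<bullet> b) * fourier f \<xi>"
proof -
  define e where "e x = cis (x \<bullet> ((- 2 * pi) *\<^sub>R \<xi>))" for x
  have int: "integrable lborel (\<lambda>x. g x * e x)" if "g \<in> schwartz" for g
    unfolding e_def using schwartz_integrable[OF schwartz_modulation[OF that]] .
  have "0 = (\<integral>x. pd b (\<lambda>x. f x * e x) x \<partial>lborel)"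
    unfolding e_def by (rule integral_pd_zero[OF schwartz_modulation[OF f] b, symmetric])
  also have "\<dots> = (\<integral>x. pd b f x * e x - 2 * pi * \<i> * of_real (\<xi> \<bullet> b) * (f x * e x) \<partial>lborel)"
    unfolding e_def pd_modulation[OF f]
  proof (intro Bochner_Integration.integral_cong refl)
    have "of_real (b \<bullet> (- 2 * pi) *\<^sub>R \<xi>) = - (2 * pi * complex_of_real (\<xi> \<bullet> b))"
      by (simp add: inner_commute)
    then show "(pd b f x + \<i> * of_real (b \<bullet> (- 2 * pi) *\<^sub>R \<xi>) * f x) * cis (x \<bullet> (- 2 * pi) *\<^sub>R \<xi>)
      = pd b f x * cis (x \<bullet> (- 2 * pi) *\<^sub>R \<xi>)
        - 2 * pi * \<i> * of_real (\<xi> \<bullet> b) * (f x * cis (x \<bullet> (- 2 * pi) *\<^sub>R \<xi>))" for x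
      by (simp only:) (simp only: ring_distribs mult_minus_left mult_minus_right diff_conv_add_uminus mult_ac)
  qed
  also have "\<dots> = (\<integral>x. pd b f x * e x \<partial>lborel) - 2 * pi * \<i> * of_real (\<xi> \<bullet> b) * (\<integral>x. f x * e x \<partial>lborel)"
    by (simp only: Bochner_Integration.integral_diff integral_mult_right_zero integrable_mult_right
        int[OF f] int[OF pd_schwartz[OF f b]])
  finally show ?thesis
    unfolding fourier_def modulation_eq e_def by simp
qed

text \<open>Differentiation under the integral with an explicit remainder: |exp(it) - 1 - it| \<le>
  t^2 / 2 gives an error of order |y - \<xi>|^2 times the second moment of |f|.\<close>

lemma fourier_has_derivative:
  fixes f :: "'a::euclidean_space \<Rightarrow> complex"
  assumes f: "f \<in> schwartz"
  shows "(fourier f has_derivative (\<lambda>h. fourier (\<lambda>x. - 2 * pi * \<i> * (of_real (x \<bullet> h) * f x)) \<xi>)) (at \<xi>)"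
proof -
  have [measurable]: "f \<in> borel_measurable borel" using f by (rule schwartz_measurable)
  define e where "e y x = cis (- 2 * pi * (x \<bullet> y))" for x y :: 'a
  have int0: "integrable lborel (\<lambda>x. f x * e y x)" for y
    unfolding e_def using schwartz_integrable[OF f] by simp
  have int1: "integrable lborel (\<lambda>x. - 2 * pi * \<i> * (of_real (x \<bullet> h) * f x) * e y x)" for h y
    unfolding e_def using schwartz_integrable[OF schwartz_coord_mult[OF f]] by simp
  define M1 where "M1 = (\<integral>x. norm x * norm (f x) \<partial>lborel)"
  define M2 where "M2 = (\<integral>x. (norm x)\<^sup>2 * norm (f x) \<partial>lborel)"
  have i2: "integrable lborel (\<lambda>x. norm x ^ k * norm (f x))" for k
    by (rule Bochner_Integration.integrable_bound[OF schwartz_weight_integrable[OF f, of k]])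
      (auto simp: abs_mult intro!: mult_right_mono order_trans[OF norm_power_le_weight])
  define L where "L h = (\<integral>x. - 2 * pi * \<i> * (of_real (x \<bullet> h) * f x) * e \<xi> x \<partial>lborel)" for h
  have lin: "bounded_linear L"
  proof (rule bounded_linear_intro[where K = "2 * pi * M1"])
    show "L (h + k) = L h + L k" for h k
      unfolding L_def by (subst Bochner_Integration.integral_add[symmetric, OF int1 int1])
        (simp add: algebra_simps inner_add_right)
    show "L (c *\<^sub>R h) = c *\<^sub>R L h" for c h
    proof -
      have "L (c *\<^sub>R h) = (\<integral>x. c *\<^sub>R (- 2 * pi * \<i> * (of_real (x \<bullet> h) * f x) * e \<xi> x) \<partial>lborel)"
        unfolding L_def by (intro Bochner_Integration.integral_cong) (auto simp: scaleR_conv_of_real algebra_simps)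
      then show ?thesis unfolding L_def by (simp only: integral_scaleR_right)
    qed
    show "norm (L h) \<le> norm h * (2 * pi * M1)" for h
    proof -
      have "norm (L h) \<le> (\<integral>x. norm h * (2 * pi) * (norm x ^ 1 * norm (f x)) \<partial>lborel)"
        unfolding L_def
      proof (rule Bochner_Integration.integral_norm_bound_integral)
        show "integrable lborel (\<lambda>x. norm h * (2 * pi) * (norm x ^ 1 * norm (f x)))"
          by (rule integrable_mult_right[OF i2])
        fix x
        have "norm (- 2 * pi * \<i> * (of_real (x \<bullet> h) * f x) * e \<xi> x) = 2 * pi * (\<bar>x \<bullet> h\<bar> * norm (f x))"
          by (simp add: norm_mult e_def)
        also have "\<dots> \<le> 2 * pi * (norm x * norm h * norm (f x))"
          by (intro mult_left_mono mult_right_mono Cauchy_Schwarz_ineq2) auto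
        finally show "norm (- 2 * pi * \<i> * (of_real (x \<bullet> h) * f x) * e \<xi> x) \<le> norm h * (2 * pi) * (norm x ^ 1 * norm (f x))"
          by (simp add: algebra_simps)
      qed (rule int1)
      also have "\<dots> = norm h * (2 * pi * M1)" by (simp add: M1_def)
      finally show ?thesis .
    qed
  qed
  have quad: "norm (fourier f y - fourier f \<xi> - L (y - \<xi>)) \<le> (norm (y - \<xi>))\<^sup>2 * (2 * pi\<^sup>2 * M2)" for y
  proof -
    define h where "h = y - \<xi>"
    have "fourier f y - fourier f \<xi> - L h
      = (\<integral>x. f x * e y x - f x * e \<xi> x - (- 2 * pi * \<i> * (of_real (x \<bullet> h) * f x) * e \<xi> x) \<partial>lborel)"
      unfolding fourier_def L_def e_def[symmetric]
      by (simp only: Bochner_Integration.integral_diff Bochner_Integration.integrable_diff int0 int1)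
    also have "norm \<dots> \<le> (\<integral>x. (norm h)\<^sup>2 * (2 * pi\<^sup>2) * (norm x ^ 2 * norm (f x)) \<partial>lborel)"
    proof (rule Bochner_Integration.integral_norm_bound_integral)
      show "integrable lborel (\<lambda>x. f x * e y x - f x * e \<xi> x - (- 2 * pi * \<i> * (of_real (x \<bullet> h) * f x) * e \<xi> x))"
        by (intro Bochner_Integration.integrable_diff int0 int1)
      show "integrable lborel (\<lambda>x. (norm h)\<^sup>2 * (2 * pi\<^sup>2) * (norm x ^ 2 * norm (f x)))"
        by (rule integrable_mult_right[OF i2])
      fix x
      define t where "t = - 2 * pi * (x \<bullet> h)"
      have "e y x = e \<xi> x * cis t"
        by (simp add: e_def t_def h_def cis_mult algebra_simps inner_diff_right)
      then have "f x * e y x - f x * e \<xi> x - (- 2 * pi * \<i> * (of_real (x \<bullet> h) * f x) * e \<xi> x)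
        = f x * e \<xi> x * (cis t - (1 + \<i> * of_real t))"
        by (simp add: t_def algebra_simps)
      moreover have "norm (f x * e \<xi> x * (cis t - (1 + \<i> * of_real t))) = norm (f x) * norm (cis t - (1 + \<i> * of_real t))"
        by (simp add: norm_mult e_def)
      moreover have "norm (cis t - (1 + \<i> * of_real t)) \<le> \<bar>t\<bar> ^ 2 / 2"
        using iexp_approx1[of t 1] by (simp add: cis_conv_exp numeral_2_eq_2)
      moreover have "\<bar>t\<bar> ^ 2 \<le> (2 * pi * (norm x * norm h)) ^ 2"
        unfolding t_def by (intro power_mono)
          (auto simp: abs_mult intro!: mult_left_mono Cauchy_Schwarz_ineq2)
      ultimately have "norm (f x * e y x - f x * e \<xi> x - (- 2 * pi * \<i> * (of_real (x \<bullet> h) * f x) * e \<xi> x))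
        \<le> norm (f x) * (\<bar>t\<bar> ^ 2 / 2)"
        and t2: "\<bar>t\<bar> ^ 2 / 2 \<le> (2 * pi * (norm x * norm h)) ^ 2 / 2"
        by (simp_all only: mult_left_mono norm_ge_zero divide_right_mono zero_le_numeral)
      note this(1)
      also have "norm (f x) * (\<bar>t\<bar> ^ 2 / 2) \<le> norm (f x) * ((2 * pi * (norm x * norm h)) ^ 2 / 2)"
        using t2 by (rule mult_left_mono) simp
      also have "\<dots> = (norm h)\<^sup>2 * (2 * pi\<^sup>2) * (norm x ^ 2 * norm (f x))"
        by (simp add: power_mult_distrib)
      finally show "norm (f x * e y x - f x * e \<xi> x - (- 2 * pi * \<i> * (of_real (x \<bullet> h) * f x) * e \<xi> x))
        \<le> (norm h)\<^sup>2 * (2 * pi\<^sup>2) * (norm x ^ 2 * norm (f x))" .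
    qed
    also have "\<dots> = (norm h)\<^sup>2 * (2 * pi\<^sup>2 * M2)" by (simp add: M2_def)
    finally show ?thesis by (simp add: h_def)
  qed
  have "(fourier f has_derivative L) (at \<xi>)"
  proof (rule has_derivativeI_sandwich[where e = 1 and H = "\<lambda>y. norm (y - \<xi>) * (2 * pi\<^sup>2 * M2)"])
    fix y assume y: "y \<noteq> \<xi>"
    have *: "A / n \<le> n * K" if "A \<le> n\<^sup>2 * K" "n > 0" for A n K :: real
      using that by (simp add: pos_divide_le_eq power2_eq_square mult.commute mult.left_commute)
    show "norm (fourier f y - fourier f \<xi> - L (y - \<xi>)) / norm (y - \<xi>) \<le> norm (y - \<xi>) * (2 * pi\<^sup>2 * M2)"
      using quad[of y] y by (intro *) auto
  next
    show "((\<lambda>y. norm (y - \<xi>) * (2 * pi\<^sup>2 * M2)) \<longlongrightarrow> 0) (at \<xi>)"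
      by (auto intro!: tendsto_eq_intros)
  qed (use lin in auto)
  then show ?thesis
    unfolding L_def e_def fourier_def .
qed


lemma pd_fourier:
  assumes f: "f \<in> schwartz"
  shows "pd b (fourier f) = fourier (\<lambda>x. - 2 * pi * \<i> * (of_real (x \<bullet> b) * f x))"
  using pd_eqI[OF fourier_has_derivative[OF f]] by (auto simp: fun_eq_iff)

section \<open>Decay and integrability of Fourier transforms from derivatives in L1\<close>

definition L1_norm :: "('a::euclidean_space \<Rightarrow> complex) \<Rightarrow> real" where
  "L1_norm f = (\<integral>x. norm (f x) \<partial>lborel)"

lemma L1_norm_nonneg [simp]: "0 \<le> L1_norm f"
  by (simp add: L1_norm_def)

lemma L1_norm_add_le:
  "f \<in> schwartz \<Longrightarrow> g \<in> schwartz \<Longrightarrow> L1_norm (\<lambda>x. f x + g x) \<le> L1_norm f + L1_norm g"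
  unfolding L1_norm_def
  by (subst Bochner_Integration.integral_add[symmetric])
    (auto simp: schwartz_integrable norm_triangle_ineq intro!: integral_mono integrable_norm schwartz_add
      simp flip: Bochner_Integration.integral_add)

lemma L1_norm_cmult: "L1_norm (\<lambda>x. c * f x) = norm c * L1_norm f"
  by (simp add: L1_norm_def norm_mult)

lemma pd_funpow_schwartz: "f \<in> schwartz \<Longrightarrow> b \<in> Basis \<Longrightarrow> (pd b ^^ k) f \<in> schwartz"
  by (induction k) (auto intro: pd_schwartz)

lemma pd_funpow_lin:
  assumes "f \<in> schwartz" "g \<in> schwartz" "b \<in> Basis"
  shows "(pd b ^^ k) (\<lambda>x. c * f x + d * g x) = (\<lambda>x. c * (pd b ^^ k) f x + d * (pd b ^^ k) g x)"
proof (induction k)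
  case (Suc k)
  have "(pd b ^^ k) f \<in> schwartz" "(pd b ^^ k) g \<in> schwartz"
    using assms by (auto intro: pd_funpow_schwartz)
  then show ?case
    using Suc by (simp add: pd_add schwartz_cmult pd_cmult)
qed simp

lemma fourier_pd_funpow:
  assumes "f \<in> schwartz" "b \<in> Basis"
  shows "fourier ((pd b ^^ k) f) \<xi> = (2 * pi * \<i> * of_real (\<xi> \<bullet> b)) ^ k * fourier f \<xi>"
  by (induction k) (simp_all add: fourier_pd pd_funpow_schwartz assms)

text \<open>Some coordinate is at least |x| / d in absolute value, because |x| is at most the sum of
  the absolute coordinates.\<close>

lemma norm_power_le_sum_coords:
  fixes x :: "'a::euclidean_space"
  shows "norm x ^ k \<le> real DIM('a) ^ k * (\<Sum>b\<in>Basis. \<bar>x \<bullet> b\<bar> ^ k)"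
proof -
  obtain b where b: "b \<in> Basis" "norm x \<le> real DIM('a) * \<bar>x \<bullet> b\<bar>"
  proof (rule ccontr)
    assume "\<not> thesis"
    with that have "\<bar>x \<bullet> b\<bar> < norm x / real DIM('a)" if "b \<in> Basis" for b
      using that by (force simp: field_simps)
    then have "(\<Sum>b\<in>Basis. \<bar>x \<bullet> b\<bar>) < (\<Sum>b\<in>(Basis::'a set). norm x / real DIM('a))"
      by (intro sum_strict_mono) auto
    with norm_le_l1[of x] show False by simp
  qed
  have "norm x ^ k \<le> real DIM('a) ^ k * \<bar>x \<bullet> b\<bar> ^ k"
    using power_mono[OF b(2), of k] by (simp add: power_mult_distrib)
  also have "\<bar>x \<bullet> b\<bar> ^ k \<le> (\<Sum>b\<in>Basis. \<bar>x \<bullet> b\<bar> ^ k)"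
    using b by (intro member_le_sum) auto
  finally show ?thesis by (simp add: mult_left_mono)
qed

text \<open>Derivatives become factors 2 \<pi> i (\<xi> \<bullet> b), and the powers of 2 \<pi> > 1
  are dropped. By \<open>norm_power_le_sum_coords\<close>, repeated derivatives in one direction at
  a time control the full norm of \<xi>.\<close>

lemma fourier_decay:
  fixes f :: "'a::euclidean_space \<Rightarrow> complex"
  assumes f: "f \<in> schwartz"
  shows "norm \<xi> ^ k * norm (fourier f \<xi>) \<le> real DIM('a) ^ k * (\<Sum>b\<in>Basis. L1_norm ((pd b ^^ k) f))"
proof -
  have "\<bar>\<xi> \<bullet> b\<bar> ^ k * norm (fourier f \<xi>) \<le> L1_norm ((pd b ^^ k) f)" if b: "b \<in> Basis" for b
  proof -
    have "\<bar>\<xi> \<bullet> b\<bar> ^ k \<le> (2 * pi * \<bar>\<xi> \<bullet> b\<bar>) ^ k"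
      using pi_gt3 by (intro power_mono) (auto simp: mult_le_cancel_right1)
    then have "\<bar>\<xi> \<bullet> b\<bar> ^ k * norm (fourier f \<xi>) \<le> (2 * pi * \<bar>\<xi> \<bullet> b\<bar>) ^ k * norm (fourier f \<xi>)"
      by (rule mult_right_mono) simp
    also have "\<dots> = norm (fourier ((pd b ^^ k) f) \<xi>)"
      by (simp add: fourier_pd_funpow[OF f b] norm_mult norm_power)
    also have "\<dots> \<le> L1_norm ((pd b ^^ k) f)"
      unfolding L1_norm_def by (intro norm_fourier_le schwartz_integrable pd_funpow_schwartz f b)
    finally show ?thesis .
  qed
  then have "(\<Sum>b\<in>Basis. \<bar>\<xi> \<bullet> b\<bar> ^ k) * norm (fourier f \<xi>) \<le> (\<Sum>b\<in>Basis. L1_norm ((pd b ^^ k) f))"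
    unfolding sum_distrib_right by (rule sum_mono)
  then have "real DIM('a) ^ k * ((\<Sum>b\<in>Basis. \<bar>\<xi> \<bullet> b\<bar> ^ k) * norm (fourier f \<xi>))
      \<le> real DIM('a) ^ k * (\<Sum>b\<in>Basis. L1_norm ((pd b ^^ k) f))"
    by (intro mult_left_mono) auto
  moreover have "norm \<xi> ^ k * norm (fourier f \<xi>) \<le> real DIM('a) ^ k * (\<Sum>b\<in>Basis. \<bar>\<xi> \<bullet> b\<bar> ^ k) * norm (fourier f \<xi>)"
    by (intro mult_right_mono norm_power_le_sum_coords) auto
  ultimately show ?thesis unfolding mult.assoc by (rule order_trans[rotated])
qed

lemma schwartz_fourier:
  fixes f :: "'a::euclidean_space \<Rightarrow> complex"
  assumes "f \<in> schwartz"
  shows "fourier f \<in> schwartz"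
proof (rule schwartz_family[OF assms, where T = fourier])
  fix f :: "'a \<Rightarrow> complex" and b x :: 'a and k
  assume f: "f \<in> schwartz"
  show "\<exists>h\<in>schwartz. pd b (fourier f) = fourier h"
    unfolding pd_fourier[OF f] using schwartz_coord_mult[OF f]
    by (intro bexI[of _ "\<lambda>x. - 2 * pi * \<i> * (of_real (x \<bullet> b) * f x)"] refl schwartz_cmult)
  show "fourier f differentiable (at x)"
    using fourier_has_derivative[OF f] by (auto simp: differentiable_def)
  show "\<exists>C. \<forall>x. norm x ^ k * norm (fourier f x) \<le> C"
    using fourier_decay[OF f] by blast
qed

lemma inv_fourier_eq: "inv_fourier f x = fourier f (- x)"
  by (simp add: inv_fourier_def fourier_def inner_commute)

lemma schwartz_inv_fourier: "f \<in> schwartz \<Longrightarrow> inv_fourier f \<in> schwartz"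
  using schwartz_dilate[of "fourier f" "-1"] by (simp add: schwartz_fourier inv_fourier_eq[abs_def])

lemma inv_fourier_fourier_schwartz:
  assumes f: "f \<in> schwartz"
  shows "inv_fourier (fourier f) = f"
proof
  fix x
  obtain K where "\<And>x. norm (f x) \<le> K" using schwartz_bounded[OF f] by metis
  then show "inv_fourier (fourier f) x = f x"
    using f by (intro inv_fourier_fourier) (auto intro: schwartz_integrable schwartz_fourier schwartz_continuous)
qed

lemma fourier_inv_fourier_schwartz:
  assumes f: "f \<in> schwartz"
  shows "fourier (inv_fourier f) = f"
proof
  fix \<xi> :: 'a
  have "fourier (inv_fourier f) \<xi> = (\<integral>x. fourier f (- x) * cis (- 2 * pi * (x \<bullet> \<xi>)) \<partial>lborel)"
    by (simp add: fourier_def[of "inv_fourier f"] inv_fourier_eq)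
  also have "\<dots> = (\<integral>x. fourier f x * cis (2 * pi * (\<xi> \<bullet> x)) \<partial>lborel)"
  proof -
    have [measurable]: "fourier f \<in> borel_measurable borel"
      using f by (intro schwartz_measurable schwartz_fourier)
    have "(\<lambda>x. fourier f x * cis (2 * pi * (\<xi> \<bullet> x))) \<in> borel_measurable borel"
      unfolding cis_conv_exp by measurable
    from lborel_integral_affine[OF this, of "-1" 0]
    show ?thesis by (simp add: inner_commute)
  qed
  also have "\<dots> = inv_fourier (fourier f) \<xi>" by (simp add: inv_fourier_def)
  finally show "fourier (inv_fourier f) \<xi> = f \<xi>" by (simp add: inv_fourier_fourier_schwartz[OF f])
qed

text \<open>Decay of order 2 d, paid for with 2 d derivatives in L1, makes the transform integrable;
  the undifferentiated term controls it near the origin.\<close>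

lemma fourier_L1_bound:
  "\<exists>K>0. \<forall>f :: 'a::euclidean_space \<Rightarrow> complex. f \<in> schwartz \<longrightarrow>
    L1_norm (fourier f) \<le> K * (L1_norm f + (\<Sum>b\<in>Basis. L1_norm ((pd b ^^ (2 * DIM('a))) f)))"
proof -
  define d where "d = DIM('a)"
  define W where "W = (\<integral>x. 1 / (1 + norm (x::'a)) ^ (2 * d) \<partial>lborel)"
  have W: "W \<ge> 0" unfolding W_def by (intro integral_nonneg_AE) auto
  have d1: "real d ^ (2 * d) \<ge> 1" unfolding d_def by (intro one_le_power) (simp add: Suc_leI)
  \<comment> \<open>The factor d^(2 d), at least 1, comes from \<open>fourier_decay\<close> and is
    put on both terms; W + 1 instead of W keeps the constant positive.\<close>
  define K where "K = 2 ^ (2 * d) * real d ^ (2 * d) * (W + 1)"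
  show ?thesis
  proof (intro exI[of _ K] conjI allI impI)
    show "K > 0" using W d1 by (auto simp: K_def intro!: mult_pos_pos)
    fix f :: "'a \<Rightarrow> complex" assume f: "f \<in> schwartz"
    define B where "B = L1_norm f + (\<Sum>b\<in>Basis. L1_norm ((pd b ^^ (2 * d)) f))"
    have B: "B \<ge> 0" unfolding B_def by (intro add_nonneg_nonneg sum_nonneg) auto
    have pw: "norm (fourier f \<xi>) \<le> 2 ^ (2 * d) * real d ^ (2 * d) * B * (1 / (1 + norm \<xi>) ^ (2 * d))" for \<xi>
    proof -
      have "(1 + norm \<xi>) ^ (2 * d) * norm (fourier f \<xi>)
        \<le> 2 ^ (2 * d) * (1 + norm \<xi> ^ (2 * d)) * norm (fourier f \<xi>)"
        by (intro mult_right_mono one_plus_power_le) auto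
      also have "\<dots> = 2 ^ (2 * d) * (norm (fourier f \<xi>) + norm \<xi> ^ (2 * d) * norm (fourier f \<xi>))"
        by (simp add: algebra_simps)
      also have "\<dots> \<le> 2 ^ (2 * d) * (real d ^ (2 * d) * L1_norm f
          + real d ^ (2 * d) * (\<Sum>b\<in>Basis. L1_norm ((pd b ^^ (2 * d)) f)))"
      proof (intro mult_left_mono add_mono)
        have "norm (fourier f \<xi>) \<le> L1_norm f"
          unfolding L1_norm_def by (intro norm_fourier_le schwartz_integrable f)
        also have "\<dots> \<le> real d ^ (2 * d) * L1_norm f"
          using mult_right_mono[OF d1, of "L1_norm f"] by simp
        finally show "norm (fourier f \<xi>) \<le> real d ^ (2 * d) * L1_norm f" .
        show "norm \<xi> ^ (2 * d) * norm (fourier f \<xi>) \<le> real d ^ (2 * d) * (\<Sum>b\<in>Basis. L1_norm ((pd b ^^ (2 * d)) f))"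
          unfolding d_def by (rule fourier_decay[OF f])
      qed auto
      also have "\<dots> = 2 ^ (2 * d) * real d ^ (2 * d) * B" by (simp add: B_def distrib_left mult.assoc)
      finally have "norm (fourier f \<xi>) \<le> 2 ^ (2 * d) * real d ^ (2 * d) * B / (1 + norm \<xi>) ^ (2 * d)"
        by (subst pos_le_divide_eq) (auto simp: add_pos_nonneg mult.commute)
      then show ?thesis by simp
    qed
    have "L1_norm (fourier f) \<le> (\<integral>\<xi>. 2 ^ (2 * d) * real d ^ (2 * d) * B * (1 / (1 + norm (\<xi>::'a)) ^ (2 * d)) \<partial>lborel)"
      unfolding L1_norm_def
    proof (rule integral_mono)
      show "integrable lborel (\<lambda>\<xi>. norm (fourier f \<xi>))"
        by (intro integrable_norm schwartz_integrable schwartz_fourier f)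
      show "integrable lborel (\<lambda>\<xi>::'a. 2 ^ (2 * d) * real d ^ (2 * d) * B * (1 / (1 + norm \<xi>) ^ (2 * d)))"
        unfolding d_def by (rule integrable_mult_right[OF integrable_weight])
    qed (rule pw)
    also have "\<dots> = 2 ^ (2 * d) * real d ^ (2 * d) * B * W"
      unfolding W_def by (rule integral_mult_right_zero)
    also have "\<dots> \<le> K * B"
    proof -
      have "B * W \<le> (W + 1) * B" using B by (simp add: distrib_right mult.commute[of B])
      then have "(2 ^ (2 * d) * real d ^ (2 * d)) * (B * W) \<le> (2 ^ (2 * d) * real d ^ (2 * d)) * ((W + 1) * B)"
        by (rule mult_left_mono) simp
      then show ?thesis by (simp only: K_def mult.assoc)
    qed
    finally show "L1_norm (fourier f) \<le> K * (L1_norm f + (\<Sum>b\<in>Basis. L1_norm ((pd b ^^ (2 * DIM('a))) f)))"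
      by (simp add: B_def d_def)
  qed
qed

lemma L1_norm_lin_le:
  assumes "f \<in> schwartz" "g \<in> schwartz"
  shows "L1_norm (\<lambda>x. c * f x + d * g x) \<le> norm c * L1_norm f + norm d * L1_norm g"
  using L1_norm_add_le[OF schwartz_cmult[OF assms(1), of c] schwartz_cmult[OF assms(2), of d]]
  by (simp add: L1_norm_cmult)

lemma pd_dilate_mult:
  assumes "\<theta> \<in> schwartz" "u \<in> schwartz" "r \<noteq> 0"
  shows "pd b (\<lambda>\<xi>. \<theta> (r *\<^sub>R \<xi>) * u (\<xi> - \<omega>)) =
    (\<lambda>\<xi>. of_real r * (pd b \<theta> (r *\<^sub>R \<xi>) * u (\<xi> - \<omega>)) + 1 * (\<theta> (r *\<^sub>R \<xi>) * pd b u (\<xi> - \<omega>)))"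
  using pd_mult[OF schwartz_dilate[OF assms(1,3)] schwartz_translate[OF assms(2)], of b \<omega>]
  by (simp add: pd_dilate pd_translate assms mult.assoc)

lemma dilate_mult_schwartz:
  "\<theta> \<in> schwartz \<Longrightarrow> u \<in> schwartz \<Longrightarrow> r \<noteq> 0 \<Longrightarrow> (\<lambda>\<xi>. \<theta> (r *\<^sub>R \<xi>) * u (\<xi> - \<omega>)) \<in> schwartz"
  by (intro schwartz_mult schwartz_dilate schwartz_translate)

text \<open>The dilated \<theta> lives at frequencies up to order 1 / r and the translated u near
  \<omega>, so their product is small once |\<omega>| is much larger than 1 / r. Uniformity in r
  holds because derivatives of the dilated factor only bring powers of r \<le> 1. The induction
  splits one derivative by the Leibniz rule, hence \<theta> and u vary in it.\<close>

lemma dilate_mult_L1_bound: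
  fixes \<theta> u :: "'a::euclidean_space \<Rightarrow> complex"
  assumes "\<theta> \<in> schwartz" "u \<in> schwartz" and b: "b \<in> Basis"
  shows "\<exists>C\<ge>0. \<forall>r \<omega>. 0 < r \<longrightarrow> r \<le> 1 \<longrightarrow>
    (r * (1 + norm \<omega>)) ^ N * L1_norm ((pd b ^^ k) (\<lambda>\<xi>. \<theta> (r *\<^sub>R \<xi>) * u (\<xi> - \<omega>))) \<le> C"
  using assms(1,2)
proof (induction k arbitrary: \<theta> u)
  case (0 \<theta> u)
  obtain C where C: "C > 0" "\<And>x. (1 + norm x) ^ N * norm (\<theta> x) \<le> C" using schwartz_bound[OF 0(1)] by metis
  define M where "M = (\<integral>\<xi>. (1 + norm \<xi>) ^ N * norm (u \<xi>) \<partial>lborel)"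
  have M: "M \<ge> 0" unfolding M_def by (intro integral_nonneg_AE) auto
  have [measurable]: "u \<in> borel_measurable borel" using 0 by (intro schwartz_measurable)
  show ?case
  proof (intro exI[of _ "C * M"] conjI allI impI)
    fix r :: real and \<omega> :: 'a assume r: "0 < r" "r \<le> 1"
    \<comment> \<open>Complex-valued, to match the translation lemmas.\<close>
    define v where "v \<xi> = complex_of_real ((1 + norm \<xi>) ^ N * norm (u \<xi>))" for \<xi>
    have [measurable]: "v \<in> borel_measurable borel" unfolding v_def by measurable
    have v: "integrable lborel v"
      unfolding v_def by (intro integrable_of_real schwartz_weight_integrable 0)
    have vt: "integrable lborel (\<lambda>\<xi>. norm (v (\<xi> + - \<omega>)))"
      by (intro integrable_norm integrable_translate v)
    have nv: "norm (v \<xi>) = (1 + norm \<xi>) ^ N * norm (u \<xi>)" for \<xi>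
      unfolding v_def norm_of_real by simp
    have pw: "(r * (1 + norm \<omega>)) ^ N * norm (\<theta> (r *\<^sub>R \<xi>) * u (\<xi> - \<omega>)) \<le> C * norm (v (\<xi> + - \<omega>))" for \<xi>
    proof -
      \<comment> \<open>A Peetre-type inequality: the weight at \<omega> is shared between \<xi>,
        measured at scale 1 / r, and \<xi> - \<omega>; the condition r \<le> 1 absorbs the remaining
        factors r.\<close>
      have "r * (1 + norm \<omega>) \<le> (1 + norm (r *\<^sub>R \<xi>)) * (1 + norm (\<xi> - \<omega>))"
      proof -
        have "norm \<omega> \<le> norm \<xi> + norm (\<xi> - \<omega>)"
          using norm_triangle_ineq4[of \<xi> "\<xi> - \<omega>"] by simp
        then have "r * (1 + norm \<omega>) \<le> r * (1 + (norm \<xi> + norm (\<xi> - \<omega>)))"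
          using r by (intro mult_left_mono) auto
        also have "\<dots> = r + r * norm \<xi> + r * norm (\<xi> - \<omega>)" by (simp add: algebra_simps)
        also have "\<dots> \<le> 1 + r * norm \<xi> + 1 * norm (\<xi> - \<omega>)"
          using r by (intro add_mono mult_right_mono) auto
        also have "\<dots> \<le> 1 + r * norm \<xi> + 1 * norm (\<xi> - \<omega>) + r * norm \<xi> * norm (\<xi> - \<omega>)"
          using r by simp
        also have "\<dots> = (1 + norm (r *\<^sub>R \<xi>)) * (1 + norm (\<xi> - \<omega>))"
          using r by (simp add: algebra_simps)
        finally show ?thesis .
      qed
      then have "(r * (1 + norm \<omega>)) ^ N \<le> ((1 + norm (r *\<^sub>R \<xi>)) * (1 + norm (\<xi> - \<omega>))) ^ N"
        using r by (intro power_mono) auto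
      then have "(r * (1 + norm \<omega>)) ^ N * (norm (\<theta> (r *\<^sub>R \<xi>)) * norm (u (\<xi> - \<omega>)))
        \<le> ((1 + norm (r *\<^sub>R \<xi>)) * (1 + norm (\<xi> - \<omega>))) ^ N * (norm (\<theta> (r *\<^sub>R \<xi>)) * norm (u (\<xi> - \<omega>)))"
        by (rule mult_right_mono) auto
      also have "\<dots> = ((1 + norm (r *\<^sub>R \<xi>)) ^ N * norm (\<theta> (r *\<^sub>R \<xi>))) * ((1 + norm (\<xi> - \<omega>)) ^ N * norm (u (\<xi> - \<omega>)))"
        by (simp add: power_mult_distrib)
      also have "\<dots> \<le> C * ((1 + norm (\<xi> - \<omega>)) ^ N * norm (u (\<xi> - \<omega>)))"
        by (intro mult_right_mono C) auto
      finally show ?thesis by (simp add: norm_mult nv)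
    qed
    have "(r * (1 + norm \<omega>)) ^ N * L1_norm ((pd b ^^ 0) (\<lambda>\<xi>. \<theta> (r *\<^sub>R \<xi>) * u (\<xi> - \<omega>)))
      = (\<integral>\<xi>. (r * (1 + norm \<omega>)) ^ N * norm (\<theta> (r *\<^sub>R \<xi>) * u (\<xi> - \<omega>)) \<partial>lborel)"
      by (simp add: L1_norm_def)
    also have "\<dots> \<le> (\<integral>\<xi>. C * norm (v (\<xi> + - \<omega>)) \<partial>lborel)"
    proof (rule integral_mono)
      show "integrable lborel (\<lambda>\<xi>. (r * (1 + norm \<omega>)) ^ N * norm (\<theta> (r *\<^sub>R \<xi>) * u (\<xi> - \<omega>)))"
        using r 0 by (intro integrable_mult_right integrable_norm schwartz_integrable dilate_mult_schwartz) auto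
      show "integrable lborel (\<lambda>\<xi>. C * norm (v (\<xi> + - \<omega>)))"
        using vt by simp
    qed (rule pw)
    also have "\<dots> = C * (\<integral>\<xi>. norm (v (\<xi> + - \<omega>)) \<partial>lborel)" by simp
    also have "(\<integral>\<xi>. norm (v (\<xi> + - \<omega>)) \<partial>lborel) = M"
    proof -
      have "complex_of_real (\<integral>\<xi>. norm (v (\<xi> + - \<omega>)) \<partial>lborel) = (\<integral>\<xi>. complex_of_real (norm (v (\<xi> + - \<omega>))) \<partial>lborel)"
        by simp
      also have "\<dots> = (\<integral>\<xi>. complex_of_real (norm (v \<xi>)) \<partial>lborel)"
        by (rule integral_translate) measurable
      also have "\<dots> = complex_of_real M" unfolding nv M_def by (rule integral_of_real[OF schwartz_weight_integrable[OF 0(2)]])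
      finally show ?thesis unfolding of_real_eq_iff .
    qed
    finally show "(r * (1 + norm \<omega>)) ^ N * L1_norm ((pd b ^^ 0) (\<lambda>\<xi>. \<theta> (r *\<^sub>R \<xi>) * u (\<xi> - \<omega>))) \<le> C * M" .
  qed (use C M in simp)
next
  case (Suc k \<theta> u)
  note p = pd_schwartz[OF _ b]
  obtain C1 where C1: "C1 \<ge> 0" "\<And>r \<omega>. 0 < r \<Longrightarrow> r \<le> 1 \<Longrightarrow>
    (r * (1 + norm \<omega>)) ^ N * L1_norm ((pd b ^^ k) (\<lambda>\<xi>. pd b \<theta> (r *\<^sub>R \<xi>) * u (\<xi> - \<omega>))) \<le> C1"
    using Suc.IH[OF p[OF Suc.prems(1)] Suc.prems(2)] by blast
  obtain C2 where C2: "C2 \<ge> 0" "\<And>r \<omega>. 0 < r \<Longrightarrow> r \<le> 1 \<Longrightarrow>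
    (r * (1 + norm \<omega>)) ^ N * L1_norm ((pd b ^^ k) (\<lambda>\<xi>. \<theta> (r *\<^sub>R \<xi>) * pd b u (\<xi> - \<omega>))) \<le> C2"
    using Suc.IH[OF Suc.prems(1) p[OF Suc.prems(2)]] by blast
  show ?case
  proof (intro exI[of _ "C1 + C2"] conjI allI impI)
    fix r :: real and \<omega> :: 'a assume r: "0 < r" "r \<le> 1"
    define F where "F = (\<lambda>\<xi>. pd b \<theta> (r *\<^sub>R \<xi>) * u (\<xi> - \<omega>))"
    define G where "G = (\<lambda>\<xi>. \<theta> (r *\<^sub>R \<xi>) * pd b u (\<xi> - \<omega>))"
    have FG: "F \<in> schwartz" "G \<in> schwartz"
      unfolding F_def G_def using r Suc.prems by (auto intro!: dilate_mult_schwartz p)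
    have "(pd b ^^ Suc k) (\<lambda>\<xi>. \<theta> (r *\<^sub>R \<xi>) * u (\<xi> - \<omega>)) = (pd b ^^ k) (\<lambda>\<xi>. of_real r * F \<xi> + 1 * G \<xi>)"
      using r by (simp add: funpow_Suc_right pd_dilate_mult Suc.prems F_def G_def del: funpow.simps)
    also have "\<dots> = (\<lambda>\<xi>. of_real r * (pd b ^^ k) F \<xi> + 1 * (pd b ^^ k) G \<xi>)"
      by (rule pd_funpow_lin[OF FG b])
    finally have eq: "(pd b ^^ Suc k) (\<lambda>\<xi>. \<theta> (r *\<^sub>R \<xi>) * u (\<xi> - \<omega>)) = \<dots>" .
    have "L1_norm ((pd b ^^ Suc k) (\<lambda>\<xi>. \<theta> (r *\<^sub>R \<xi>) * u (\<xi> - \<omega>)))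
      \<le> norm (complex_of_real r) * L1_norm ((pd b ^^ k) F) + norm (1::complex) * L1_norm ((pd b ^^ k) G)"
      unfolding eq by (rule L1_norm_lin_le[OF pd_funpow_schwartz[OF FG(1) b] pd_funpow_schwartz[OF FG(2) b]])
    also have "\<dots> \<le> L1_norm ((pd b ^^ k) F) + L1_norm ((pd b ^^ k) G)"
      using r by (simp add: mult_left_le_one_le)
    finally have "(r * (1 + norm \<omega>)) ^ N * L1_norm ((pd b ^^ Suc k) (\<lambda>\<xi>. \<theta> (r *\<^sub>R \<xi>) * u (\<xi> - \<omega>)))
      \<le> (r * (1 + norm \<omega>)) ^ N * (L1_norm ((pd b ^^ k) F) + L1_norm ((pd b ^^ k) G))"
      using r by (intro mult_left_mono) auto
    also have "\<dots> = (r * (1 + norm \<omega>)) ^ N * L1_norm ((pd b ^^ k) F) + (r * (1 + norm \<omega>)) ^ N * L1_norm ((pd b ^^ k) G)"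
      by (rule distrib_left)
    also have "\<dots> \<le> C1 + C2"
      unfolding F_def G_def by (intro add_mono C1 C2 r)
    finally show "(r * (1 + norm \<omega>)) ^ N * L1_norm ((pd b ^^ Suc k) (\<lambda>\<xi>. \<theta> (r *\<^sub>R \<xi>) * u (\<xi> - \<omega>))) \<le> C1 + C2" .
  qed (use C1 C2 in simp)
qed

lemma fourier_dilate_mult_L1_bound:
  fixes \<theta> u :: "'a::euclidean_space \<Rightarrow> complex"
  assumes "\<theta> \<in> schwartz" "u \<in> schwartz"
  shows "\<exists>C>0. \<forall>r \<omega>. 0 < r \<longrightarrow> r \<le> 1 \<longrightarrow>
    (r * (1 + norm \<omega>)) ^ N * L1_norm (fourier (\<lambda>\<xi>. \<theta> (r *\<^sub>R \<xi>) * u (\<xi> - \<omega>))) \<le> C"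
proof -
  obtain K where K: "K > 0" "\<And>f :: 'a \<Rightarrow> complex. f \<in> schwartz \<Longrightarrow>
    L1_norm (fourier f) \<le> K * (L1_norm f + (\<Sum>b\<in>Basis. L1_norm ((pd b ^^ (2 * DIM('a))) f)))"
    using fourier_L1_bound by blast
  have "\<exists>C. \<forall>r \<omega>. 0 < r \<longrightarrow> r \<le> 1 \<longrightarrow>
    (r * (1 + norm \<omega>)) ^ N * L1_norm ((pd b ^^ k) (\<lambda>\<xi>. \<theta> (r *\<^sub>R \<xi>) * u (\<xi> - \<omega>))) \<le> C" if "b \<in> Basis" for b k
    using dilate_mult_L1_bound[OF assms that] by blast
  then obtain C where C: "\<And>b k r \<omega>. b \<in> Basis \<Longrightarrow> 0 < r \<Longrightarrow> r \<le> 1 \<Longrightarrow>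
    (r * (1 + norm \<omega>)) ^ N * L1_norm ((pd b ^^ k) (\<lambda>\<xi>. \<theta> (r *\<^sub>R \<xi>) * u (\<xi> - \<omega>))) \<le> C b k"
    by metis
  \<comment> \<open>\<open>pd b0 ^^ 0\<close> is the identity, so an arbitrary direction expresses
    the undifferentiated L1 norm through the same family of constants.\<close>
  obtain b0 :: 'a where b0: "b0 \<in> Basis" using nonempty_Basis by blast
  define D where "D = K * (\<bar>C b0 0\<bar> + (\<Sum>b\<in>Basis. \<bar>C b (2 * DIM('a))\<bar>)) + 1"
  show ?thesis
  proof (intro exI[of _ D] conjI allI impI)
    show "D > 0" unfolding D_def using K by (intro add_nonneg_pos mult_nonneg_nonneg add_nonneg_nonneg sum_nonneg) auto
    fix r :: real and \<omega> :: 'a assume r: "0 < r" "r \<le> 1"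
    define v where "v = (\<lambda>\<xi>. \<theta> (r *\<^sub>R \<xi>) * u (\<xi> - \<omega>))"
    have v: "v \<in> schwartz" unfolding v_def using r assms by (intro dilate_mult_schwartz) auto
    define w where "w = (r * (1 + norm \<omega>)) ^ N"
    have w: "w \<ge> 0" using r by (simp add: w_def)
    have "w * L1_norm (fourier v) \<le> w * (K * (L1_norm v + (\<Sum>b\<in>Basis. L1_norm ((pd b ^^ (2 * DIM('a))) v))))"
      using w K(2)[OF v] by (rule mult_left_mono[rotated])
    also have "\<dots> = K * (w * L1_norm ((pd b0 ^^ 0) v) + (\<Sum>b\<in>Basis. w * L1_norm ((pd b ^^ (2 * DIM('a))) v)))"
      by (simp add: distrib_left sum_distrib_left mult.left_commute)
    also have "\<dots> \<le> K * (\<bar>C b0 0\<bar> + (\<Sum>b\<in>Basis. \<bar>C b (2 * DIM('a))\<bar>))"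
      using K(1) unfolding v_def w_def
      by (intro mult_left_mono add_mono sum_mono order_trans[OF C abs_ge_self] b0 r) auto
    also have "\<dots> \<le> D" by (simp add: D_def)
    finally show "(r * (1 + norm \<omega>)) ^ N * L1_norm (fourier (\<lambda>\<xi>. \<theta> (r *\<^sub>R \<xi>) * u (\<xi> - \<omega>))) \<le> D"
      by (simp add: v_def w_def)
  qed
qed


section \<open>Convergence of frequency cutoffs under a tempered distribution\<close>

text \<open>Without derivatives the difference is eventually 0 at each \<xi>, since r n \<xi> enters
  the unit ball. A derivative falls either on the cutoff, giving a factor r n against uniformly
  bounded norms, or on u, giving the same expression for \<open>pd b u\<close>.\<close>

lemma cutoff_L1_tendsto:
  fixes \<phi> u :: "'a::euclidean_space \<Rightarrow> complex"
  assumes \<phi>: "\<phi> \<in> schwartz" and \<phi>1: "\<And>\<xi>. norm \<xi> \<le> 1 \<Longrightarrow> \<phi> \<xi> = 1" and "u \<in> schwartz" and b: "b \<in> Basis"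
    and r: "\<And>n. 0 < r n" "\<And>n. r n \<le> 1" "r \<longlonglongrightarrow> 0"
  shows "(\<lambda>n. L1_norm ((pd b ^^ k) (\<lambda>\<xi>. \<phi> (r n *\<^sub>R \<xi>) * u \<xi> - u \<xi>))) \<longlonglongrightarrow> 0"
  using assms(3)
proof (induction k arbitrary: u)
  case (0 u)
  have [measurable]: "\<phi> \<in> borel_measurable borel" "u \<in> borel_measurable borel"
    using 0 \<phi> by (auto intro: schwartz_measurable)
  obtain C where C: "C > 0" "\<And>x. norm (\<phi> x) \<le> C" using schwartz_bounded[OF \<phi>] by metis
  have "(\<lambda>n. \<integral>\<xi>. norm (\<phi> (r n *\<^sub>R \<xi>) * u \<xi> - u \<xi>) \<partial>lborel) \<longlonglongrightarrow> (\<integral>\<xi>. 0 \<partial>(lborel :: 'a measure))"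
  proof (rule integral_dominated_convergence[where w = "\<lambda>\<xi>. (C + 1) * norm (u \<xi>)"])
    show "integrable lborel (\<lambda>\<xi>. (C + 1) * norm (u \<xi>))"
      using 0 by (intro integrable_mult_right integrable_norm schwartz_integrable)
    have "(\<lambda>n. norm (\<phi> (r n *\<^sub>R \<xi>) * u \<xi> - u \<xi>)) \<longlonglongrightarrow> 0" for \<xi>
    proof (rule tendsto_eventually)
      have "(\<lambda>n. r n * norm \<xi>) \<longlonglongrightarrow> 0 * norm \<xi>"
        by (intro tendsto_mult r tendsto_const)
      then have "\<forall>\<^sub>F n in sequentially. r n * norm \<xi> < 1"
        by (intro order_tendstoD(2)) auto
      then show "\<forall>\<^sub>F n in sequentially. norm (\<phi> (r n *\<^sub>R \<xi>) * u \<xi> - u \<xi>) = 0"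
      proof eventually_elim
        case (elim n)
        then show ?case using r(1)[of n] by (simp add: \<phi>1)
      qed
    qed
    then show "AE \<xi> in lborel. (\<lambda>n. norm (\<phi> (r n *\<^sub>R \<xi>) * u \<xi> - u \<xi>)) \<longlonglongrightarrow> 0" by simp
    have "norm (\<phi> (r n *\<^sub>R \<xi>) * u \<xi> - u \<xi>) \<le> (C + 1) * norm (u \<xi>)" for n \<xi>
    proof -
      have "norm (\<phi> (r n *\<^sub>R \<xi>) * u \<xi> - u \<xi>) \<le> norm (\<phi> (r n *\<^sub>R \<xi>)) * norm (u \<xi>) + norm (u \<xi>)"
        using norm_triangle_ineq4[of "\<phi> (r n *\<^sub>R \<xi>) * u \<xi>" "u \<xi>"] by (simp add: norm_mult)
      also have "\<dots> \<le> C * norm (u \<xi>) + norm (u \<xi>)"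
        by (intro add_mono mult_right_mono C) auto
      finally show ?thesis by (simp add: algebra_simps)
    qed
    then show "AE \<xi> in lborel. norm (norm (\<phi> (r n *\<^sub>R \<xi>) * u \<xi> - u \<xi>)) \<le> (C + 1) * norm (u \<xi>)" for n
      by simp
  qed measurable
  then show ?case by (simp add: L1_norm_def)
next
  case (Suc k u)
  note u = Suc.prems
  have pu: "pd b u \<in> schwartz" and p\<phi>: "pd b \<phi> \<in> schwartz" using u \<phi> b by (auto intro: pd_schwartz)
  define F where "F n = (\<lambda>\<xi>. pd b \<phi> (r n *\<^sub>R \<xi>) * u \<xi>)" for n
  define G where "G n = (\<lambda>\<xi>. \<phi> (r n *\<^sub>R \<xi>) * pd b u \<xi> - pd b u \<xi>)" for n
  have rn: "r n \<noteq> 0" for n using r(1)[of n] by simp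
  have F: "F n \<in> schwartz" and G: "G n \<in> schwartz" for n
    unfolding F_def G_def using rn by (auto intro!: schwartz_mult schwartz_diff schwartz_dilate pu p\<phi> u \<phi>)
  have pd: "pd b (\<lambda>\<xi>. \<phi> (r n *\<^sub>R \<xi>) * u \<xi> - u \<xi>) = (\<lambda>\<xi>. of_real (r n) * F n \<xi> + 1 * G n \<xi>)" for n
  proof -
    have "(\<lambda>\<xi>. \<phi> (r n *\<^sub>R \<xi>) * u (\<xi> - 0)) \<in> schwartz"
      by (rule dilate_mult_schwartz[OF \<phi> u rn])
    from pd_add[OF this schwartz_cmult[OF u, of "- 1"], of b]
    have "pd b (\<lambda>\<xi>. \<phi> (r n *\<^sub>R \<xi>) * u \<xi> + (- 1) * u \<xi>)
      = (\<lambda>\<xi>. pd b (\<lambda>\<xi>. \<phi> (r n *\<^sub>R \<xi>) * u (\<xi> - 0)) \<xi> + (- 1) * pd b u \<xi>)"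
      unfolding pd_cmult[OF u] by simp
    then show ?thesis
      unfolding pd_dilate_mult[OF \<phi> u rn] by (simp add: F_def G_def fun_eq_iff)
  qed
  obtain C where C: "C \<ge> 0" "\<And>s \<omega>. 0 < s \<Longrightarrow> s \<le> 1 \<Longrightarrow>
    (s * (1 + norm \<omega>)) ^ 0 * L1_norm ((pd b ^^ k) (\<lambda>\<xi>. pd b \<phi> (s *\<^sub>R \<xi>) * u (\<xi> - \<omega>))) \<le> C"
    using dilate_mult_L1_bound[OF p\<phi> u b, of 0 k] by blast
  have bound: "L1_norm ((pd b ^^ Suc k) (\<lambda>\<xi>. \<phi> (r n *\<^sub>R \<xi>) * u \<xi> - u \<xi>))
      \<le> r n * C + L1_norm ((pd b ^^ k) (G n))" for n
  proof -
    have eq: "(pd b ^^ Suc k) (\<lambda>\<xi>. \<phi> (r n *\<^sub>R \<xi>) * u \<xi> - u \<xi>)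
      = (\<lambda>\<xi>. of_real (r n) * (pd b ^^ k) (F n) \<xi> + 1 * (pd b ^^ k) (G n) \<xi>)"
      unfolding funpow_Suc_right o_apply pd by (rule pd_funpow_lin[OF F G b])
    have "L1_norm ((pd b ^^ Suc k) (\<lambda>\<xi>. \<phi> (r n *\<^sub>R \<xi>) * u \<xi> - u \<xi>))
      \<le> norm (complex_of_real (r n)) * L1_norm ((pd b ^^ k) (F n)) + norm (1::complex) * L1_norm ((pd b ^^ k) (G n))"
      unfolding eq by (rule L1_norm_lin_le[OF pd_funpow_schwartz[OF F b] pd_funpow_schwartz[OF G b]])
    also have "\<dots> = r n * L1_norm ((pd b ^^ k) (F n)) + L1_norm ((pd b ^^ k) (G n))"
      using r(1)[of n] by simp
    also have "\<dots> \<le> r n * C + L1_norm ((pd b ^^ k) (G n))"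
      using C(2)[OF r(1,2), of n 0] r(1)[of n] by (simp add: F_def mult_left_mono)
    finally show ?thesis .
  qed
  show ?case
  proof (rule Lim_null_comparison)
    show "\<forall>\<^sub>F n in sequentially. norm (L1_norm ((pd b ^^ Suc k) (\<lambda>\<xi>. \<phi> (r n *\<^sub>R \<xi>) * u \<xi> - u \<xi>)))
        \<le> r n * C + L1_norm ((pd b ^^ k) (G n))"
      using bound by (simp only: real_norm_def abs_of_nonneg L1_norm_nonneg eventually_True)
    have "(\<lambda>n. r n * C + L1_norm ((pd b ^^ k) (G n))) \<longlonglongrightarrow> 0 * C + 0"
      unfolding G_def by (intro tendsto_add tendsto_mult r tendsto_const Suc.IH pu)
    then show "(\<lambda>n. r n * C + L1_norm ((pd b ^^ k) (G n))) \<longlonglongrightarrow> 0" by simp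
  qed
qed

text \<open>What a list of derivatives of \<open>fourier f\<close> becomes inside the
  transform.\<close>

primrec coord_mult :: "'a::euclidean_space list \<Rightarrow> ('a \<Rightarrow> complex) \<Rightarrow> 'a \<Rightarrow> complex" where
  "coord_mult [] f = f"
| "coord_mult (b # bs) f = (\<lambda>x. - 2 * pi * \<i> * (of_real (x \<bullet> b) * coord_mult bs f x))"

lemma coord_mult_schwartz: "f \<in> schwartz \<Longrightarrow> coord_mult bs f \<in> schwartz"
proof (induction bs)
  case (Cons b bs)
  then show ?case
    unfolding coord_mult.simps by (intro schwartz_cmult schwartz_coord_mult)
qed simp

lemma coord_mult_mult: "coord_mult bs (\<lambda>x. m x * f x) = (\<lambda>x. m x * coord_mult bs f x)"
  by (induction bs) (auto simp: fun_eq_iff)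

lemma coord_mult_diff: "coord_mult bs (\<lambda>x. f x - g x) = (\<lambda>x. coord_mult bs f x - coord_mult bs g x)"
  by (induction bs) (simp_all add: right_diff_distrib)

lemma partial_derivs_fourier:
  "f \<in> schwartz \<Longrightarrow> partial_derivs bs (fourier f) = fourier (coord_mult bs f)"
  by (induction bs) (simp_all add: partial_derivs_Cons pd_fourier coord_mult_schwartz del: partial_derivs.simps(2))

lemma schwartz_seminorm_le:
  assumes "\<And>x. norm x ^ k * norm (partial_derivs bs f x) \<le> B"
  shows "schwartz_seminorm k bs f \<le> B"
  unfolding schwartz_seminorm_def by (rule cSUP_least) (use assms in auto)

lemma schwartz_seminorm_nonneg:
  assumes "f \<in> schwartz" "set bs \<subseteq> Basis"
  shows "0 \<le> schwartz_seminorm k bs f"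
proof -
  have "bdd_above (range (\<lambda>x. norm x ^ k * norm (partial_derivs bs f x)))"
    using assms by (auto simp: schwartz_def)
  then have "norm (0::'a) ^ k * norm (partial_derivs bs f 0) \<le> schwartz_seminorm k bs f"
    unfolding schwartz_seminorm_def by (intro cSUP_upper) auto
  moreover have "0 \<le> norm (0::'a) ^ k * norm (partial_derivs bs f 0)" by simp
  ultimately show ?thesis by linarith
qed

lemma tempered_tendsto_0:
  assumes f: "f \<in> tempered_distributions" and \<psi>: "\<And>n. \<psi> n \<in> schwartz"
    and lim: "\<And>k bs. set bs \<subseteq> Basis \<Longrightarrow> (\<lambda>n. schwartz_seminorm k bs (\<psi> n)) \<longlonglongrightarrow> 0"
  shows "(\<lambda>n. f (\<psi> n)) \<longlonglongrightarrow> 0"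
proof -
  obtain C N where le: "\<And>\<phi>. \<phi> \<in> schwartz \<Longrightarrow> norm (f \<phi>) \<le>
      C * (\<Sum>k\<le>N. \<Sum>bs | set bs \<subseteq> Basis \<and> length bs \<le> N. schwartz_seminorm k bs \<phi>)"
    using f unfolding tempered_distributions_def by blast
  have "(\<lambda>n. C * (\<Sum>k\<le>N. \<Sum>bs | set bs \<subseteq> Basis \<and> length bs \<le> N. schwartz_seminorm k bs (\<psi> n)))
    \<longlonglongrightarrow> C * (\<Sum>k\<le>N. \<Sum>bs | set (bs :: 'a list) \<subseteq> Basis \<and> length bs \<le> N. 0)"
    by (intro tendsto_intros lim) auto
  then show ?thesis
    by (intro Lim_null_comparison[OF always_eventually[OF allI[OF le[OF \<psi>]]]]) simp
qed

text \<open>Continuity of f reduces the claim to Schwartz seminorms of a Fourier transform.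
  Derivatives there are coordinate factors on the frequency side, powers of the norm are bounded by
  L1 norms of frequency derivatives (\<open>fourier_decay\<close>), and
  \<open>cutoff_L1_tendsto\<close> sends these to 0.\<close>

lemma tempered_cutoff_tendsto:
  fixes \<phi> u :: "'a::euclidean_space \<Rightarrow> complex"
  assumes f: "f \<in> tempered_distributions" and \<phi>: "dyadic_cutoff \<phi>" and u: "u \<in> schwartz"
  shows "(\<lambda>n. f (fourier (\<lambda>\<xi>. \<phi> (\<xi> /\<^sub>R 2 ^ n) * u \<xi>))) \<longlonglongrightarrow> f (fourier u)"
proof -
  have \<phi>s: "\<phi> \<in> schwartz" and \<phi>1: "\<And>\<xi>. norm \<xi> \<le> 1 \<Longrightarrow> \<phi> \<xi> = 1"
    using \<phi> by (auto simp: dyadic_cutoff_def)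
  define r :: "nat \<Rightarrow> real" where "r n = inverse (2 ^ n)" for n
  have r: "0 < r n" "r n \<le> 1" for n by (auto simp: r_def inverse_le_1_iff)
  have r0: "r \<longlonglongrightarrow> 0" unfolding r_def by (rule LIMSEQ_inverse_realpow_zero) simp
  have rn: "r n \<noteq> 0" for n using r(1)[of n] by simp
  define v where "v n = (\<lambda>\<xi>. \<phi> (r n *\<^sub>R \<xi>) * u \<xi>)" for n
  have v: "v n \<in> schwartz" for n unfolding v_def by (intro schwartz_mult schwartz_dilate \<phi>s rn u)
  define w where "w n = (\<lambda>\<xi>. v n \<xi> - u \<xi>)" for n
  have w: "w n \<in> schwartz" for n unfolding w_def by (intro schwartz_diff v u)
  have fw: "f (fourier (v n)) = f (fourier (w n)) + f (fourier u)" for n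
  proof -
    have "fourier (v n) = (\<lambda>x. fourier (w n) x + fourier u x)"
      unfolding w_def fourier_def
      by (subst Bochner_Integration.integral_add[symmetric])
        (simp_all add: schwartz_integrable v u algebra_simps)
    then show ?thesis
      using f schwartz_fourier[OF w, of n] schwartz_fourier[OF u]
      unfolding tempered_distributions_def by simp
  qed
  have "(\<lambda>n. f (fourier (w n))) \<longlonglongrightarrow> 0"
  proof (rule tempered_tendsto_0[OF f schwartz_fourier[OF w]])
    fix k and bs :: "'a list" assume bs: "set bs \<subseteq> Basis"
    define u' where "u' = coord_mult bs u"
    have u': "u' \<in> schwartz" unfolding u'_def by (rule coord_mult_schwartz[OF u])
    have eq: "coord_mult bs (w n) = (\<lambda>\<xi>. \<phi> (r n *\<^sub>R \<xi>) * u' \<xi> - u' \<xi>)" for n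
      unfolding w_def v_def u'_def by (simp add: coord_mult_diff coord_mult_mult)
    have le: "schwartz_seminorm k bs (fourier (w n)) \<le>
      real DIM('a) ^ k * (\<Sum>b\<in>Basis. L1_norm ((pd b ^^ k) (\<lambda>\<xi>. \<phi> (r n *\<^sub>R \<xi>) * u' \<xi> - u' \<xi>)))" for n
      by (rule schwartz_seminorm_le)
        (simp add: partial_derivs_fourier[OF w] eq[symmetric] fourier_decay coord_mult_schwartz w)
    have t: "(\<lambda>n. L1_norm ((pd b ^^ k) (\<lambda>\<xi>. \<phi> (r n *\<^sub>R \<xi>) * u' \<xi> - u' \<xi>))) \<longlonglongrightarrow> 0" if "b \<in> Basis" for b
      by (rule cutoff_L1_tendsto[OF \<phi>s \<phi>1 u' that r r0])
    have "(\<lambda>n. real DIM('a) ^ k * (\<Sum>b\<in>Basis. L1_norm ((pd b ^^ k) (\<lambda>\<xi>. \<phi> (r n *\<^sub>R \<xi>) * u' \<xi> - u' \<xi>))))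
      \<longlonglongrightarrow> real DIM('a) ^ k * (\<Sum>b\<in>(Basis::'a set). 0)"
      by (intro tendsto_mult tendsto_const tendsto_sum t)
    then have lim: "(\<lambda>n. real DIM('a) ^ k * (\<Sum>b\<in>Basis. L1_norm ((pd b ^^ k) (\<lambda>\<xi>. \<phi> (r n *\<^sub>R \<xi>) * u' \<xi> - u' \<xi>))))
      \<longlonglongrightarrow> 0" by simp
    have "norm (schwartz_seminorm k bs (fourier (w n))) \<le>
      real DIM('a) ^ k * (\<Sum>b\<in>Basis. L1_norm ((pd b ^^ k) (\<lambda>\<xi>. \<phi> (r n *\<^sub>R \<xi>) * u' \<xi> - u' \<xi>)))" for n
      using le[of n] schwartz_seminorm_nonneg[OF schwartz_fourier[OF w] bs, of k n] by simp
    then show "(\<lambda>n. schwartz_seminorm k bs (fourier (w n))) \<longlonglongrightarrow> 0"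
      by (rule Lim_null_comparison[OF always_eventually[OF allI] lim])
  qed
  then have "(\<lambda>n. f (fourier (w n)) + f (fourier u)) \<longlonglongrightarrow> 0 + f (fourier u)"
    by (intro tendsto_add tendsto_const)
  then show ?thesis by (simp add: fw[symmetric] v_def r_def)
qed

section \<open>Littlewood--Paley pieces and the short-time Fourier transform\<close>

lemma tempered_add:
  "f \<in> tempered_distributions \<Longrightarrow> \<phi> \<in> schwartz \<Longrightarrow> \<psi> \<in> schwartz \<Longrightarrow> f (\<lambda>x. \<phi> x + \<psi> x) = f \<phi> + f \<psi>"
  by (simp add: tempered_distributions_def)

lemma fourier_add:
  "u \<in> schwartz \<Longrightarrow> v \<in> schwartz \<Longrightarrow> fourier (\<lambda>x. u x + v x) = (\<lambda>\<xi>. fourier u \<xi> + fourier v \<xi>)"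
  unfolding fourier_def
  by (subst Bochner_Integration.integral_add[symmetric]) (simp_all add: schwartz_integrable algebra_simps)

lemma dyadic_cutoff_dilate_schwartz:
  assumes "dyadic_cutoff \<phi>"
  shows "(\<lambda>\<xi>. \<phi> (\<xi> /\<^sub>R 2 ^ n)) \<in> schwartz"
  using assms by (intro schwartz_dilate) (auto simp: dyadic_cutoff_def)

lemma dyadic_partition_schwartz:
  assumes "dyadic_cutoff \<phi>"
  shows "dyadic_partition \<phi> j \<in> schwartz"
proof (cases j)
  case 0
  then have "dyadic_partition \<phi> j = \<phi>" by (simp add: fun_eq_iff)
  then show ?thesis using assms by (simp add: dyadic_cutoff_def)
next
  case (Suc i)
  then have "dyadic_partition \<phi> j = (\<lambda>\<xi>. \<phi> (\<xi> /\<^sub>R 2 ^ Suc i) - \<phi> (\<xi> /\<^sub>R 2 ^ i))"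
    by (simp add: fun_eq_iff)
  then show ?thesis by (simp only: schwartz_diff dyadic_cutoff_dilate_schwartz[OF assms])
qed

lemma littlewood_paley_eq:
  assumes "dyadic_cutoff \<phi>" "\<psi> \<in> schwartz"
  shows "littlewood_paley \<phi> j f \<psi> = f (fourier (\<lambda>\<xi>. dyadic_partition \<phi> j \<xi> * inv_fourier \<psi> \<xi>))"
proof -
  have "(\<lambda>\<xi>. dyadic_partition \<phi> j \<xi> * inv_fourier \<psi> \<xi>) \<in> schwartz"
    by (intro schwartz_mult dyadic_partition_schwartz schwartz_inv_fourier assms)
  then show ?thesis
    using assms schwartz_inv_fourier[OF assms(2)]
    by (simp add: littlewood_paley_def distr_inv_fourier_def distr_mult_def distr_fourier_def)
qed

text \<open>The dyadic partition telescopes to the single cutoff at scale 2^n.\<close>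

lemma sum_littlewood_paley:
  assumes f: "f \<in> tempered_distributions" and \<phi>: "dyadic_cutoff \<phi>" and \<psi>: "\<psi> \<in> schwartz"
  shows "(\<Sum>j\<le>n. littlewood_paley \<phi> j f \<psi>) = f (fourier (\<lambda>\<xi>. \<phi> (\<xi> /\<^sub>R 2 ^ n) * inv_fourier \<psi> \<xi>))"
proof (induction n)
  case 0
  then show ?case by (simp add: littlewood_paley_eq[OF \<phi> \<psi>])
next
  case (Suc n)
  note s = schwartz_inv_fourier[OF \<psi>]
  define A where "A = (\<lambda>\<xi>. \<phi> (\<xi> /\<^sub>R 2 ^ n) * inv_fourier \<psi> \<xi>)"
  define B where "B = (\<lambda>\<xi>. dyadic_partition \<phi> (Suc n) \<xi> * inv_fourier \<psi> \<xi>)"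
  have AB: "A \<in> schwartz" "B \<in> schwartz"
    unfolding A_def B_def by (intro schwartz_mult s dyadic_cutoff_dilate_schwartz dyadic_partition_schwartz \<phi>)+
  have "(\<lambda>\<xi>. \<phi> (\<xi> /\<^sub>R 2 ^ Suc n) * inv_fourier \<psi> \<xi>) = (\<lambda>\<xi>. A \<xi> + B \<xi>)"
    by (simp add: A_def B_def algebra_simps)
  then have "f (fourier (\<lambda>\<xi>. \<phi> (\<xi> /\<^sub>R 2 ^ Suc n) * inv_fourier \<psi> \<xi>)) = f (fourier A) + f (fourier B)"
    using AB by (simp only: fourier_add tempered_add[OF f] schwartz_fourier)
  then show ?case
    using Suc by (simp only: sum.atMost_Suc littlewood_paley_eq[OF \<phi> \<psi>] A_def B_def)
qed

lemma littlewood_paley_sums: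
  assumes "f \<in> tempered_distributions" "dyadic_cutoff \<phi>" "\<psi> \<in> schwartz"
  shows "(\<lambda>j. littlewood_paley \<phi> j f \<psi>) sums f \<psi>"
  unfolding sums_def_le sum_littlewood_paley[OF assms]
  using tempered_cutoff_tendsto[OF assms(1,2) schwartz_inv_fourier[OF assms(3)]]
  by (simp add: fourier_inv_fourier_schwartz assms)

text \<open>The j-th member vanishes for |\<xi>| > 2^(j + 1), and up to this radius the cutoff
  dilated by 2^(j + 1) equals 1: one dyadic step beyond j is exactly enough.\<close>

lemma dyadic_partition_cutoff:
  assumes \<phi>: "dyadic_cutoff \<phi>"
  shows "dyadic_partition \<phi> j \<xi> * \<phi> (\<xi> /\<^sub>R 2 ^ Suc j) = dyadic_partition \<phi> j \<xi>"
proof (cases "norm \<xi> \<le> 2 ^ Suc j")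
  case True
  then have "norm (\<xi> /\<^sub>R 2 ^ Suc j) \<le> 1"
    by (simp add: field_simps del: power_Suc)
  then show ?thesis using \<phi> by (simp add: dyadic_cutoff_def del: power_Suc)
next
  case False
  have "dyadic_partition \<phi> j \<xi> = 0"
  proof (cases j)
    case 0
    then show ?thesis using False \<phi> by (simp add: dyadic_cutoff_def)
  next
    case (Suc i)
    then have "norm \<xi> > 4 * 2 ^ i" using False by simp
    moreover have "2 * (2::real) ^ i < 4 * 2 ^ i" by simp
    ultimately have "norm \<xi> > 4 * 2 ^ i" "norm \<xi> > 2 * 2 ^ i" by linarith+
    then have "norm (\<xi> /\<^sub>R 2 ^ Suc i) > 2" "norm (\<xi> /\<^sub>R 2 ^ i) > 2"
      by (simp_all add: field_simps)
    then show ?thesis using Suc \<phi> by (simp add: dyadic_cutoff_def del: power_Suc norm_scaleR)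
  qed
  then show ?thesis by simp
qed

text \<open>Moves the band limitation from the piece to the test function, which may be low-pass
  filtered without changing the pairing. A filtered test function is small when its spectrum sits
  far out, and this is where decay in \<omega> comes from.\<close>

lemma littlewood_paley_reproduce:
  assumes \<phi>: "dyadic_cutoff \<phi>" and \<psi>: "\<psi> \<in> schwartz"
  shows "littlewood_paley \<phi> j f \<psi> = littlewood_paley \<phi> j f (fourier (\<lambda>\<xi>. \<phi> (\<xi> /\<^sub>R 2 ^ Suc j) * inv_fourier \<psi> \<xi>))"
proof -
  define u where "u = (\<lambda>\<xi>. \<phi> (\<xi> /\<^sub>R 2 ^ Suc j) * inv_fourier \<psi> \<xi>)"
  have u: "u \<in> schwartz"
    unfolding u_def by (intro schwartz_mult dyadic_cutoff_dilate_schwartz schwartz_inv_fourier \<phi> \<psi>)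
  have "littlewood_paley \<phi> j f (fourier u) = f (fourier (\<lambda>\<xi>. dyadic_partition \<phi> j \<xi> * u \<xi>))"
    by (simp add: littlewood_paley_eq[OF \<phi>] schwartz_fourier u inv_fourier_fourier_schwartz)
  also have "(\<lambda>\<xi>. dyadic_partition \<phi> j \<xi> * u \<xi>) = (\<lambda>\<xi>. dyadic_partition \<phi> j \<xi> * inv_fourier \<psi> \<xi>)"
    unfolding u_def mult.assoc[symmetric] dyadic_partition_cutoff[OF \<phi>] ..
  finally show ?thesis by (simp add: littlewood_paley_eq[OF \<phi> \<psi>] u_def)
qed

definition stft_test :: "('a::euclidean_space \<Rightarrow> complex) \<Rightarrow> 'a \<Rightarrow> 'a \<Rightarrow> 'a \<Rightarrow> complex" where
  "stft_test g x \<omega> y = cnj (g (y - x)) * cis (- 2 * pi * (y \<bullet> \<omega>))"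

lemma stft_eq: "stft g f x \<omega> = f (stft_test g x \<omega>)"
  by (simp add: stft_def stft_test_def[abs_def])

lemma stft_test_schwartz:
  assumes "g \<in> schwartz"
  shows "stft_test g x \<omega> \<in> schwartz"
  unfolding stft_test_def[abs_def] modulation_eq
  by (intro schwartz_modulation schwartz_translate[of "\<lambda>y. cnj (g y)"] schwartz_cnj assms)

text \<open>Translation and modulation exchange roles: the spectrum is that of the conjugate window,
  moved to \<omega>, up to a unimodular factor.\<close>

lemma inv_fourier_stft_test:
  assumes g: "g \<in> schwartz"
  shows "inv_fourier (stft_test g x \<omega>) \<xi> = inv_fourier (\<lambda>y. cnj (g y)) (\<xi> - \<omega>) * cis (2 * pi * (x \<bullet> (\<xi> - \<omega>)))"
proof -
  have [measurable]: "(\<lambda>y. cnj (g y)) \<in> borel_measurable borel"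
    by (intro schwartz_measurable schwartz_cnj g)
  have "inv_fourier (stft_test g x \<omega>) \<xi> = (\<integral>y. cnj (g (y - x)) * cis (2 * pi * (y \<bullet> (\<xi> - \<omega>))) \<partial>lborel)"
    unfolding inv_fourier_def stft_test_def mult.assoc cis_mult
    by (intro Bochner_Integration.integral_cong)
      (auto simp: inner_diff_right inner_commute right_diff_distrib)
  also have "\<dots> = (\<integral>y. cnj (g (y + x - x)) * cis (2 * pi * ((y + x) \<bullet> (\<xi> - \<omega>))) \<partial>lborel)"
    unfolding cis_conv_exp by (rule integral_translate[symmetric]) measurable
  also have "\<dots> = (\<integral>y. cnj (g y) * cis (2 * pi * ((\<xi> - \<omega>) \<bullet> y)) * cis (2 * pi * (x \<bullet> (\<xi> - \<omega>))) \<partial>lborel)"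
    unfolding mult.assoc cis_mult
    by (intro Bochner_Integration.integral_cong) (auto simp: inner_commute[of _ "\<xi> - \<omega>"] inner_add_right distrib_left)
  also have "\<dots> = (\<integral>y. cnj (g y) * cis (2 * pi * ((\<xi> - \<omega>) \<bullet> y)) \<partial>lborel) * cis (2 * pi * (x \<bullet> (\<xi> - \<omega>)))"
    by (rule integral_mult_left_zero)
  finally show ?thesis by (simp add: inv_fourier_def)
qed

text \<open>The transform as an honest integral, for which joint measurability and Fubini's theorem
  are available; it agrees with \<open>stft\<close> for every representing function.\<close>

definition stft_fun :: "('a::euclidean_space \<Rightarrow> complex) \<Rightarrow> ('a \<Rightarrow> complex) \<Rightarrow> 'a \<Rightarrow> 'a \<Rightarrow> complex" where
  "stft_fun g h x \<omega> = (\<integral>y. h y * stft_test g x \<omega> y \<partial>lborel)"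

lemma stft_represents:
  "g \<in> schwartz \<Longrightarrow> represents h f \<Longrightarrow> stft g f x \<omega> = stft_fun g h x \<omega>"
  by (simp add: stft_eq represents_def stft_test_schwartz stft_fun_def)

text \<open>The low-pass filtered test function at x = 0. Other x only translate it and multiply it
  by a unimodular factor, so x enters the estimates through y - x alone.\<close>

definition stft_kernel :: "('a::euclidean_space \<Rightarrow> complex) \<Rightarrow> ('a \<Rightarrow> complex) \<Rightarrow> nat \<Rightarrow> 'a \<Rightarrow> 'a \<Rightarrow> complex" where
  "stft_kernel \<phi> g j \<omega> = fourier (\<lambda>\<xi>. \<phi> (\<xi> /\<^sub>R 2 ^ Suc j) * inv_fourier (\<lambda>y. cnj (g y)) (\<xi> - \<omega>))"

lemma stft_kernel_schwartz:
  "dyadic_cutoff \<phi> \<Longrightarrow> g \<in> schwartz \<Longrightarrow> stft_kernel \<phi> g j \<omega> \<in> schwartz"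
  unfolding stft_kernel_def
  by (intro schwartz_fourier schwartz_mult dyadic_cutoff_dilate_schwartz schwartz_translate schwartz_inv_fourier schwartz_cnj)

lemma fourier_cutoff_stft_test:
  assumes "g \<in> schwartz"
  shows "fourier (\<lambda>\<xi>. \<phi> (\<xi> /\<^sub>R 2 ^ Suc j) * inv_fourier (stft_test g x \<omega>) \<xi>) y
    = stft_kernel \<phi> g j \<omega> (y - x) * cis (- 2 * pi * (x \<bullet> \<omega>))"
proof -
  define G where "G \<xi> = \<phi> (\<xi> /\<^sub>R 2 ^ Suc j) * inv_fourier (\<lambda>y. cnj (g y)) (\<xi> - \<omega>)" for \<xi>
  have "\<phi> (\<xi> /\<^sub>R 2 ^ Suc j) * inv_fourier (stft_test g x \<omega>) \<xi> * cis (- 2 * pi * (\<xi> \<bullet> y))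
    = G \<xi> * cis (- 2 * pi * (\<xi> \<bullet> (y - x))) * cis (- 2 * pi * (x \<bullet> \<omega>))" for \<xi>
    unfolding inv_fourier_stft_test[OF assms] G_def mult.assoc cis_mult
    by (simp add: inner_diff_right inner_commute algebra_simps)
  then have "fourier (\<lambda>\<xi>. \<phi> (\<xi> /\<^sub>R 2 ^ Suc j) * inv_fourier (stft_test g x \<omega>) \<xi>) y
    = (\<integral>\<xi>. G \<xi> * cis (- 2 * pi * (\<xi> \<bullet> (y - x))) * cis (- 2 * pi * (x \<bullet> \<omega>)) \<partial>lborel)"
    unfolding fourier_def by presburger
  also have "\<dots> = (\<integral>\<xi>. G \<xi> * cis (- 2 * pi * (\<xi> \<bullet> (y - x))) \<partial>lborel) * cis (- 2 * pi * (x \<bullet> \<omega>))"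
    by (rule integral_mult_left_zero)
  finally show ?thesis by (simp add: stft_kernel_def fourier_def G_def)
qed

text \<open>Absolute values taken in the original integral would destroy the oscillation and all
  decay in \<omega>. After \<open>littlewood_paley_reproduce\<close> they are harmless, as the
  smallness has been moved into the kernel.\<close>

lemma norm_stft_fun_le_kernel:
  assumes \<phi>: "dyadic_cutoff \<phi>" and g: "g \<in> schwartz" and h: "represents h (littlewood_paley \<phi> j f)"
  shows "ennreal (norm (stft_fun g h x \<omega>))
    \<le> (\<integral>\<^sup>+y. ennreal (norm (stft_kernel \<phi> g j \<omega> (y - x))) * ennreal (norm (h y)) \<partial>lborel)"
proof -
  note t = stft_test_schwartz[OF g, of x \<omega>]
  define u where "u = fourier (\<lambda>\<xi>. \<phi> (\<xi> /\<^sub>R 2 ^ Suc j) * inv_fourier (stft_test g x \<omega>) \<xi>)"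
  have u: "u \<in> schwartz"
    unfolding u_def
    by (intro schwartz_fourier schwartz_mult dyadic_cutoff_dilate_schwartz \<phi> schwartz_inv_fourier t)
  have "stft_fun g h x \<omega> = littlewood_paley \<phi> j f (stft_test g x \<omega>)"
    using h t by (simp add: represents_def stft_fun_def)
  also have "\<dots> = littlewood_paley \<phi> j f u"
    unfolding u_def by (rule littlewood_paley_reproduce[OF \<phi> t])
  also have "\<dots> = (\<integral>y. h y * u y \<partial>lborel)"
    using h u by (simp add: represents_def)
  finally have le: "ennreal (norm (stft_fun g h x \<omega>)) \<le> (\<integral>\<^sup>+y. ennreal (norm (h y * u y)) \<partial>lborel)"
    by (simp add: norm_integral_le_nn_integral)
  have "norm (h y * u y) = norm (stft_kernel \<phi> g j \<omega> (y - x)) * norm (h y)" for y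
    unfolding u_def fourier_cutoff_stft_test[OF g] by (simp add: norm_mult mult_ac)
  with le show ?thesis by (simp add: ennreal_mult)
qed

lemma stft_kernel_L1_bound:
  fixes \<phi> g :: "'a::euclidean_space \<Rightarrow> complex"
  assumes \<phi>: "dyadic_cutoff \<phi>" and g: "g \<in> schwartz"
  shows "\<exists>C>0. \<forall>j \<omega>. L1_norm (stft_kernel \<phi> g j \<omega>) \<le> C * (2 ^ j / (1 + norm \<omega>)) ^ N"
proof -
  have "\<phi> \<in> schwartz" using \<phi> by (simp add: dyadic_cutoff_def)
  from fourier_dilate_mult_L1_bound[OF this schwartz_inv_fourier[OF schwartz_cnj[OF g]], of N]
  obtain C where C: "C > 0" "\<And>r \<omega>. 0 < r \<Longrightarrow> r \<le> 1 \<Longrightarrow>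
    (r * (1 + norm \<omega>)) ^ N * L1_norm (fourier (\<lambda>\<xi>. \<phi> (r *\<^sub>R \<xi>) * inv_fourier (\<lambda>x. cnj (g x)) (\<xi> - \<omega>))) \<le> C"
    by blast
  have "L1_norm (stft_kernel \<phi> g j \<omega>) \<le> (C * 2 ^ N) * (2 ^ j / (1 + norm \<omega>)) ^ N" for j \<omega>
  proof -
    \<comment> \<open>The scale of the cutoff in \<open>stft_kernel\<close>; passing from 2^(j + 1)
      to 2^j costs the factor 2^N in the constant.\<close>
    define r :: real where "r = inverse (2 ^ Suc j)"
    have r: "0 < r" "r \<le> 1" unfolding r_def by (auto simp: inverse_le_1_iff simp del: power_Suc intro: one_le_power)
    have w: "r * (1 + norm \<omega>) > 0" using r by (intro mult_pos_pos) (auto simp: add_pos_nonneg)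
    have "(r * (1 + norm \<omega>)) ^ N * L1_norm (stft_kernel \<phi> g j \<omega>) \<le> C"
      using C(2)[OF r, of \<omega>] by (simp add: stft_kernel_def r_def)
    then have "L1_norm (stft_kernel \<phi> g j \<omega>) \<le> C / (r * (1 + norm \<omega>)) ^ N"
      using w by (simp add: pos_le_divide_eq mult.commute del: power_mult_distrib)
    also have "\<dots> = C * (1 / (r * (1 + norm \<omega>))) ^ N"
    proof -
      have "C / w ^ N = C * (1 / w) ^ N" for w :: real by (simp add: power_divide)
      then show ?thesis .
    qed
    also have "1 / (r * (1 + norm \<omega>)) = 2 * (2 ^ j / (1 + norm \<omega>))"
      by (simp add: r_def field_simps)
    also have "C * (2 * (2 ^ j / (1 + norm \<omega>))) ^ N = C * 2 ^ N * (2 ^ j / (1 + norm \<omega>)) ^ N"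
      by (simp only: power_mult_distrib mult.assoc)
    finally show ?thesis .
  qed
  then show ?thesis using C(1) by (intro exI[of _ "C * 2 ^ N"]) auto
qed

lemma norm_sums_le_suminf:
  fixes a :: "nat \<Rightarrow> complex"
  assumes "a sums s"
  shows "ennreal (norm s) \<le> (\<Sum>j. ennreal (norm (a j)))"
proof (rule LIMSEQ_le_const2)
  show "(\<lambda>n. ennreal (norm (\<Sum>j<n. a j))) \<longlonglongrightarrow> ennreal (norm s)"
    using assms unfolding sums_def by (intro tendsto_ennrealI tendsto_norm)
  have "ennreal (norm (\<Sum>j<n. a j)) \<le> (\<Sum>j. ennreal (norm (a j)))" for n
  proof -
    have "ennreal (norm (\<Sum>j<n. a j)) \<le> ennreal (\<Sum>j<n. norm (a j))"
      by (intro ennreal_leI norm_sum)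
    also have "\<dots> = (\<Sum>j<n. ennreal (norm (a j)))" by (simp add: sum_ennreal)
    also have "\<dots> \<le> (\<Sum>j. ennreal (norm (a j)))" by (intro sum_le_suminf) auto
    finally show ?thesis .
  qed
  then show "\<exists>N. \<forall>n\<ge>N. ennreal (norm (\<Sum>j<n. a j)) \<le> (\<Sum>j. ennreal (norm (a j)))" by blast
qed

text \<open>A value of the transform is one pairing with a Schwartz function, so the decomposition
  holds at every (x, \<omega>). It carries both size and measurability from the pieces to f.\<close>

lemma stft_sums:
  assumes f: "f \<in> tempered_distributions" and \<phi>: "dyadic_cutoff \<phi>" and g: "g \<in> schwartz"
    and h: "\<And>j. represents (h j) (littlewood_paley \<phi> j f)"
  shows "(\<lambda>j. stft_fun g (h j) x \<omega>) sums stft g f x \<omega>"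
  using littlewood_paley_sums[OF f \<phi> stft_test_schwartz[OF g, of x \<omega>]]
  by (simp add: stft_represents[OF g h, symmetric] stft_eq)

lemma borel_measurable_stft_fun:
  assumes g: "g \<in> schwartz" and h[measurable]: "h \<in> borel_measurable borel"
  shows "(\<lambda>(x, \<omega>). stft_fun g h x \<omega>) \<in> borel_measurable (borel \<Otimes>\<^sub>M borel)"
proof -
  have [measurable]: "(\<lambda>y. cnj (g y)) \<in> borel_measurable borel"
    by (intro schwartz_measurable schwartz_cnj g)
  show ?thesis
    unfolding stft_fun_def stft_test_def cis_conv_exp by measurable
qed

section \<open>Bounds for the short-time Fourier transform of a function\<close>

text \<open>In \<open>ennreal\<close>, 1 / top = 0 and 1 / 0 = top, so the one equation covers both
  endpoints and excludes p' = 0.\<close>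

lemma conjugate_exponent_cases:
  fixes p p' :: ennreal
  assumes "1 \<le> p" and pp: "1 / p + 1 / p' = 1"
  obtains (one) "p = 1" "p' = top" | (top) "p = top" "p' = 1"
    | (real) r where "p = ennreal r" "1 < r" "p' = ennreal (r / (r - 1))"
  using \<open>1 \<le> p\<close>
proof (cases rule: exponent_cases)
  case top
  then have "1 / p' = 1" using pp by simp
  have "p' = 1"
  proof (cases p')
    case (real t)
    then have "t \<noteq> 0" using \<open>1 / p' = 1\<close> by (auto simp: divide_ennreal_def)
    then have "ennreal (1 / t) = ennreal 1" using \<open>1 / p' = 1\<close> real divide_ennreal[of 1 t] by simp
    then have "1 / t = 1" using real by (subst (asm) ennreal_inj) auto
    then show ?thesis using real by simp
  next
    case top
    then show ?thesis using \<open>1 / p' = 1\<close> by simp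
  qed
  then show ?thesis using top that by simp
next
  case (real r)
  have p1: "1 / p = ennreal (1 / r)"
    using real divide_ennreal[of 1 r] by simp
  show ?thesis
  proof (cases p')
    case (real t)
    have t: "t > 0"
    proof (rule ccontr)
      assume "\<not> t > 0"
      then have "1 / p' = top" using real by (simp add: divide_ennreal_def)
      then show False using pp by simp
    qed
    have "1 / p' = ennreal (1 / t)"
      using real t divide_ennreal[of 1 t] by simp
    then have "ennreal (1 / r + 1 / t) = ennreal 1"
      using pp p1 t \<open>1 \<le> r\<close> by simp
    then have e: "1 / r + 1 / t = 1"
      using t \<open>1 \<le> r\<close> by (subst (asm) ennreal_inj) auto
    then have "1 / r < 1" using t by (smt (verit) zero_less_divide_1_iff)
    then have r: "1 < r" using \<open>1 \<le> r\<close> by (simp add: field_simps)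
    then have "t = r / (r - 1)" using e t by (simp add: field_simps)
    then show ?thesis using that(3) r real \<open>p = ennreal r\<close> by simp
  next
    case top
    then have "ennreal (1 / r) = ennreal 1" using pp p1 by simp
    then have "r = 1" using \<open>1 \<le> r\<close> by (subst (asm) ennreal_inj) auto
    then show ?thesis using that(1) top \<open>p = ennreal r\<close> by simp
  qed
qed

lemma nn_integral_convolution:
  fixes A B :: "'a::euclidean_space \<Rightarrow> ennreal"
  assumes [measurable]: "A \<in> borel_measurable borel" "B \<in> borel_measurable borel"
  shows "(\<integral>\<^sup>+x. \<integral>\<^sup>+y. A (y - x) * B y \<partial>lborel \<partial>lborel) = (\<integral>\<^sup>+x. A x \<partial>lborel) * (\<integral>\<^sup>+x. B x \<partial>lborel)"
proof -
  have "(\<integral>\<^sup>+x. \<integral>\<^sup>+y. A (y - x) * B y \<partial>lborel \<partial>lborel) = (\<integral>\<^sup>+y. \<integral>\<^sup>+x. A (y - x) * B y \<partial>lborel \<partial>lborel)"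
    by (rule lborel_pair.Fubini') measurable
  also have "\<dots> = (\<integral>\<^sup>+y. (\<integral>\<^sup>+x. A x \<partial>lborel) * B y \<partial>lborel)"
    by (simp add: nn_integral_multc nn_integral_lborel_translate(3))
  finally show ?thesis by (simp add: nn_integral_cmult)
qed

text \<open>Jensen's inequality in y with weight K(y - x), then integration in x. The reflected
  argument y - x is the form that \<open>norm_stft_fun_le_kernel\<close> produces.\<close>

lemma Lp_norm_convolution_le:
  fixes H K :: "'a::euclidean_space \<Rightarrow> ennreal"
  assumes p: "1 \<le> p" and [measurable]: "H \<in> borel_measurable borel" "K \<in> borel_measurable borel"
    and c: "(\<integral>\<^sup>+x. K x \<partial>lborel) \<le> ennreal c" "0 \<le> c"
  shows "Lp_norm p lborel (\<lambda>x. \<integral>\<^sup>+y. K (y - x) * H y \<partial>lborel) \<le> ennreal c * Lp_norm p lborel H"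
  using p
proof (cases rule: exponent_cases)
  case top
  have "(\<integral>\<^sup>+y. K (y - x) * H y \<partial>lborel) \<le> ennreal c * esssup lborel H" for x
  proof -
    have "AE y in lborel. H y \<le> esssup lborel H" by (rule esssup_AE)
    then have "(\<integral>\<^sup>+y. K (y - x) * H y \<partial>lborel) \<le> (\<integral>\<^sup>+y. K (y - x) * esssup lborel H \<partial>lborel)"
      by (intro nn_integral_mono_AE) (auto elim!: eventually_mono intro: mult_left_mono)
    also have "\<dots> = (\<integral>\<^sup>+y. K y \<partial>lborel) * esssup lborel H"
      by (simp add: nn_integral_multc nn_integral_lborel_translate(2))
    also have "\<dots> \<le> ennreal c * esssup lborel H"
      by (intro mult_right_mono c) auto
    finally show ?thesis .
  qed
  then show ?thesis unfolding top Lp_norm_top by (intro esssup_I) auto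
next
  case (real r)
  have cx: "(\<integral>\<^sup>+y. K (y - x) \<partial>lborel) \<le> ennreal c" for x
    using c by (simp add: nn_integral_lborel_translate(2))
  have "(\<integral>\<^sup>+x. ennreal_rpow (\<integral>\<^sup>+y. K (y - x) * H y \<partial>lborel) r \<partial>lborel)
    \<le> (\<integral>\<^sup>+x. ennreal (c powr (r - 1)) * (\<integral>\<^sup>+y. K (y - x) * ennreal_rpow (H y) r \<partial>lborel) \<partial>lborel)"
    using real by (intro nn_integral_mono nn_integral_rpow_jensen cx c) auto
  also have "\<dots> = ennreal (c powr (r - 1)) * ((\<integral>\<^sup>+x. K x \<partial>lborel) * (\<integral>\<^sup>+x. ennreal_rpow (H x) r \<partial>lborel))"
    by (simp add: nn_integral_cmult nn_integral_convolution[of K "\<lambda>y. ennreal_rpow (H y) r"])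
  also have "\<dots> \<le> ennreal (c powr (r - 1)) * (ennreal c * (\<integral>\<^sup>+x. ennreal_rpow (H x) r \<partial>lborel))"
    by (intro mult_left_mono mult_right_mono c) auto
  also have "\<dots> = ennreal (c powr r) * (\<integral>\<^sup>+x. ennreal_rpow (H x) r \<partial>lborel)"
  proof -
    have "c powr (r - 1) * c = c powr r"
      using c real by (cases "c = 0") (auto simp: powr_diff)
    then show ?thesis using c by (simp add: mult.assoc[symmetric] flip: ennreal_mult)
  qed
  finally have "ennreal_rpow (\<integral>\<^sup>+x. ennreal_rpow (\<integral>\<^sup>+y. K (y - x) * H y \<partial>lborel) r \<partial>lborel) (1 / r)
    \<le> ennreal_rpow (ennreal (c powr r) * (\<integral>\<^sup>+x. ennreal_rpow (H x) r \<partial>lborel)) (1 / r)"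
    using real by (intro ennreal_rpow_mono) auto
  then show ?thesis
    using real c by (simp add: Lp_norm_real ennreal_rpow_mult powr_powr)
qed

text \<open>A bounded integrable function has integrable powers: |g|^r \<le> C^(r - 1) |g| for a
  bound C of |g|.\<close>

lemma schwartz_powr_integral:
  fixes g :: "'a::euclidean_space \<Rightarrow> complex"
  assumes g: "g \<in> schwartz" and r: "1 \<le> r"
  obtains A where "A > 0" "(\<integral>\<^sup>+x. ennreal (norm (g x) powr r) \<partial>lborel) \<le> ennreal A"
proof -
  obtain C where C: "C > 0" "\<And>x. norm (g x) \<le> C" using schwartz_bounded[OF g] by metis
  have "(\<integral>\<^sup>+x. ennreal (norm (g x) powr r) \<partial>lborel) \<le> (\<integral>\<^sup>+x. ennreal (C powr (r - 1) * norm (g x)) \<partial>lborel)"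
  proof (intro nn_integral_mono ennreal_leI)
    fix x
    have "norm (g x) powr r = norm (g x) powr (r - 1) * norm (g x)"
      using r by (cases "g x = 0") (auto simp: powr_diff)
    also have "\<dots> \<le> C powr (r - 1) * norm (g x)"
      using r C by (intro mult_right_mono powr_mono2) auto
    finally show "norm (g x) powr r \<le> C powr (r - 1) * norm (g x)" .
  qed
  also have "\<dots> = ennreal (\<integral>x. C powr (r - 1) * norm (g x) \<partial>lborel)"
    by (intro nn_integral_eq_integral integrable_mult_right integrable_norm schwartz_integrable g) auto
  also have "\<dots> \<le> ennreal (\<bar>\<integral>x. C powr (r - 1) * norm (g x) \<partial>lborel\<bar> + 1)"
    by (intro ennreal_leI) linarith
  finally show thesis
    by (rule that[rotated]) (rule add_nonneg_pos, auto)
qed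

abbreviation Lp_fun :: "ennreal \<Rightarrow> ('a::euclidean_space \<Rightarrow> complex) \<Rightarrow> ennreal" where
  "Lp_fun p h \<equiv> Lp_norm p lborel (\<lambda>x. ennreal (norm (h x)))"

lemma represents_measurable: "represents h f \<Longrightarrow> h \<in> borel_measurable borel"
  by (simp add: represents_def)

lemma stft_fun_fourier: "stft_fun g h x \<omega> = fourier (\<lambda>y. h y * cnj (g (y - x))) \<omega>"
  by (simp add: stft_fun_def stft_test_def fourier_def mult.assoc)

text \<open>The integrability against Schwartz functions contained in \<open>represents\<close>,
  read for the test function with \<omega> = 0.\<close>

lemma represents_integrable:
  assumes "represents h f" "g \<in> schwartz"
  shows "integrable lborel (\<lambda>y. h y * cnj (g (y - x)))"
proof -
  have "integrable lborel (\<lambda>y. h y * stft_test g x 0 y)"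
    using assms by (simp add: represents_def stft_test_schwartz)
  then show ?thesis by (simp add: stft_test_def)
qed

text \<open>For fixed x the transform is the Fourier transform of h times a translated window, and
  the constant is independent of x.\<close>

lemma stft_fun_hausdorff_young:
  fixes g :: "'a::euclidean_space \<Rightarrow> complex"
  assumes g: "g \<in> schwartz" and p: "1 < p" "p \<le> 2" and q: "q = p / (p - 1)"
  shows "\<exists>C>0. \<forall>h f x. represents h f \<longrightarrow>
    (\<integral>\<^sup>+\<omega>. ennreal_rpow (ennreal (norm (stft_fun g h x \<omega>))) q \<partial>lborel)
      \<le> ennreal C * ennreal_rpow (\<integral>\<^sup>+y. ennreal (norm (g (y - x)) powr p) * ennreal (norm (h y) powr p) \<partial>lborel) (q / p)"
proof -
  obtain C where C: "C > 0" "\<And>u :: 'a \<Rightarrow> complex. integrable lborel u \<Longrightarrow>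
    (\<integral>\<^sup>+\<xi>. ennreal (norm (fourier u \<xi>) powr q) \<partial>lborel)
      \<le> ennreal C * ennreal_rpow (\<integral>\<^sup>+x. ennreal (norm (u x) powr p) \<partial>lborel) (q / p)"
    using hausdorff_young[OF p q] by blast
  show ?thesis
  proof (intro exI[of _ C] conjI allI impI C(1))
    fix h f x assume h: "represents h (f :: 'a distr)"
    show "(\<integral>\<^sup>+\<omega>. ennreal_rpow (ennreal (norm (stft_fun g h x \<omega>))) q \<partial>lborel)
      \<le> ennreal C * ennreal_rpow (\<integral>\<^sup>+y. ennreal (norm (g (y - x)) powr p) * ennreal (norm (h y) powr p) \<partial>lborel) (q / p)"
      using C(2)[OF represents_integrable[OF h g, of x]]
      by (simp add: stft_fun_fourier norm_mult powr_mult ennreal_mult mult.commute)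
  qed
qed

lemma stft_bound_low:
  fixes g :: "'a::euclidean_space \<Rightarrow> complex"
  assumes g: "g \<in> schwartz" and p: "1 \<le> p" "p \<le> 2" and pp: "1 / p + 1 / p' = 1"
  shows "\<exists>C>0. \<forall>h f. represents h f \<longrightarrow>
    Lp_norm p' lborel (\<lambda>\<omega>. Lp_fun p (\<lambda>x. stft_fun g h x \<omega>))
      \<le> ennreal C * Lp_fun p h"
  using p(1) pp
proof (cases rule: conjugate_exponent_cases)
  case top
  then show ?thesis using p by (simp add: top_unique)
next
  \<comment> \<open>At p = 1 absolute values under the integral already bound the L1 norm in x,
    uniformly in \<omega>.\<close>
  case one
  note [measurable] = schwartz_measurable[OF g]
  obtain A where A: "A > 0" "(\<integral>\<^sup>+x. ennreal (norm (g x) powr 1) \<partial>lborel) \<le> ennreal A"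
    using schwartz_powr_integral[OF g, of 1] by auto
  show ?thesis
  proof (intro exI[of _ A] conjI allI impI A(1))
    fix h f assume h: "represents h (f :: 'a distr)"
    note [measurable] = represents_measurable[OF h]
    have "(\<lambda>(x, \<omega>). stft_fun g h x \<omega>) \<in> borel_measurable (borel \<Otimes>\<^sub>M borel)"
      by (rule borel_measurable_stft_fun[OF g]) measurable
    then have [measurable]: "(\<lambda>(\<omega>, x). ennreal (norm (stft_fun g h x \<omega>))) \<in> borel_measurable (borel \<Otimes>\<^sub>M borel)"
      by measurable
    have "(\<integral>\<^sup>+x. ennreal (norm (stft_fun g h x \<omega>)) \<partial>lborel) \<le> ennreal A * (\<integral>\<^sup>+x. ennreal (norm (h x)) \<partial>lborel)" for \<omega>
    proof -
      have "ennreal (norm (stft_fun g h x \<omega>)) \<le> (\<integral>\<^sup>+y. ennreal (norm (g (y - x))) * ennreal (norm (h y)) \<partial>lborel)" for x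
        unfolding stft_fun_def
        by (rule order_trans[OF norm_integral_le_nn_integral])
          (simp add: stft_test_def norm_mult ennreal_mult mult.commute)
      then have "(\<integral>\<^sup>+x. ennreal (norm (stft_fun g h x \<omega>)) \<partial>lborel)
        \<le> (\<integral>\<^sup>+x. \<integral>\<^sup>+y. ennreal (norm (g (y - x))) * ennreal (norm (h y)) \<partial>lborel \<partial>lborel)"
        by (intro nn_integral_mono)
      also have "\<dots> = (\<integral>\<^sup>+x. ennreal (norm (g x)) \<partial>lborel) * (\<integral>\<^sup>+x. ennreal (norm (h x)) \<partial>lborel)"
        by (rule nn_integral_convolution) measurable
      also have "\<dots> \<le> ennreal A * (\<integral>\<^sup>+x. ennreal (norm (h x)) \<partial>lborel)"
        using A by (intro mult_right_mono) auto
      finally show ?thesis .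
    qed
    moreover have "Lp_norm p lborel F = (\<integral>\<^sup>+x. F x \<partial>lborel)" for F :: "'a \<Rightarrow> ennreal"
      using Lp_norm_real[of 1 lborel F] one by simp
    ultimately show "Lp_norm p' lborel (\<lambda>\<omega>. Lp_fun p (\<lambda>x. stft_fun g h x \<omega>))
      \<le> ennreal A * Lp_fun p h"
      unfolding one(2) Lp_norm_top by (intro esssup_I) (simp_all, measurable)
  qed
next
  case (real r)
  define q where "q = r / (r - 1)"
  have r: "1 < r" "r \<le> 2" using real p by (auto simp flip: ennreal_numeral)
  have q: "q \<ge> 2" using r by (simp add: q_def field_simps)
  have qr: "q / r \<ge> 1" "q > 0" using r by (auto simp: q_def field_simps)
  note [measurable] = schwartz_measurable[OF g]
  obtain A where A: "A > 0" "(\<integral>\<^sup>+x. ennreal (norm (g x) powr r) \<partial>lborel) \<le> ennreal A"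
    using schwartz_powr_integral[OF g, of r] r by auto
  obtain C where C: "C > 0" "\<And>h f x. represents h (f :: 'a distr) \<Longrightarrow>
    (\<integral>\<^sup>+\<omega>. ennreal_rpow (ennreal (norm (stft_fun g h x \<omega>))) q \<partial>lborel)
      \<le> ennreal C * ennreal_rpow (\<integral>\<^sup>+y. ennreal (norm (g (y - x)) powr r) * ennreal (norm (h y) powr r) \<partial>lborel) (q / r)"
    using stft_fun_hausdorff_young[OF g r q_def] by blast
  \<comment> \<open>The Hausdorff--Young constant after the power r / q, times the mass of |g|^r
    from the convolution; the outer root makes an L^r norm of it.\<close>
  define D where "D = (C powr (r / q) * A) powr (1 / r)"
  show ?thesis
  proof (intro exI[of _ D] conjI allI impI)
    show "D > 0" using A C by (simp add: D_def)
    fix h f assume h: "represents h (f :: 'a distr)"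
    note [measurable] = represents_measurable[OF h]
    define v where "v x \<omega> = ennreal (norm (stft_fun g h x \<omega>))" for x \<omega>
    have "(\<lambda>(x, \<omega>). stft_fun g h x \<omega>) \<in> borel_measurable (borel \<Otimes>\<^sub>M borel)"
      by (rule borel_measurable_stft_fun[OF g]) measurable
    then have [measurable]: "(\<lambda>(x, \<omega>). v x \<omega>) \<in> borel_measurable (borel \<Otimes>\<^sub>M borel)"
      unfolding v_def by measurable
    define Hr where "Hr = (\<integral>\<^sup>+y. ennreal (norm (h y) powr r) \<partial>lborel)"
    \<comment> \<open>Minkowski with exponent q / r \<ge> 1, applied to the r-th power of the
      transform: it brings the \<omega>-norm inside the x-norm, where Hausdorff--Young can act for
      each x.\<close>
    have "ennreal_rpow (\<integral>\<^sup>+\<omega>. ennreal_rpow (\<integral>\<^sup>+x. ennreal_rpow (v x \<omega>) r \<partial>lborel) (q / r) \<partial>lborel) (1 / (q / r))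
      \<le> (\<integral>\<^sup>+x. ennreal_rpow (\<integral>\<^sup>+\<omega>. ennreal_rpow (ennreal_rpow (v x \<omega>) r) (q / r) \<partial>lborel) (1 / (q / r)) \<partial>lborel)"
      by (rule nn_integral_minkowski[OF _ qr(1)]) (simp_all add: lborel_pair.pair_sigma_finite_axioms)
    also have "\<dots> = (\<integral>\<^sup>+x. ennreal_rpow (\<integral>\<^sup>+\<omega>. ennreal_rpow (v x \<omega>) q \<partial>lborel) (r / q) \<partial>lborel)"
      using r by (simp add: ennreal_rpow_rpow)
    also have "\<dots> \<le> (\<integral>\<^sup>+x. ennreal (C powr (r / q)) *
        (\<integral>\<^sup>+y. ennreal (norm (g (y - x)) powr r) * ennreal (norm (h y) powr r) \<partial>lborel) \<partial>lborel)"
    proof (rule nn_integral_mono)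
      fix x
      have "ennreal_rpow (\<integral>\<^sup>+\<omega>. ennreal_rpow (v x \<omega>) q \<partial>lborel) (r / q) \<le>
        ennreal_rpow (ennreal C * ennreal_rpow (\<integral>\<^sup>+y. ennreal (norm (g (y - x)) powr r) * ennreal (norm (h y) powr r) \<partial>lborel) (q / r)) (r / q)"
        unfolding v_def using r qr C(2)[OF h] by (intro ennreal_rpow_mono) auto
      then show "ennreal_rpow (\<integral>\<^sup>+\<omega>. ennreal_rpow (v x \<omega>) q \<partial>lborel) (r / q) \<le> ennreal (C powr (r / q)) *
        (\<integral>\<^sup>+y. ennreal (norm (g (y - x)) powr r) * ennreal (norm (h y) powr r) \<partial>lborel)"
        using r qr C(1) by (simp add: ennreal_rpow_mult ennreal_rpow_rpow)
    qed
    also have "\<dots> = ennreal (C powr (r / q)) * ((\<integral>\<^sup>+x. ennreal (norm (g x) powr r) \<partial>lborel) * Hr)"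
      unfolding Hr_def
      by (subst nn_integral_cmult, measurable)
        (subst nn_integral_convolution[of "\<lambda>x. ennreal (norm (g x) powr r)" "\<lambda>y. ennreal (norm (h y) powr r)"], simp_all)
    also have "\<dots> \<le> ennreal (C powr (r / q)) * (ennreal A * Hr)"
      by (intro mult_left_mono mult_right_mono A) auto
    also have "\<dots> = ennreal (C powr (r / q) * A) * Hr"
      using A by (simp add: ennreal_mult mult.assoc)
    finally have main: "ennreal_rpow (\<integral>\<^sup>+\<omega>. ennreal_rpow (\<integral>\<^sup>+x. ennreal_rpow (v x \<omega>) r \<partial>lborel) (q / r) \<partial>lborel) (r / q)
      \<le> ennreal (C powr (r / q) * A) * Hr" by simp
    have "ennreal_rpow (ennreal_rpow (\<integral>\<^sup>+\<omega>. ennreal_rpow (\<integral>\<^sup>+x. ennreal_rpow (v x \<omega>) r \<partial>lborel) (q / r) \<partial>lborel) (r / q)) (1 / r)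
      \<le> ennreal_rpow (ennreal (C powr (r / q) * A) * Hr) (1 / r)"
      using r by (intro ennreal_rpow_mono main) auto
    then have "ennreal_rpow (\<integral>\<^sup>+\<omega>. ennreal_rpow (\<integral>\<^sup>+x. ennreal_rpow (v x \<omega>) r \<partial>lborel) (q / r) \<partial>lborel) (1 / q)
      \<le> ennreal D * ennreal_rpow Hr (1 / r)"
      using r A(1) by (simp add: ennreal_rpow_mult ennreal_rpow_rpow D_def)
    then show "Lp_norm p' lborel (\<lambda>\<omega>. Lp_fun p (\<lambda>x. stft_fun g h x \<omega>))
      \<le> ennreal D * Lp_fun p h"
      unfolding real(1,3) q_def[symmetric]
      using r q by (simp add: Lp_norm_real ennreal_rpow_rpow Hr_def v_def)
  qed
qed

text \<open>With q conjugate to r, so q \<le> 2, Hausdorff--Young lands in L^r in \<omega> and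
  yields the power r / q \<ge> 1 of an integral of |h|^q with weight |g(y - x)|^q. Jensen moves that
  power onto |h|^q, which becomes |h|^r, and the integral in x removes the window.\<close>

lemma stft_bound_diagonal:
  fixes g :: "'a::euclidean_space \<Rightarrow> complex"
  assumes g: "g \<in> schwartz" and r: "2 \<le> r"
  shows "\<exists>C>0. \<forall>h f. represents h f \<longrightarrow>
    (\<integral>\<^sup>+\<omega>. \<integral>\<^sup>+x. ennreal_rpow (ennreal (norm (stft_fun g h x \<omega>))) r \<partial>lborel \<partial>lborel)
      \<le> ennreal C * (\<integral>\<^sup>+x. ennreal_rpow (ennreal (norm (h x))) r \<partial>lborel)"
proof -
  define q where "q = r / (r - 1)"
  have q: "1 < q" "q \<le> 2" "r = q / (q - 1)" "1 \<le> r / q" using r by (auto simp: q_def field_simps)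
  note [measurable] = schwartz_measurable[OF g]
  obtain A where A: "A > 0" "(\<integral>\<^sup>+x. ennreal (norm (g x) powr q) \<partial>lborel) \<le> ennreal A"
    using schwartz_powr_integral[OF g, of q] q by auto
  obtain C where C: "C > 0" "\<And>h f x. represents h (f :: 'a distr) \<Longrightarrow>
    (\<integral>\<^sup>+\<omega>. ennreal_rpow (ennreal (norm (stft_fun g h x \<omega>))) r \<partial>lborel)
      \<le> ennreal C * ennreal_rpow (\<integral>\<^sup>+y. ennreal (norm (g (y - x)) powr q) * ennreal (norm (h y) powr q) \<partial>lborel) (r / q)"
    using stft_fun_hausdorff_young[OF g q(1-3)] by blast
  \<comment> \<open>C from Hausdorff--Young, A^(r / q - 1) from Jensen, and the last A from
    integrating the window over x.\<close>
  define D where "D = C * A powr (r / q - 1) * A"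
  show ?thesis
  proof (intro exI[of _ D] conjI allI impI)
    show "D > 0" using A C by (simp add: D_def)
    fix h f assume h: "represents h (f :: 'a distr)"
    note [measurable] = represents_measurable[OF h]
    define v where "v x \<omega> = ennreal (norm (stft_fun g h x \<omega>))" for x \<omega>
    have "(\<lambda>(x, \<omega>). stft_fun g h x \<omega>) \<in> borel_measurable (borel \<Otimes>\<^sub>M borel)"
      by (rule borel_measurable_stft_fun[OF g]) measurable
    then have [measurable]: "(\<lambda>(x, \<omega>). v x \<omega>) \<in> borel_measurable (borel \<Otimes>\<^sub>M borel)"
      unfolding v_def by measurable
    have "(\<integral>\<^sup>+\<omega>. \<integral>\<^sup>+x. ennreal_rpow (v x \<omega>) r \<partial>lborel \<partial>lborel) = (\<integral>\<^sup>+x. \<integral>\<^sup>+\<omega>. ennreal_rpow (v x \<omega>) r \<partial>lborel \<partial>lborel)"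
      by (rule lborel_pair.Fubini') measurable
    also have "\<dots> \<le> (\<integral>\<^sup>+x. ennreal (C * A powr (r / q - 1)) *
        (\<integral>\<^sup>+y. ennreal (norm (g (y - x)) powr q) * ennreal (norm (h y) powr r) \<partial>lborel) \<partial>lborel)"
    proof (rule nn_integral_mono)
      fix x
      have gx: "(\<integral>\<^sup>+y. ennreal (norm (g (y - x)) powr q) \<partial>lborel) \<le> ennreal A"
        using A(2) nn_integral_lborel_translate(2)[of "\<lambda>y. ennreal (norm (g y) powr q)" x] by simp
      have "(\<integral>\<^sup>+\<omega>. ennreal_rpow (v x \<omega>) r \<partial>lborel)
        \<le> ennreal C * ennreal_rpow (\<integral>\<^sup>+y. ennreal (norm (g (y - x)) powr q) * ennreal (norm (h y) powr q) \<partial>lborel) (r / q)"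
        unfolding v_def by (rule C(2)[OF h])
      also have "\<dots> \<le> ennreal C * (ennreal (A powr (r / q - 1)) *
        (\<integral>\<^sup>+y. ennreal (norm (g (y - x)) powr q) * ennreal_rpow (ennreal (norm (h y) powr q)) (r / q) \<partial>lborel))"
        using A gx q by (intro mult_left_mono nn_integral_rpow_jensen) auto
      also have "\<dots> = ennreal (C * A powr (r / q - 1)) *
        (\<integral>\<^sup>+y. ennreal (norm (g (y - x)) powr q) * ennreal (norm (h y) powr r) \<partial>lborel)"
        using q C(1) by (simp add: powr_powr ennreal_mult mult.assoc)
      finally show "(\<integral>\<^sup>+\<omega>. ennreal_rpow (v x \<omega>) r \<partial>lborel) \<le> ennreal (C * A powr (r / q - 1)) *
        (\<integral>\<^sup>+y. ennreal (norm (g (y - x)) powr q) * ennreal (norm (h y) powr r) \<partial>lborel)" .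
    qed
    also have "\<dots> = ennreal (C * A powr (r / q - 1)) *
        ((\<integral>\<^sup>+x. ennreal (norm (g x) powr q) \<partial>lborel) * (\<integral>\<^sup>+y. ennreal (norm (h y) powr r) \<partial>lborel))"
      by (subst nn_integral_cmult, measurable)
        (subst nn_integral_convolution[of "\<lambda>x. ennreal (norm (g x) powr q)" "\<lambda>y. ennreal (norm (h y) powr r)"], simp_all)
    also have "\<dots> \<le> ennreal (C * A powr (r / q - 1)) * (ennreal A * (\<integral>\<^sup>+y. ennreal (norm (h y) powr r) \<partial>lborel))"
      by (intro mult_left_mono mult_right_mono A) auto
    also have "\<dots> = ennreal D * (\<integral>\<^sup>+y. ennreal (norm (h y) powr r) \<partial>lborel)"
      using A C by (simp add: D_def ennreal_mult mult.assoc)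
    finally show "(\<integral>\<^sup>+\<omega>. \<integral>\<^sup>+x. ennreal_rpow (ennreal (norm (stft_fun g h x \<omega>))) r \<partial>lborel \<partial>lborel)
      \<le> ennreal D * (\<integral>\<^sup>+x. ennreal_rpow (ennreal (norm (h x))) r \<partial>lborel)"
      by (simp add: v_def)
  qed
qed

text \<open>For each single \<omega> and every p, including \<infinity>. The choice N = 0 gives a
  bound uniform in \<omega>, a large N gives the decay beyond 2^j.\<close>

lemma stft_pointwise_bound:
  fixes \<phi> g :: "'a::euclidean_space \<Rightarrow> complex"
  assumes \<phi>: "dyadic_cutoff \<phi>" and g: "g \<in> schwartz" and p: "1 \<le> p"
  shows "\<exists>C>0. \<forall>h f j \<omega>. represents h (littlewood_paley \<phi> j f) \<longrightarrow>
    Lp_fun p (\<lambda>x. stft_fun g h x \<omega>)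
      \<le> ennreal (C * (2 ^ j / (1 + norm \<omega>)) ^ N) * Lp_fun p h"
proof -
  obtain C where C: "C > 0" "\<And>j \<omega>. L1_norm (stft_kernel \<phi> g j \<omega>) \<le> C * (2 ^ j / (1 + norm \<omega>)) ^ N"
    using stft_kernel_L1_bound[OF \<phi> g, of N] by blast
  show ?thesis
  proof (intro exI[of _ C] conjI allI impI C(1))
    fix h f j \<omega> assume h: "represents h (littlewood_paley \<phi> j f)"
    note [measurable] = represents_measurable[OF h]
    define k where "k = stft_kernel \<phi> g j \<omega>"
    have k: "k \<in> schwartz" unfolding k_def by (rule stft_kernel_schwartz[OF \<phi> g])
    note [measurable] = schwartz_measurable[OF k]
    have meas: "(\<lambda>(x, \<omega>). stft_fun g h x \<omega>) \<in> borel_measurable (borel \<Otimes>\<^sub>M borel)"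
      by (rule borel_measurable_stft_fun[OF g]) measurable
    have "(\<integral>\<^sup>+x. ennreal (norm (k x)) \<partial>lborel) = ennreal (L1_norm k)"
      unfolding L1_norm_def by (intro nn_integral_eq_integral integrable_norm schwartz_integrable k) auto
    also have "\<dots> \<le> ennreal (C * (2 ^ j / (1 + norm \<omega>)) ^ N)"
      unfolding k_def by (intro ennreal_leI C)
    finally have kc: "(\<integral>\<^sup>+x. ennreal (norm (k x)) \<partial>lborel) \<le> ennreal (C * (2 ^ j / (1 + norm \<omega>)) ^ N)" .
    have "Lp_fun p (\<lambda>x. stft_fun g h x \<omega>)
      \<le> Lp_norm p lborel (\<lambda>x. \<integral>\<^sup>+y. ennreal (norm (k (y - x))) * ennreal (norm (h y)) \<partial>lborel)"
      unfolding k_def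
    proof (rule Lp_norm_mono[OF p _ norm_stft_fun_le_kernel[OF \<phi> g h]])
      show "(\<lambda>x. ennreal (norm (stft_fun g h x \<omega>))) \<in> borel_measurable lborel"
        using measurable_compose[OF measurable_Pair1' meas, of \<omega>]
          measurable_compose[OF measurable_Pair2'[of \<omega> borel borel] meas] by simp
    qed
    also have "\<dots> \<le> ennreal (C * (2 ^ j / (1 + norm \<omega>)) ^ N) * Lp_fun p h"
      using C(1) by (intro Lp_norm_convolution_le[where K = "\<lambda>x. ennreal (norm (k x))"] p kc) auto
    finally show "Lp_fun p (\<lambda>x. stft_fun g h x \<omega>)
      \<le> ennreal (C * (2 ^ j / (1 + norm \<omega>)) ^ N) * Lp_fun p h" .
  qed
qed

section \<open>From the dyadic pieces to the embedding\<close>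

text \<open>Passes an estimate for every representing function to \<open>distr_Lp_norm\<close>.
  Thanks to c > 0 it is also right for empty S, where the infimum is \<open>top\<close>.\<close>

lemma le_cmult_INF:
  fixes X :: ennreal
  assumes c: "c > 0" and le: "\<And>h. h \<in> S \<Longrightarrow> X \<le> ennreal c * L h"
  shows "X \<le> ennreal c * (INF h\<in>S. L h)"
proof -
  have cc: "ennreal (1 / c) * ennreal c = 1" "ennreal c * ennreal (1 / c) = 1"
    using c by (simp_all flip: ennreal_mult)
  have "ennreal (1 / c) * X \<le> (INF h\<in>S. L h)"
  proof (rule INF_greatest)
    fix h assume "h \<in> S"
    from mult_left_mono[OF le[OF this], of "ennreal (1 / c)"]
    show "ennreal (1 / c) * X \<le> L h" by (simp only: mult.assoc[symmetric] cc mult_1 zero_le)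
  qed
  from mult_left_mono[OF this, of "ennreal c"]
  show ?thesis by (simp only: mult.assoc[symmetric] cc mult_1 zero_le)
qed

text \<open>From y \<ge> 2^(j (1 + \<delta>)) follows 2^j \<le> y^(1 / (1 + \<delta>)), so the ratio
  is at most y^(- \<delta> / (1 + \<delta>)). This negative power, raised to M, reaches order k;
  with \<delta> = 0 there would be no decay at all.\<close>

lemma tail_weight_le:
  fixes y \<delta> :: real
  assumes \<delta>: "\<delta> > 0" and M: "real k * (1 + \<delta>) \<le> real M * \<delta>" and y: "2 powr (real j * (1 + \<delta>)) \<le> y" and y1: "1 \<le> y"
  shows "(2 ^ j / y) ^ M \<le> 1 / y ^ k"
proof -
  have "(2::real) ^ j = (2 powr (real j * (1 + \<delta>))) powr (1 / (1 + \<delta>))"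
    using \<delta> by (simp add: powr_powr powr_realpow)
  also have "\<dots> \<le> y powr (1 / (1 + \<delta>))"
    using y \<delta> by (intro powr_mono2) auto
  finally have "2 ^ j / y \<le> y powr (1 / (1 + \<delta>)) / y powr 1"
    using y1 by (simp add: divide_right_mono)
  also have "\<dots> = y powr (1 / (1 + \<delta>) - 1)" by (rule powr_diff[symmetric])
  also have "1 / (1 + \<delta>) - 1 = - \<delta> / (1 + \<delta>)" using \<delta> by (simp add: field_simps)
  finally have "(2 ^ j / y) ^ M \<le> (y powr (- \<delta> / (1 + \<delta>))) ^ M"
    using y1 by (intro power_mono) auto
  also have "\<dots> = y powr (- (real M * \<delta>) / (1 + \<delta>))"
    using y1 by (simp add: powr_realpow[symmetric] powr_powr mult.commute)
  also have "\<dots> \<le> y powr (- real k)"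
    using y1 M \<delta> by (intro powr_mono) (auto simp: field_simps)
  also have "\<dots> = 1 / y ^ k"
    using y1 by (simp add: powr_minus powr_realpow divide_inverse)
  finally show ?thesis .
qed

definition weight_integral :: "'a::euclidean_space itself \<Rightarrow> real" where
  "weight_integral _ = (\<integral>x. 1 / (1 + norm (x::'a)) ^ (2 * DIM('a)) \<partial>lborel)"

lemma weight_integral_nonneg: "0 \<le> weight_integral TYPE('a::euclidean_space)"
  unfolding weight_integral_def by (intro integral_nonneg_AE) auto

lemma nn_integral_weight:
  "(\<integral>\<^sup>+x. ennreal (1 / (1 + norm (x::'a::euclidean_space)) ^ (2 * DIM('a))) \<partial>lborel) = ennreal (weight_integral TYPE('a))"
  unfolding weight_integral_def by (intro nn_integral_eq_integral integrable_weight) auto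

text \<open>Hoelder's inequality on the ball of radius R, the pointwise bound outside. K is fixed
  before N, \<Lambda> and R, which later are the x-norm of the transform, the norm of a piece, and a
  power of 2^j.\<close>

lemma Lp_norm_le_split:
  fixes N :: "'a::euclidean_space \<Rightarrow> ennreal"
  assumes r: "2 \<le> r" and q: "q = r / (r - 1)" and K: "K1 > 0" "K2 > 0"
  shows "\<exists>K>0. \<forall>N \<Lambda> R. N \<in> borel_measurable borel \<longrightarrow> 1 \<le> R \<longrightarrow>
    (\<integral>\<^sup>+\<omega>. ennreal_rpow (N \<omega>) r \<partial>lborel) \<le> ennreal K1 * ennreal_rpow \<Lambda> r \<longrightarrow>
    (\<forall>\<omega>::'a. R < norm \<omega> \<longrightarrow> N \<omega> \<le> ennreal (K2 * (1 / (1 + norm \<omega>) ^ (2 * DIM('a)))) * \<Lambda>) \<longrightarrow>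
    Lp_norm (ennreal q) lborel N \<le> ennreal (K * R powr (real DIM('a) * (1 / q - 1 / r))) * \<Lambda>"
proof -
  have q1: "1 < q" "q \<le> r" using r by (auto simp: q field_simps)
  define t where "t = r / q"
  have t: "1 \<le> t" "t > 0" using q1 by (simp_all add: t_def)
  define d where "d = DIM('a)"
  define V where "V = unit_ball_vol (real d)"
  have V: "V > 0" by (simp add: V_def)
  define W where "W = weight_integral TYPE('a)"
  have W: "W \<ge> 0" unfolding W_def by (rule weight_integral_nonneg)
  define E where "E = V powr (1 - q / r) * K1 powr (q / r) + K2 powr q * W"
  have E: "E > 0" unfolding E_def using V K W by (intro add_pos_nonneg) auto
  show ?thesis
  proof (intro exI[of _ "E powr (1 / q)"] conjI allI impI)
    show "E powr (1 / q) > 0" using E by simp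
    fix N :: "'a \<Rightarrow> ennreal" and \<Lambda> and R :: real
    assume [measurable]: "N \<in> borel_measurable borel" and R: "1 \<le> R"
      and main: "(\<integral>\<^sup>+\<omega>. ennreal_rpow (N \<omega>) r \<partial>lborel) \<le> ennreal K1 * ennreal_rpow \<Lambda> r"
      and tail: "\<forall>\<omega>::'a. R < norm \<omega> \<longrightarrow> N \<omega> \<le> ennreal (K2 * (1 / (1 + norm \<omega>) ^ (2 * DIM('a)))) * \<Lambda>"
    define B where "B = cball (0::'a) R"
    define c where "c = V * R ^ d"
    have c: "c > 0" using V R by (simp add: c_def)
    define I1 where "I1 = (\<integral>\<^sup>+\<omega>. indicator B \<omega> * ennreal_rpow (N \<omega>) q \<partial>lborel)"
    define I2 where "I2 = (\<integral>\<^sup>+\<omega>. indicator (- B) \<omega> * ennreal_rpow (N \<omega>) q \<partial>lborel)"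
    have [measurable]: "B \<in> sets borel" by (simp add: B_def)
    \<comment> \<open>Jensen with the indicator of the ball as weight and exponent t = r / q; its
      mass c = V R^d is the source of the power of R.\<close>
    have "ennreal_rpow I1 t \<le> ennreal (c powr (t - 1)) *
        (\<integral>\<^sup>+\<omega>. indicator B \<omega> * ennreal_rpow (ennreal_rpow (N \<omega>) q) t \<partial>lborel)"
      unfolding I1_def
    proof (rule nn_integral_rpow_jensen[OF t(1)])
      show "(\<integral>\<^sup>+\<omega>. indicator B \<omega> \<partial>lborel) \<le> ennreal c"
        using R by (simp add: B_def emeasure_cball c_def V_def d_def)
    qed (use c in auto)
    also have "\<dots> \<le> ennreal (c powr (t - 1)) * (\<integral>\<^sup>+\<omega>. ennreal_rpow (N \<omega>) r \<partial>lborel)"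
      using q1 by (intro mult_left_mono nn_integral_mono)
        (auto simp: ennreal_rpow_rpow t_def indicator_def)
    also have "\<dots> \<le> ennreal (c powr (t - 1)) * (ennreal K1 * ennreal_rpow \<Lambda> r)"
      by (intro mult_left_mono main) auto
    finally have "ennreal_rpow (ennreal_rpow I1 t) (1 / t)
      \<le> ennreal_rpow (ennreal (c powr (t - 1)) * (ennreal K1 * ennreal_rpow \<Lambda> r)) (1 / t)"
      using t by (intro ennreal_rpow_mono) auto
    then have "I1 \<le> ennreal ((c powr (t - 1)) powr (1 / t)) * (ennreal (K1 powr (1 / t)) * ennreal_rpow \<Lambda> (r * (1 / t)))"
      using t K by (simp only: ennreal_rpow_rpow ennreal_rpow_mult ennreal_rpow_ennreal powr_ge_zero less_imp_le) (simp)
    moreover have "r * (1 / t) = q" "1 / t = q / r" using q1 r by (auto simp: t_def)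
    moreover have "(c powr (t - 1)) powr (1 / t) = V powr (1 - q / r) * R powr (real d * (1 - q / r))"
    proof -
      have "(t - 1) * (1 / t) = 1 - q / r" using q1 r by (simp add: t_def field_simps)
      then have "(c powr (t - 1)) powr (1 / t) = c powr (1 - q / r)" by (simp only: powr_powr)
      also have "\<dots> = V powr (1 - q / r) * (R ^ d) powr (1 - q / r)"
        using V R by (simp add: c_def powr_mult)
      also have "(R ^ d) powr (1 - q / r) = R powr (real d * (1 - q / r))"
        using R by (simp add: powr_realpow[symmetric] powr_powr)
      finally show ?thesis .
    qed
    ultimately have I1: "I1 \<le> ennreal (V powr (1 - q / r) * R powr (real d * (1 - q / r)) * K1 powr (q / r)) * ennreal_rpow \<Lambda> q"
      by (simp add: ennreal_mult mult.assoc)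
    have "I2 \<le> (\<integral>\<^sup>+\<omega>. ennreal (K2 powr q) * ennreal (1 / (1 + norm (\<omega>::'a)) ^ (2 * d)) * ennreal_rpow \<Lambda> q \<partial>lborel)"
      unfolding I2_def
    proof (rule nn_integral_mono)
      fix \<omega> :: 'a
      define w where "w = 1 / (1 + norm \<omega>) ^ (2 * d)"
      have w: "0 < w" "w \<le> 1" by (auto simp: w_def add_pos_nonneg divide_le_eq_1 intro!: one_le_power zero_less_power)
      have "ennreal_rpow (N \<omega>) q \<le> ennreal (K2 powr q) * ennreal w * ennreal_rpow \<Lambda> q" if "R < norm \<omega>"
      proof -
        have "ennreal_rpow (N \<omega>) q \<le> ennreal_rpow (ennreal (K2 * w) * \<Lambda>) q"
          using tail that q1 by (intro ennreal_rpow_mono) (auto simp: w_def d_def)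
        also have "\<dots> = ennreal (K2 powr q * w powr q) * ennreal_rpow \<Lambda> q"
          using K w by (simp add: ennreal_rpow_mult powr_mult)
        \<comment> \<open>As w \<le> 1 and q > 1, the q-th power of the weight is dominated by the
          weight itself, which is integrable.\<close>
        also have "w powr q \<le> w powr 1" using w q1 by (intro powr_mono') auto
        then have "ennreal (K2 powr q * w powr q) * ennreal_rpow \<Lambda> q \<le> ennreal (K2 powr q * w) * ennreal_rpow \<Lambda> q"
          using w by (intro mult_right_mono ennreal_leI mult_left_mono) auto
        finally show ?thesis using w by (simp add: ennreal_mult)
      qed
      then show "indicator (- B) \<omega> * ennreal_rpow (N \<omega>) q \<le>
        ennreal (K2 powr q) * ennreal (1 / (1 + norm \<omega>) ^ (2 * d)) * ennreal_rpow \<Lambda> q"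
        unfolding w_def[symmetric] by (auto simp: indicator_def B_def)
    qed
    also have "\<dots> = ennreal (K2 powr q) * ennreal W * ennreal_rpow \<Lambda> q"
      unfolding d_def W_def by (simp add: nn_integral_multc nn_integral_cmult nn_integral_weight)
    also have "\<dots> = ennreal (K2 powr q * W) * ennreal_rpow \<Lambda> q"
      using W by (simp add: ennreal_mult)
    finally have I2: "I2 \<le> ennreal (K2 powr q * W) * ennreal_rpow \<Lambda> q" .
    have "(\<integral>\<^sup>+\<omega>. ennreal_rpow (N \<omega>) q \<partial>lborel) = I1 + I2"
      unfolding I1_def I2_def by (subst nn_integral_add[symmetric]) (auto intro!: nn_integral_cong simp: indicator_def)
    also have "\<dots> \<le> ennreal (V powr (1 - q / r) * R powr (real d * (1 - q / r)) * K1 powr (q / r)) * ennreal_rpow \<Lambda> q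
        + ennreal (K2 powr q * W) * ennreal_rpow \<Lambda> q"
      by (rule add_mono[OF I1 I2])
    also have "\<dots> = ennreal (V powr (1 - q / r) * R powr (real d * (1 - q / r)) * K1 powr (q / r) + K2 powr q * W) * ennreal_rpow \<Lambda> q"
      using W by (simp add: distrib_right[symmetric] ennreal_plus)
    also have "\<dots> \<le> ennreal (E * R powr (real d * (1 - q / r))) * ennreal_rpow \<Lambda> q"
    proof (intro mult_right_mono ennreal_leI)
      \<comment> \<open>The tail term has no power of R; since R \<ge> 1 and q \<le> r it can be
        given one.\<close>
      have "1 \<le> R powr (real d * (1 - q / r))"
        using R q1 by (intro ge_one_powr_ge_zero) auto
      then have "K2 powr q * W * 1 \<le> K2 powr q * W * R powr (real d * (1 - q / r))"
        using W by (intro mult_left_mono) auto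
      then show "V powr (1 - q / r) * R powr (real d * (1 - q / r)) * K1 powr (q / r) + K2 powr q * W
        \<le> E * R powr (real d * (1 - q / r))"
        unfolding E_def distrib_right by (intro add_mono) (simp_all add: mult_ac)
    qed simp
    finally have "ennreal_rpow (\<integral>\<^sup>+\<omega>. ennreal_rpow (N \<omega>) q \<partial>lborel) (1 / q)
      \<le> ennreal_rpow (ennreal (E * R powr (real d * (1 - q / r))) * ennreal_rpow \<Lambda> q) (1 / q)"
      using q1 by (intro ennreal_rpow_mono) auto
    also have "\<dots> = ennreal (E powr (1 / q) * R powr (real d * (1 - q / r) * (1 / q))) * \<Lambda>"
      using q1 E by (simp add: ennreal_rpow_mult ennreal_rpow_rpow powr_mult powr_powr)
    also have "real d * (1 - q / r) * (1 / q) = real DIM('a) * (1 / q - 1 / r)"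
      using q1 r by (simp add: d_def field_simps)
    finally show "Lp_norm (ennreal q) lborel N \<le> ennreal (E powr (1 / q) * R powr (real DIM('a) * (1 / q - 1 / r))) * \<Lambda>"
      using q1 by (simp add: Lp_norm_real)
  qed
qed

lemma borel_measurable_norm_stft_fun:
  assumes g: "g \<in> schwartz" and h: "h \<in> borel_measurable borel"
  shows "(\<lambda>(\<omega>, x). ennreal (norm (stft_fun g h x \<omega>))) \<in> borel_measurable (borel \<Otimes>\<^sub>M borel)"
proof -
  note [measurable] = borel_measurable_stft_fun[OF g h]
  show ?thesis by measurable
qed

text \<open>The majorant \<open>b\<close> is needed for \<open>p = \<infinity>\<close>, where the measurability of the essential supremum in \<open>x\<close> is not available.\<close>

definition dyadic_bound ::
  "('a::euclidean_space \<Rightarrow> complex) \<Rightarrow> ('a \<Rightarrow> complex) \<Rightarrow> ennreal \<Rightarrow> ennreal \<Rightarrow> real \<Rightarrow> real \<Rightarrow> bool" where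
  "dyadic_bound \<phi> g p p' C s0 \<longleftrightarrow> (\<forall>f j. (\<exists>h. represents h (littlewood_paley \<phi> j f)) \<longrightarrow>
    (\<exists>b\<in>borel_measurable borel.
      (\<forall>\<omega>. Lp_fun p (\<lambda>x. stft g (littlewood_paley \<phi> j f) x \<omega>) \<le> b \<omega>) \<and>
      Lp_norm p' lborel b \<le> ennreal (C * 2 powr (real j * s0)) * distr_Lp_norm p (littlewood_paley \<phi> j f)))"

lemma borel_measurable_Lp_norm_stft:
  assumes g: "g \<in> schwartz" and h: "represents h (f :: 'a::euclidean_space distr)" and p: "1 \<le> p" "p \<noteq> top"
  shows "(\<lambda>\<omega>. Lp_fun p (\<lambda>x. stft g f x \<omega>)) \<in> borel_measurable borel"
proof -
  have "(\<lambda>(\<omega>, x). ennreal (norm (stft_fun g h x \<omega>))) \<in> borel_measurable (borel \<Otimes>\<^sub>M lborel)"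
    using borel_measurable_norm_stft_fun[OF g represents_measurable[OF h]] by simp
  from borel_measurable_Lp_norm[OF sigma_finite_lborel p this]
  show ?thesis by (simp add: stft_represents[OF g h])
qed

text \<open>For finite p the x-norm is itself measurable in \<omega> and serves as the majorant; the
  bound, proved for every representing function, passes to the infimum.\<close>

lemma dyadic_bound_low:
  fixes g :: "'a::euclidean_space \<Rightarrow> complex"
  assumes g: "g \<in> schwartz" and p: "1 \<le> p" "p \<le> 2" and pp: "1 / p + 1 / p' = 1"
  shows "\<exists>C>0. dyadic_bound \<phi> g p p' C 0"
proof -
  obtain C where C: "C > 0" "\<And>h f. represents h (f :: 'a distr) \<Longrightarrow>
    Lp_norm p' lborel (\<lambda>\<omega>. Lp_fun p (\<lambda>x. stft_fun g h x \<omega>))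
      \<le> ennreal C * Lp_fun p h"
    using stft_bound_low[OF g p pp] by blast
  have pt: "p \<noteq> top" using p by (auto simp: top_unique)
  show ?thesis
    unfolding dyadic_bound_def
  proof (intro exI[of _ C] conjI allI impI C(1))
    fix f j assume "\<exists>h. represents h (littlewood_paley \<phi> j f)"
    then obtain h where h: "represents h (littlewood_paley \<phi> j f)" by blast
    define T where "T = littlewood_paley \<phi> j f"
    show "\<exists>b\<in>borel_measurable borel. (\<forall>\<omega>. Lp_fun p (\<lambda>x. stft g (littlewood_paley \<phi> j f) x \<omega>) \<le> b \<omega>) \<and>
      Lp_norm p' lborel b \<le> ennreal (C * 2 powr (real j * 0)) * distr_Lp_norm p (littlewood_paley \<phi> j f)"
      unfolding T_def[symmetric] distr_Lp_norm_def
    proof (intro bexI[of _ "\<lambda>\<omega>. Lp_fun p (\<lambda>x. stft g T x \<omega>)"] conjI allI le_cmult_INF)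
      fix k assume "k \<in> {h. represents h T}"
      then have k: "represents k T" by simp
      show "Lp_norm p' lborel (\<lambda>\<omega>. Lp_fun p (\<lambda>x. stft g T x \<omega>))
        \<le> ennreal (C * 2 powr (real j * 0)) * Lp_fun p k"
        using C(2)[OF k] by (simp add: stft_represents[OF g k])
    qed (use C borel_measurable_Lp_norm_stft[OF g h p(1) pt] in \<open>auto simp: T_def\<close>)
  qed
qed

lemma exponent_room:
  fixes D s :: real
  assumes "0 \<le> D" "D < s"
  obtains \<delta> where "\<delta> > 0" "(1 + \<delta>) * D < s"
\<comment> \<open>Dividing by D + 1 instead of D admits D = 0, which occurs at p = 2.\<close>
proof (rule that[of "(s - D) / (D + 1)"])
  show "(s - D) / (D + 1) > 0" using assms by simp
  have "(s - D) * D < (s - D) * (D + 1)" using assms by simp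
  then have "(s - D) / (D + 1) * D < s - D" using assms by (simp add: field_simps)
  then show "(1 + (s - D) / (D + 1)) * D < s" by (simp add: distrib_right)
qed

lemma dyadic_bound_high:
  fixes g :: "'a::euclidean_space \<Rightarrow> complex"
  assumes \<phi>: "dyadic_cutoff \<phi>" and g: "g \<in> schwartz" and p: "2 \<le> p" and pp: "1 / p + 1 / p' = 1"
    and s: "s > real DIM('a) * (enn2real (1 / p') - enn2real (1 / p))"
  shows "\<exists>C>0. \<exists>s0<s. dyadic_bound \<phi> g p p' C s0"
proof -
  have p1: "1 \<le> p" using p by (rule order_trans[rotated]) simp
  define D where "D = real DIM('a) * (enn2real (1 / p') - enn2real (1 / p))"
  have D0: "0 \<le> D"
    using p1 pp
  proof (cases rule: conjugate_exponent_cases)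
    case (real r)
    then have r2: "2 \<le> r" using p by (simp flip: ennreal_numeral)
    have "1 / p = ennreal (1 / r)" "1 / p' = ennreal (1 / (r / (r - 1)))"
      using real divide_ennreal[of 1 r] divide_ennreal[of 1 "r / (r - 1)"] by simp_all
    then show ?thesis using r2 by (simp add: D_def field_simps)
  qed (use p in \<open>auto simp: D_def\<close>)
  obtain \<delta> where \<delta>: "\<delta> > 0" "(1 + \<delta>) * D < s"
    using exponent_room[OF D0] s unfolding D_def by blast
  \<comment> \<open>Enough decay for \<open>tail_weight_le\<close> with k = 2 d, the order at which
    \<open>integrable_weight\<close> applies.\<close>
  obtain M :: nat where M: "real (2 * DIM('a)) * (1 + \<delta>) / \<delta> \<le> real M"
    using real_arch_simple by blast
  then have M: "real (2 * DIM('a)) * (1 + \<delta>) \<le> real M * \<delta>"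
    using \<delta> by (simp add: pos_divide_le_eq)
  obtain K2 where K2: "K2 > 0" "\<And>h f j \<omega>. represents h (littlewood_paley \<phi> j f) \<Longrightarrow>
    Lp_fun p (\<lambda>x. stft_fun g h x \<omega>)
      \<le> ennreal (K2 * (2 ^ j / (1 + norm \<omega>)) ^ M) * Lp_fun p h"
    using stft_pointwise_bound[OF \<phi> g p1, of M] by blast
  define R where "R j = 2 powr (real j * (1 + \<delta>))" for j :: nat
  have R: "1 \<le> R j" for j unfolding R_def using \<delta> by (intro ge_one_powr_ge_zero) auto
  have tail: "Lp_fun p (\<lambda>x. stft_fun g h x \<omega>)
      \<le> ennreal (K2 * (1 / (1 + norm \<omega>) ^ (2 * DIM('a)))) * Lp_fun p h"
    if "represents h (littlewood_paley \<phi> j f)" "R j < norm \<omega>" for h f j \<omega>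
  proof (rule order_trans[OF K2(2)[OF that(1)]])
    have "(2 ^ j / (1 + norm \<omega>)) ^ M \<le> 1 / (1 + norm \<omega>) ^ (2 * DIM('a))"
      using that(2) by (intro tail_weight_le[OF \<delta>(1) M]) (auto simp: R_def)
    then show "ennreal (K2 * (2 ^ j / (1 + norm \<omega>)) ^ M) * Lp_fun p h
      \<le> ennreal (K2 * (1 / (1 + norm \<omega>) ^ (2 * DIM('a)))) * Lp_fun p h"
      using K2 by (intro mult_right_mono ennreal_leI mult_left_mono) auto
  qed
  have RD: "R j powr D = 2 powr (real j * ((1 + \<delta>) * D))" for j
    by (simp add: R_def powr_powr mult.assoc)
  have "\<exists>C>0. dyadic_bound \<phi> g p p' C ((1 + \<delta>) * D)"
    using p1 pp
  proof (cases rule: conjugate_exponent_cases)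
    case one
    then show ?thesis using p by simp
  next
    case (real r)
    have r: "2 \<le> r" using p real by (simp flip: ennreal_numeral)
    define q where "q = r / (r - 1)"
    have "1 / p = ennreal (1 / r)" "1 / p' = ennreal (1 / q)"
      using real divide_ennreal[of 1 r] divide_ennreal[of 1 q] by (simp_all add: q_def)
    then have Dq: "D = real DIM('a) * (1 / q - 1 / r)" using r by (simp add: D_def q_def)
    obtain K1 where K1: "K1 > 0" "\<And>h f. represents h (f :: 'a distr) \<Longrightarrow>
      (\<integral>\<^sup>+\<omega>. \<integral>\<^sup>+x. ennreal_rpow (ennreal (norm (stft_fun g h x \<omega>))) r \<partial>lborel \<partial>lborel)
      \<le> ennreal K1 * (\<integral>\<^sup>+x. ennreal_rpow (ennreal (norm (h x))) r \<partial>lborel)"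
      using stft_bound_diagonal[OF g r] by blast
    obtain C where C: "C > 0" "\<And>N \<Lambda> R. N \<in> borel_measurable borel \<Longrightarrow> 1 \<le> R \<Longrightarrow>
      (\<integral>\<^sup>+\<omega>. ennreal_rpow (N \<omega>) r \<partial>lborel) \<le> ennreal K1 * ennreal_rpow \<Lambda> r \<Longrightarrow>
      (\<And>\<omega>::'a. R < norm \<omega> \<Longrightarrow> N \<omega> \<le> ennreal (K2 * (1 / (1 + norm \<omega>) ^ (2 * DIM('a)))) * \<Lambda>) \<Longrightarrow>
      Lp_norm (ennreal q) lborel N \<le> ennreal (C * R powr D) * \<Lambda>"
      using Lp_norm_le_split[OF r q_def K1(1) K2(1), where 'a = 'a] unfolding Dq by blast
    show ?thesis
      unfolding dyadic_bound_def
    proof (intro exI[of _ C] conjI allI impI C(1))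
      fix f j assume "\<exists>h. represents h (littlewood_paley \<phi> j f)"
      then obtain h where h: "represents h (littlewood_paley \<phi> j f)" by blast
      define T where "T = littlewood_paley \<phi> j f"
      have meas: "(\<lambda>\<omega>. Lp_fun p (\<lambda>x. stft g T x \<omega>)) \<in> borel_measurable borel"
        unfolding T_def using real by (intro borel_measurable_Lp_norm_stft[OF g h p1]) auto
      show "\<exists>b\<in>borel_measurable borel. (\<forall>\<omega>. Lp_fun p (\<lambda>x. stft g (littlewood_paley \<phi> j f) x \<omega>) \<le> b \<omega>) \<and>
        Lp_norm p' lborel b \<le> ennreal (C * 2 powr (real j * ((1 + \<delta>) * D))) * distr_Lp_norm p (littlewood_paley \<phi> j f)"
        unfolding T_def[symmetric] distr_Lp_norm_def
      proof (intro bexI[of _ "\<lambda>\<omega>. Lp_fun p (\<lambda>x. stft g T x \<omega>)"] conjI allI le_cmult_INF meas)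
        fix k assume "k \<in> {h. represents h T}"
        then have k: "represents k T" by simp
        define N where "N \<omega> = Lp_fun p (\<lambda>x. stft_fun g k x \<omega>)" for \<omega>
        have N: "N \<in> borel_measurable borel"
          using meas by (simp add: N_def[abs_def] stft_represents[OF g k])
        have "(\<integral>\<^sup>+\<omega>. ennreal_rpow (N \<omega>) r \<partial>lborel) \<le> ennreal K1 * ennreal_rpow (Lp_fun p k) r"
          using K1(2)[OF k] r by (simp add: N_def real(1) Lp_norm_real ennreal_rpow_rpow)
        moreover have "N \<omega> \<le> ennreal (K2 * (1 / (1 + norm \<omega>) ^ (2 * DIM('a)))) * Lp_fun p k"
          if "R j < norm \<omega>" for \<omega>
          unfolding N_def using tail[OF _ that] k by (simp add: T_def)
        ultimately have "Lp_norm (ennreal q) lborel N \<le> ennreal (C * R j powr D) * Lp_fun p k"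
          by (rule C(2)[OF N R])
        then show "Lp_norm p' lborel (\<lambda>\<omega>. Lp_fun p (\<lambda>x. stft g T x \<omega>))
          \<le> ennreal (C * 2 powr (real j * ((1 + \<delta>) * D))) * Lp_fun p k"
          by (simp only: RD stft_represents[OF g k] N_def[abs_def] real(3) q_def)
      qed (use C in auto)
    qed
  next
    \<comment> \<open>Here p' = 1 and D = d: a uniform bound on the ball times its volume, of order
      R^d, plus the integrable weight outside; Hausdorff--Young does not enter.\<close>
    case top
    have Dd: "D = real DIM('a)" by (simp add: D_def top)
    obtain K0 where K0: "K0 > 0" "\<And>h f j \<omega>. represents h (littlewood_paley \<phi> j f) \<Longrightarrow>
      Lp_fun p (\<lambda>x. stft_fun g h x \<omega>)
      \<le> ennreal (K0 * (2 ^ j / (1 + norm \<omega>)) ^ 0) * Lp_fun p h"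
      using stft_pointwise_bound[OF \<phi> g p1, of 0] by blast
    define V where "V = unit_ball_vol (real DIM('a))"
    have V: "V > 0" by (simp add: V_def)
    define W where "W = weight_integral TYPE('a)"
    have W: "W \<ge> 0" unfolding W_def by (rule weight_integral_nonneg)
    define C where "C = K0 * V + K2 * W"
    have C: "C > 0" unfolding C_def using K0 K2 V W by (intro add_pos_nonneg) auto
    show ?thesis
      unfolding dyadic_bound_def
    proof (intro exI[of _ C] conjI allI impI C)
      fix f j assume "\<exists>h. represents h (littlewood_paley \<phi> j f)"
      define T where "T = littlewood_paley \<phi> j f"
      define \<Lambda> where "\<Lambda> = distr_Lp_norm p T"
      define B where "B = cball (0::'a) (R j)"
      have [measurable]: "B \<in> sets borel" by (simp add: B_def)
      \<comment> \<open>The bounds inside and outside the ball in one explicitly measurable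
        function. It uses the infimum \<Lambda>, so it does not depend on a choice of
        representative.\<close>
      define b where "b \<omega> = ennreal K0 * \<Lambda> * indicator B \<omega> + ennreal K2 * \<Lambda> * ennreal (1 / (1 + norm \<omega>) ^ (2 * DIM('a)))" for \<omega> :: 'a
      have b: "b \<in> borel_measurable borel" unfolding b_def by measurable
      have le: "Lp_fun p (\<lambda>x. stft g T x \<omega>) \<le> b \<omega>" for \<omega>
      proof (cases "\<omega> \<in> B")
        case True
        have "Lp_fun p (\<lambda>x. stft g T x \<omega>) \<le> ennreal K0 * \<Lambda>"
          unfolding \<Lambda>_def distr_Lp_norm_def
        proof (rule le_cmult_INF[OF K0(1)])
          fix k assume "k \<in> {h. represents h T}"
          then show "Lp_fun p (\<lambda>x. stft g T x \<omega>) \<le> ennreal K0 * Lp_fun p k"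
            using K0(2)[of k j f \<omega>] by (simp add: T_def stft_represents[OF g])
        qed
        also have "\<dots> \<le> b \<omega>" using True by (simp add: b_def)
        finally show ?thesis .
      next
        case False
        then have out: "R j < norm \<omega>" by (simp add: B_def)
        have pos: "K2 * (1 / (1 + norm \<omega>) ^ (2 * DIM('a))) > 0"
          using K2 by (simp add: add_pos_nonneg)
        have "Lp_fun p (\<lambda>x. stft g T x \<omega>) \<le> ennreal (K2 * (1 / (1 + norm \<omega>) ^ (2 * DIM('a)))) * \<Lambda>"
          unfolding \<Lambda>_def distr_Lp_norm_def
        proof (rule le_cmult_INF[OF pos])
          fix k assume "k \<in> {h. represents h T}"
          then have k: "represents k T" by simp
          show "Lp_fun p (\<lambda>x. stft g T x \<omega>)
            \<le> ennreal (K2 * (1 / (1 + norm \<omega>) ^ (2 * DIM('a)))) * Lp_fun p k"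
            using tail[OF k[unfolded T_def] out] unfolding stft_represents[OF g k] .
        qed
        also have "\<dots> = b \<omega>"
        proof -
          have "ennreal (K2 * (1 / (1 + norm \<omega>) ^ (2 * DIM('a)))) = ennreal K2 * ennreal (1 / (1 + norm \<omega>) ^ (2 * DIM('a)))"
            using K2(1) by (intro ennreal_mult) auto
          then have "ennreal (K2 * (1 / (1 + norm \<omega>) ^ (2 * DIM('a)))) * \<Lambda>
            = ennreal K2 * \<Lambda> * ennreal (1 / (1 + norm \<omega>) ^ (2 * DIM('a)))"
            by (simp only: mult_ac)
          then show ?thesis using False by (simp only: b_def indicator_def of_bool_eq mult_zero_right add_0)
        qed
        finally show ?thesis .
      qed
      have "Lp_norm p' lborel b = (\<integral>\<^sup>+\<omega>. b \<omega> \<partial>lborel)"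
        using Lp_norm_real[of 1 lborel b] top by simp
      also have "\<dots> = ennreal K0 * \<Lambda> * emeasure lborel B + ennreal K2 * \<Lambda> * ennreal W"
        unfolding b_def W_def
        by (subst nn_integral_add) (auto simp: nn_integral_cmult nn_integral_cmult_indicator nn_integral_weight)
      also have "emeasure lborel B = ennreal (V * R j ^ DIM('a))"
        using R[of j] by (simp add: B_def emeasure_cball V_def)
      also have "ennreal K0 * \<Lambda> * ennreal (V * R j ^ DIM('a)) + ennreal K2 * \<Lambda> * ennreal W
        = ennreal (K0 * (V * R j ^ DIM('a)) + K2 * W) * \<Lambda>"
        using K0(1) K2(1) V W R[of j] by (simp add: ennreal_plus ennreal_mult distrib_left distrib_right mult_ac)
      also have "\<dots> \<le> ennreal (C * R j powr D) * \<Lambda>"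
      proof (intro mult_right_mono ennreal_leI)
        have "1 \<le> R j ^ DIM('a)" using R by (intro one_le_power)
        then have "K2 * W * 1 \<le> K2 * W * R j ^ DIM('a)" using K2 W by (intro mult_left_mono) auto
        moreover have "R j powr D = R j ^ DIM('a)" using R[of j] by (simp add: Dd powr_realpow)
        ultimately show "K0 * (V * R j ^ DIM('a)) + K2 * W \<le> C * R j powr D"
          by (simp add: C_def distrib_right mult.assoc)
      qed simp
      finally have "Lp_norm p' lborel b \<le> ennreal (C * 2 powr (real j * ((1 + \<delta>) * D))) * \<Lambda>"
        by (simp only: RD)
      then show "\<exists>b\<in>borel_measurable borel. (\<forall>\<omega>. Lp_fun p (\<lambda>x. stft g (littlewood_paley \<phi> j f) x \<omega>) \<le> b \<omega>) \<and>
        Lp_norm p' lborel b \<le> ennreal (C * 2 powr (real j * ((1 + \<delta>) * D))) * distr_Lp_norm p (littlewood_paley \<phi> j f)"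
        unfolding T_def[symmetric] \<Lambda>_def[symmetric] using b le by blast
    qed
  qed
  then show ?thesis using \<delta> by blast
qed

section \<open>Summation of the dyadic pieces\<close>

text \<open>A sequence is bounded by its norm in any sequence space; this is all that the embedding
  takes from the summability exponent.\<close>

lemma Lp_norm_count_space_ge:
  assumes "1 \<le> q"
  shows "F j \<le> Lp_norm q (count_space UNIV) F"
  using assms
proof (cases rule: exponent_cases)
  case top
  then show ?thesis using esssup_AE[of F "count_space UNIV"] by (simp add: Lp_norm_top AE_count_space)
next
  case (real r)
  have "ennreal_rpow (ennreal_rpow (F j) r) (1 / r) \<le> ennreal_rpow (\<integral>\<^sup>+j. ennreal_rpow (F j) r \<partial>count_space UNIV) (1 / r)"
    using real by (intro ennreal_rpow_mono nn_integral_ge_point) auto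
  then show ?thesis using real by (simp add: Lp_norm_real ennreal_rpow_rpow)
qed

text \<open>The triangle inequality runs over the majorants from \<open>dyadic_bound\<close>. When
  p' = \<infinity>, the x-norm of the transform of f must itself be measurable in \<omega>; the last
  assumption on the exponents makes p finite in that case.\<close>

lemma embedding_from_dyadic_bound:
  fixes g \<phi> :: "'a::euclidean_space \<Rightarrow> complex"
  assumes \<phi>: "dyadic_cutoff \<phi>" and g: "g \<in> schwartz" and p: "1 \<le> p" "1 \<le> p'" "p' = top \<Longrightarrow> p \<noteq> top"
    and C: "C > 0" and bound: "dyadic_bound \<phi> g p p' C s0" and s: "s0 < s" and q: "1 \<le> q"
  shows "continuously_embedded (besov_space \<phi> p q s) (besov_norm \<phi> p q s)
    (modulation_space g p p') (modulation_norm g p p')"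
proof -
  \<comment> \<open>The ratio of the geometric series: the growth 2^(j s0) of the bounds measured
    against the Besov weight 2^(j s).\<close>
  define \<rho> where "\<rho> = 2 powr (s0 - s)"
  have "\<rho> < 2 powr 0" unfolding \<rho>_def using s by (intro powr_less_mono) auto
  then have \<rho>: "0 < \<rho>" "\<rho> < 1" by (simp_all add: \<rho>_def)
  define K where "K = C * (1 / (1 - \<rho>))"
  have K: "(\<Sum>j. ennreal (C * \<rho> ^ j)) = ennreal K"
    unfolding K_def using C \<rho> by (intro suminf_ennreal_eq sums_mult geometric_sums) auto
  have main: "modulation_norm g p p' f \<le> ennreal K * besov_norm \<phi> p q s f" if f: "f \<in> besov_space \<phi> p q s" for f
  proof -
    have ft: "f \<in> tempered_distributions" and fin: "besov_norm \<phi> p q s f < \<infinity>"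
      using f by (auto simp: besov_space_def)
    define B where "B = besov_norm \<phi> p q s f"
    define T where "T j = littlewood_paley \<phi> j f" for j
    have aB: "ennreal (2 powr (real j * s)) * distr_Lp_norm p (T j) \<le> B" for j
      unfolding B_def besov_norm_def T_def by (rule Lp_norm_count_space_ge[OF q])
    \<comment> \<open>A piece that is not given by a function has norm \<open>top\<close>; its
      weight is positive, so the whole Besov norm would be \<open>top\<close>.\<close>
    have "\<exists>h. represents h (T j)" for j
    proof (rule ccontr)
      assume "\<not> (\<exists>h. represents h (T j))"
      then have "distr_Lp_norm p (T j) = top" by (simp add: distr_Lp_norm_def)
      with aB[of j] have "B = top" by (simp add: ennreal_mult_top top_unique)
      with fin show False by (simp add: B_def)
    qed
    then obtain h where h: "\<And>j. represents (h j) (T j)" by metis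
    have "\<exists>b\<in>borel_measurable borel. (\<forall>\<omega>. Lp_fun p (\<lambda>x. stft g (T j) x \<omega>) \<le> b \<omega>) \<and>
      Lp_norm p' lborel b \<le> ennreal (C * 2 powr (real j * s0)) * distr_Lp_norm p (T j)" for j
      using bound h unfolding dyadic_bound_def T_def by blast
    then obtain b where b: "\<And>j. b j \<in> borel_measurable borel"
      "\<And>j \<omega>. Lp_fun p (\<lambda>x. stft g (T j) x \<omega>) \<le> b j \<omega>"
      "\<And>j. Lp_norm p' lborel (b j) \<le> ennreal (C * 2 powr (real j * s0)) * distr_Lp_norm p (T j)"
      by metis
    have sums: "(\<lambda>j. stft_fun g (h j) x \<omega>) sums stft g f x \<omega>" for x \<omega>
      using h by (intro stft_sums[OF ft \<phi> g]) (auto simp: T_def)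
    have meas_j: "(\<lambda>(\<omega>, x). stft_fun g (h j) x \<omega>) \<in> borel_measurable (borel \<Otimes>\<^sub>M borel)" for j
    proof -
      note [measurable] = borel_measurable_stft_fun[OF g represents_measurable[OF h]]
      show ?thesis by measurable
    qed
    \<comment> \<open>f itself is only a distribution; its transform is measurable as a pointwise
      limit of finite sums of transforms of functions.\<close>
    have meas: "(\<lambda>(\<omega>, x). stft g f x \<omega>) \<in> borel_measurable (borel \<Otimes>\<^sub>M borel)"
    proof (rule borel_measurable_LIMSEQ_metric)
      show "(\<lambda>z. \<Sum>j<n. case z of (\<omega>, x) \<Rightarrow> stft_fun g (h j) x \<omega>) \<in> borel_measurable (borel \<Otimes>\<^sub>M borel)" for n
        by (intro borel_measurable_sum meas_j)
      show "(\<lambda>n. \<Sum>j<n. case z of (\<omega>, x) \<Rightarrow> stft_fun g (h j) x \<omega>) \<longlonglongrightarrow> (case z of (\<omega>, x) \<Rightarrow> stft g f x \<omega>)" for z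
        using sums by (cases z) (simp add: sums_def)
    qed
    have section_meas: "(\<lambda>x. F \<omega> x) \<in> borel_measurable borel"
      if "(\<lambda>(\<omega>, x). F \<omega> x) \<in> borel_measurable (borel \<Otimes>\<^sub>M borel)" for F :: "'a \<Rightarrow> 'a \<Rightarrow> complex" and \<omega>
      using measurable_compose[OF measurable_Pair1'[of \<omega> borel borel] that] by simp
    have "modulation_norm g p p' f \<le> (\<Sum>j. Lp_norm p' lborel (b j))"
      unfolding modulation_norm_def
    proof (rule mixed_Lp_norm_suminf_le[OF sigma_finite_lborel sigma_finite_lborel p(1,2),
          where F = "\<lambda>j \<omega> x. ennreal (norm (stft g (T j) x \<omega>))"])
      show "(\<lambda>x. ennreal (norm (stft g (T j) x \<omega>))) \<in> borel_measurable lborel" for j \<omega>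
        using section_meas[OF meas_j[of j], of \<omega>] by (simp add: stft_represents[OF g h])
      show "(\<lambda>x. ennreal (norm (stft g f x \<omega>))) \<in> borel_measurable lborel" for \<omega>
        using section_meas[OF meas, of \<omega>] by simp
      show "ennreal (norm (stft g f x \<omega>)) \<le> (\<Sum>j. ennreal (norm (stft g (T j) x \<omega>)))" for x \<omega>
        using norm_sums_le_suminf[OF sums] by (simp add: stft_represents[OF g h])
      show "(\<lambda>\<omega>. Lp_fun p (\<lambda>x. stft g f x \<omega>)) \<in> borel_measurable lborel" if "p' = top"
      proof -
        have "(\<lambda>(\<omega>, x). ennreal (norm (stft g f x \<omega>))) \<in> borel_measurable (borel \<Otimes>\<^sub>M lborel)"
          using meas by (simp add: split_beta')
        from borel_measurable_Lp_norm[OF sigma_finite_lborel p(1) p(3)[OF that] this]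
        show ?thesis by simp
      qed
    qed (use b in auto)
    also have "\<dots> \<le> (\<Sum>j. ennreal (C * \<rho> ^ j) * B)"
    proof (rule suminf_le)
      fix j
      have "2 powr (real j * s0) = \<rho> ^ j * 2 powr (real j * s)"
        unfolding \<rho>_def by (simp add: powr_realpow[symmetric] powr_powr powr_add[symmetric] algebra_simps)
      then have "Lp_norm p' lborel (b j) \<le> ennreal (C * \<rho> ^ j * 2 powr (real j * s)) * distr_Lp_norm p (T j)"
        using b(3)[of j] by (simp add: mult.assoc)
      also have "\<dots> = ennreal (C * \<rho> ^ j) * (ennreal (2 powr (real j * s)) * distr_Lp_norm p (T j))"
        using C \<rho> by (simp add: ennreal_mult mult.assoc)
      also have "\<dots> \<le> ennreal (C * \<rho> ^ j) * B"
        by (intro mult_left_mono aB) simp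
      finally show "Lp_norm p' lborel (b j) \<le> ennreal (C * \<rho> ^ j) * B" .
    qed auto
    also have "\<dots> = ennreal K * B" by (simp only: ennreal_suminf_multc K)
    finally show ?thesis by (simp add: B_def)
  qed
  have "f \<in> modulation_space g p p'" if f: "f \<in> besov_space \<phi> p q s" for f
  proof -
    have "ennreal K * besov_norm \<phi> p q s f < \<infinity>"
      using f by (auto simp: besov_space_def ennreal_mult_less_top)
    then have "modulation_norm g p p' f < \<infinity>" using main[OF f] by (rule le_less_trans[rotated])
    with f show ?thesis by (simp add: modulation_space_def besov_space_def)
  qed
  with main show ?thesis unfolding continuously_embedded_def by blast
qed

theorem theorem5p5:
  fixes p p' :: ennreal and s :: real and g \<phi> :: "real ^ 'n \<Rightarrow> complex"
  assumes "1 \<le> p" and "1 / p + 1 / p' = 1"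
    and "g \<in> schwartz" and "g \<noteq> (\<lambda>_. 0)"
    and "dyadic_cutoff \<phi>"
  shows "(p \<le> 2 \<and> s > 0 \<longrightarrow>
      (\<forall>q\<ge>1. continuously_embedded
        (besov_space \<phi> p q s) (besov_norm \<phi> p q s)
        (modulation_space g p p') (modulation_norm g p p')))
    \<and> (2 \<le> p \<and> s > real CARD('n) * (enn2real (1 / p') - enn2real (1 / p)) \<longrightarrow>
      (\<forall>q\<ge>1. continuously_embedded
        (besov_space \<phi> p q s) (besov_norm \<phi> p q s)
        (modulation_space g p p') (modulation_norm g p p')))"
proof (intro conjI impI allI)
  \<comment> \<open>The conjugate exponent is infinite only for p = 1.\<close>
  have p': "1 \<le> p'" "p' = top \<Longrightarrow> p \<noteq> top"
    by (cases rule: conjugate_exponent_cases[OF assms(1,2)]; simp add: divide_simps)+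
  \<comment> \<open>The low case has s0 = 0, so s > 0 is exactly the gap that sums the geometric
    series.\<close>
  show "continuously_embedded (besov_space \<phi> p q s) (besov_norm \<phi> p q s)
        (modulation_space g p p') (modulation_norm g p p')"
    if "p \<le> 2 \<and> s > 0" "1 \<le> q" for q
    using dyadic_bound_low[OF assms(3,1) _ assms(2)] that
      embedding_from_dyadic_bound[OF assms(5,3,1) p'] by blast
  show "continuously_embedded (besov_space \<phi> p q s) (besov_norm \<phi> p q s)
        (modulation_space g p p') (modulation_norm g p p')"
    if "2 \<le> p \<and> s > real CARD('n) * (enn2real (1 / p') - enn2real (1 / p))" "1 \<le> q" for q
  proof -
    have "\<exists>C>0. \<exists>s0<s. dyadic_bound \<phi> g p p' C s0"
      using that by (intro dyadic_bound_high[OF assms(5,3) _ assms(2)]) auto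
    then obtain C s0 where "C > 0" "s0 < s" "dyadic_bound \<phi> g p p' C s0"
      by blast
    then show ?thesis
      using embedding_from_dyadic_bound[OF assms(5,3,1) p'] that by blast
  qed
qed

end
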